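(* Let $T>0$. Suppose that for every $j\in\mathbb{N}$, $b^j,u^j\in L^3(\mathbb{T}^3\times(0,T);\mathbb{R}^3)$ and $\Pi^j\in L^1_{loc}(\mathbb{T}^3\times(0,T))$ satisfy the ideal MHD equations $$\partial_tu^j+\operatorname{div}(u^j\otimes u^j-b^j\otimes b^j)+\nabla\Pi^j=0,\quad \partial_tb^j+\operatorname{div}(b^j\otimes u^j-u^j\otimes b^j)=0,\quad \operatorname{div}u^j=\operatorname{div}b^j=0$$ in the sense of distributions in $\mathbb{T}^3\times(0,T)$, and $\int_{\mathbb{T}^3}u^j(x,t)\,dx=\int_{\mathbb{T}^3}b^j(x,t)\,dx=0$ for a.e. $t\in(0,T)$. Suppose that $b^j\rightharpoonup b$ and $u^j\rightharpoonup u$ weakly in $L^3(\mathbb{T}^3\times(0,T);\mathbb{R}^3)$ and that $\Pi^j\rightharpoonup\Pi$ weakly in $L^1_{loc}(\mathbb{T}^3\times(0,T))$. Let $\Psi$ be the mean-zero, divergence-free vector potential of $b$. Then $(b,u,\Pi)$ conserves magnetic helicity for a.e. $t\in(0,T)$, that is, $t\mapsto\int_{\mathbb{T}^3}\Psi(x,t)\cdot b(x,t)\,dx$ is a.e. equal to a constant on $(0,T)$.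
   Context: $\mathbb{T}^3=[0,1]^3$ is the flat torus; $(v\otimes w)_{ij}=v_iw_j$; $(\operatorname{div}M)_i=\sum_j\partial_jM_{ij}$. The vector potential of $b$ is the unique $\Psi\in L^3_tW^{1,3}_x(\mathbb{T}^3\times(0,T);\mathbb{R}^3)$ with $\nabla\times\Psi=b$, $\operatorname{div}\Psi=0$ and $\int_{\mathbb{T}^3}\Psi(x,t)\,dx=0$ for a.e. $t\in(0,T)$. *)

theory Defs
  imports "HOL-Analysis.Analysis"
begin

text \<open>
  The torus is represented by its fundamental cube.  A function on the torus is a function on
  \<^typ>\<open>real^3\<close> of which only the restriction to the cube matters (opposite faces are
  null sets), except for smooth test functions, which are functions on the whole space that are
  periodic with respect to the integer lattice.
\<close>

abbreviation torus :: "(real^3) set"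
  where "torus \<equiv> cbox 0 1"

abbreviation space_time :: "real \<Rightarrow> ((real^3) \<times> real) set"
  where "space_time T \<equiv> torus \<times> {0<..<T}"

subsection \<open>Smooth functions and test functions\<close>

definition dir_deriv :: "'a::euclidean_space \<Rightarrow> ('a \<Rightarrow> real) \<Rightarrow> 'a \<Rightarrow> real"
  where "dir_deriv v f z = frechet_derivative f (at z) v"

primrec C_k :: "nat \<Rightarrow> ('a::euclidean_space \<Rightarrow> real) \<Rightarrow> bool"
  where
    "C_k 0 f \<longleftrightarrow> continuous_on UNIV f"
  | "C_k (Suc k) f \<longleftrightarrow>
       (\<forall>z. f differentiable (at z)) \<and> (\<forall>v\<in>Basis. C_k k (dir_deriv v f))"

definition smooth :: "('a::euclidean_space \<Rightarrow> real) \<Rightarrow> bool"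
  where "smooth f \<longleftrightarrow> (\<forall>k. C_k k f)"

definition torus_test :: "(real^3 \<Rightarrow> real) \<Rightarrow> bool"
  where "torus_test \<phi> \<longleftrightarrow> smooth \<phi> \<and> (\<forall>x i. \<phi> (x + axis i 1) = \<phi> x)"

text \<open>The torus being compact, compact support in the space-time cylinder only restricts
  the time variable.\<close>

definition space_time_test :: "real \<Rightarrow> ((real^3) \<times> real \<Rightarrow> real) \<Rightarrow> bool"
  where "space_time_test T \<phi> \<longleftrightarrow>
    smooth \<phi> \<and>
    (\<forall>x t i. \<phi> (x + axis i 1, t) = \<phi> (x, t)) \<and>
    (\<exists>s r. 0 < s \<and> r < T \<and> (\<forall>x t. \<phi> (x, t) \<noteq> 0 \<longrightarrow> s \<le> t \<and> t \<le> r))"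

subsection \<open>Function spaces and weak convergence\<close>

definition Lp :: "real \<Rightarrow> 'a::euclidean_space set \<Rightarrow> ('a \<Rightarrow> 'b::euclidean_space) \<Rightarrow> bool"
  where "Lp p S f \<longleftrightarrow>
    f \<in> borel_measurable (lebesgue_on S) \<and>
    integrable (lebesgue_on S) (\<lambda>z. norm (f z) powr p)"

definition Linf :: "'a::euclidean_space set \<Rightarrow> ('a \<Rightarrow> 'b::euclidean_space) \<Rightarrow> bool"
  where "Linf S f \<longleftrightarrow>
    f \<in> borel_measurable (lebesgue_on S) \<and>
    (\<exists>C. AE z in lebesgue_on S. norm (f z) \<le> C)"

definition L1_loc :: "real \<Rightarrow> ((real^3) \<times> real \<Rightarrow> real) \<Rightarrow> bool"
  where "L1_loc T f \<longleftrightarrow>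
    (\<forall>s r. 0 < s \<longrightarrow> r < T \<longrightarrow> integrable (lebesgue_on (torus \<times> {s..r})) f)"

text \<open>The test functions are taken from the dual space of \<open>L\<^sup>3\<close>, which is
  \<open>L\<^sup>3\<^sup>/\<^sup>2\<close>.\<close>

definition weakly_converges_L3 ::
  "'a::euclidean_space set \<Rightarrow> (nat \<Rightarrow> 'a \<Rightarrow> 'b::euclidean_space) \<Rightarrow> ('a \<Rightarrow> 'b) \<Rightarrow> bool"
  where "weakly_converges_L3 S fs f \<longleftrightarrow>
    (\<forall>j. Lp 3 S (fs j)) \<and> Lp 3 S f \<and>
    (\<forall>g. Lp (3/2) S g \<longrightarrow>
      (\<lambda>j. LINT z|lebesgue_on S. fs j z \<bullet> g z)
        \<longlonglongrightarrow> (LINT z|lebesgue_on S. f z \<bullet> g z))"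

text \<open>Weak convergence in the Frechet space of locally integrable functions, whose dual consists
  of the bounded functions with compact support; that is, weak convergence in \<open>L\<^sup>1\<close> on
  every compact time slab.\<close>

definition weakly_converges_L1_loc ::
  "real \<Rightarrow> (nat \<Rightarrow> (real^3) \<times> real \<Rightarrow> real) \<Rightarrow> ((real^3) \<times> real \<Rightarrow> real) \<Rightarrow> bool"
  where "weakly_converges_L1_loc T fs f \<longleftrightarrow>
    (\<forall>j. L1_loc T (fs j)) \<and> L1_loc T f \<and>
    (\<forall>s r g. 0 < s \<longrightarrow> r < T \<longrightarrow> Linf (torus \<times> {s..r}) g \<longrightarrow>
      (\<lambda>j. LINT z|lebesgue_on (torus \<times> {s..r}). fs j z * g z)
        \<longlonglongrightarrow> (LINT z|lebesgue_on (torus \<times> {s..r}). f z * g z))"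

subsection \<open>The ideal MHD equations in the sense of distributions\<close>

definition dist_deriv ::
  "real \<Rightarrow> (real^3) \<times> real \<Rightarrow> ((real^3) \<times> real \<Rightarrow> real) \<Rightarrow> ((real^3) \<times> real \<Rightarrow> real) \<Rightarrow> real"
  where "dist_deriv T v f \<phi> =
    - (LINT z|lebesgue_on (space_time T). f z * dir_deriv v \<phi> z)"

abbreviation dist_dt ::
  "real \<Rightarrow> ((real^3) \<times> real \<Rightarrow> real) \<Rightarrow> ((real^3) \<times> real \<Rightarrow> real) \<Rightarrow> real"
  where "dist_dt T \<equiv> dist_deriv T (0, 1)"

abbreviation dist_dx ::
  "real \<Rightarrow> 3 \<Rightarrow> ((real^3) \<times> real \<Rightarrow> real) \<Rightarrow> ((real^3) \<times> real \<Rightarrow> real) \<Rightarrow> real"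
  where "dist_dx T i \<equiv> dist_deriv T (axis i 1, 0)"

definition outer :: "real^3 \<Rightarrow> real^3 \<Rightarrow> real^3^3"
  where "outer v w = (\<chi> i j. v $ i * w $ j)"

definition dist_div ::
  "real \<Rightarrow> ((real^3) \<times> real \<Rightarrow> real^3) \<Rightarrow> ((real^3) \<times> real \<Rightarrow> real) \<Rightarrow> real"
  where "dist_div T v \<phi> = (\<Sum>i\<in>UNIV. dist_dx T i (\<lambda>z. v z $ i) \<phi>)"

definition dist_div_matrix ::
  "real \<Rightarrow> ((real^3) \<times> real \<Rightarrow> real^3^3) \<Rightarrow> 3 \<Rightarrow> ((real^3) \<times> real \<Rightarrow> real) \<Rightarrow> real"
  where "dist_div_matrix T M i \<phi> = (\<Sum>j\<in>UNIV. dist_dx T j (\<lambda>z. M z $ i $ j) \<phi>)"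

definition ideal_MHD ::
  "real \<Rightarrow> ((real^3) \<times> real \<Rightarrow> real^3) \<Rightarrow> ((real^3) \<times> real \<Rightarrow> real^3) \<Rightarrow>
    ((real^3) \<times> real \<Rightarrow> real) \<Rightarrow> bool"
  where "ideal_MHD T b u q \<longleftrightarrow>
    (\<forall>\<phi>. space_time_test T \<phi> \<longrightarrow>
      (\<forall>i. dist_dt T (\<lambda>z. u z $ i) \<phi>
            + dist_div_matrix T (\<lambda>z. outer (u z) (u z) - outer (b z) (b z)) i \<phi>
            + dist_dx T i q \<phi> = 0) \<and>
      (\<forall>i. dist_dt T (\<lambda>z. b z $ i) \<phi>
            + dist_div_matrix T (\<lambda>z. outer (b z) (u z) - outer (u z) (b z)) i \<phi> = 0) \<and>
      dist_div T u \<phi> = 0 \<and>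
      dist_div T b \<phi> = 0)"

definition mean_zero :: "real \<Rightarrow> ((real^3) \<times> real \<Rightarrow> real^3) \<Rightarrow> bool"
  where "mean_zero T f \<longleftrightarrow>
    (AE t in lebesgue_on {0<..<T}. (LINT x|lebesgue_on torus. f (x, t)) = 0)"

subsection \<open>Vector potential and magnetic helicity\<close>

text \<open>\<open>W13 w G\<close> says that \<open>w\<close> belongs to the Sobolev space \<open>W\<^sup>1\<^sup>,\<^sup>3\<close> of the torus, with weak
  gradient \<open>G $ i $ j = \<partial>\<^sub>j w\<^sub>i\<close>.\<close>

definition W13 :: "(real^3 \<Rightarrow> real^3) \<Rightarrow> (real^3 \<Rightarrow> real^3^3) \<Rightarrow> bool"
  where "W13 w G \<longleftrightarrow>
    Lp 3 torus w \<and> Lp 3 torus G \<and>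
    (\<forall>\<phi> i j. torus_test \<phi> \<longrightarrow>
      (LINT x|lebesgue_on torus. G x $ i $ j * \<phi> x)
        = - (LINT x|lebesgue_on torus. w x $ i * dir_deriv (axis j 1) \<phi> x))"

definition L3_W13 ::
  "real \<Rightarrow> ((real^3) \<times> real \<Rightarrow> real^3) \<Rightarrow> ((real^3) \<times> real \<Rightarrow> real^3^3) \<Rightarrow> bool"
  where "L3_W13 T \<Psi> G \<longleftrightarrow>
    Lp 3 (space_time T) \<Psi> \<and> Lp 3 (space_time T) G \<and>
    (AE t in lebesgue_on {0<..<T}. W13 (\<lambda>x. \<Psi> (x, t)) (\<lambda>x. G (x, t)))"

text \<open>The curl of a vector field in terms of its gradient matrix; the divergence is the
  trace of that matrix.\<close>

definition curl_of_grad :: "real^3^3 \<Rightarrow> real^3"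
  where "curl_of_grad G =
    vector [G $ 3 $ 2 - G $ 2 $ 3, G $ 1 $ 3 - G $ 3 $ 1, G $ 2 $ 1 - G $ 1 $ 2]"

definition vector_potential ::
  "real \<Rightarrow> ((real^3) \<times> real \<Rightarrow> real^3) \<Rightarrow> ((real^3) \<times> real \<Rightarrow> real^3) \<Rightarrow> bool"
  where "vector_potential T b \<Psi> \<longleftrightarrow>
    (\<exists>G. L3_W13 T \<Psi> G \<and>
      (AE z in lebesgue_on (space_time T). curl_of_grad (G z) = b z) \<and>
      (AE z in lebesgue_on (space_time T). trace (G z) = 0)) \<and>
    mean_zero T \<Psi>"

definition conserves_magnetic_helicity ::
  "real \<Rightarrow> ((real^3) \<times> real \<Rightarrow> real^3) \<Rightarrow> ((real^3) \<times> real \<Rightarrow> real^3) \<Rightarrow> bool"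
  where "conserves_magnetic_helicity T b \<Psi> \<longleftrightarrow>
    (\<exists>c. AE t in lebesgue_on {0<..<T}.
      (LINT x|lebesgue_on torus. \<Psi> (x, t) \<bullet> b (x, t)) = c)"

end

theory Submission
  imports Defs
begin

text \<open>
  The helicity of \<open>b\<close> is the quadratic form with Fourier symbol of order \<open>1 / \<bar>k\<bar>\<close>, so by Bessel's
  inequality its high frequencies are controlled by a small multiple of \<open>\<parallel>b\<parallel>\<^sup>2\<close>, uniformly along a weakly
  convergent sequence.  Every single mode solves an ordinary differential equation in time whose right-hand side
  is bounded in \<open>L\<^sup>1\<close>, hence converges strongly.  It remains to see that an \<open>L\<^sup>3\<close> solution conserves
  helicity.  The helicity regularised with the Fourier weights of a positive trigonometric kernel \<open>K\<^sub>N\<close> has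
  time derivative \<open>- 2 \<integral> (K\<^sub>N * b) \<bullet> (b \<times> u) dx\<close>, which tends to \<open>- 2 \<integral> b \<bullet> (b \<times> u) dx = 0\<close>, because
  convolution with a positive kernel of mass one is bounded on \<open>L\<^sup>3\<close>.  Time dependence is measured by the mean
  oscillation in \<open>L\<^sup>1(0, T)\<close>: it is stable under both limits and vanishes only for constants.
\<close>

subsection \<open>Lebesgue measure on products\<close>

text \<open>Products of weakly convergent fields need not converge to the product of the limits, so
  \<open>(b, u)\<close> need not solve ideal MHD and cannot be fed into the conservation law: only
  the \<open>bj\<close> are known to conserve helicity, and this has to survive the limit. For one
  \<open>bj\<close> the derivative of the regularised helicity tends to zero as the cut-off grows,
  but at a rate that depends on \<open>j\<close>; the frequency tail is small uniformly in
  \<open>j\<close>. This fixes the order of the limits: two cut-offs N \<le> M are compared for one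
  \<open>j\<close>, then M grows, then \<open>j\<close>, and N last. Helicity is expressed by the
  coefficients of the field alone, so potentials of the \<open>bj\<close> are never constructed; the
  given potential enters only when N grows. The exponent 3 is what makes b . (b x u) integrable. As
  b x u lies only in L^(3/2), Plancherel does not give the convergence of its pairing with the
  smoothed b; for a positive kernel it follows from Young's inequality and the density of continuous
  functions, whereas a sharp cut-off would call for singular integrals. Mean oscillation avoids
  naming the conserved values or choosing continuous representatives in time.\<close>

lemma AE_lebesgue_on_iff:
  assumes "A \<in> sets borel"
  shows "(AE x in lebesgue_on A. P x) \<longleftrightarrow> (AE x in lebesgue. x \<in> A \<longrightarrow> P x)"
  using assms by (simp add: AE_restrict_space_iff)

text \<open>\<open>AE_pair\<close> freezes the first coordinate, whereas here time, the second one,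
  is to be frozen. Hence the swap, applied to a Borel null set that covers the exceptional
  points.\<close>

lemma AE_lborel_prod_swap:
  fixes P :: "'a::euclidean_space \<times> 'b::euclidean_space \<Rightarrow> bool"
  assumes "AE z in lborel. P z"
  shows "AE t in lborel. AE x in lborel. P (x, t)"
proof -
  obtain N where N: "N \<in> null_sets lborel" "{z. \<not> P z} \<subseteq> N"
    using assms by (auto simp: eventually_ae_filter)
  have Nm: "N \<in> sets (lborel \<Otimes>\<^sub>M lborel)"
    using N(1) unfolding lborel_prod by auto
  have "AE z in lborel \<Otimes>\<^sub>M lborel. z \<notin> N"
    unfolding lborel_prod using N(1) by (rule AE_not_in)
  then have "AE z in distr (lborel \<Otimes>\<^sub>M lborel) (lborel \<Otimes>\<^sub>M lborel) (\<lambda>(x, y). (y, x)). z \<notin> N"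
    using lborel_pair.distr_pair_swap by metis
  then have "AE z in lborel \<Otimes>\<^sub>M lborel. (\<lambda>(x, y). (y, x)) z \<notin> N"
    by (rule AE_distrD[rotated]) (rule measurable_pair_swap')
  then have "AE t in lborel. AE x in lborel. (\<lambda>(x, y). (y, x)) (t, x) \<notin> N"
    by (rule lborel_pair.AE_pair)
  then show ?thesis
    using N(2) by (auto elim!: eventually_mono)
qed

lemma AE_lebesgue_on_prod:
  fixes P :: "'a::euclidean_space \<times> 'b::euclidean_space \<Rightarrow> bool"
  assumes A: "A \<in> sets borel" and B: "B \<in> sets borel"
    and P: "AE z in lebesgue_on (A \<times> B). P z"
  shows "AE t in lebesgue_on B. AE x in lebesgue_on A. P (x, t)"
proof -
  have AB: "A \<times> B \<in> sets borel"
    using A B by (rule borel_Times)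
  have "AE z in lborel. z \<in> A \<times> B \<longrightarrow> P z"
    using P by (simp add: AE_lebesgue_on_iff[OF AB] AE_completion_iff)
  then have "AE t in lborel. AE x in lborel. (x, t) \<in> A \<times> B \<longrightarrow> P (x, t)"
    by (rule AE_lborel_prod_swap)
  then have "AE t in lborel. t \<in> B \<longrightarrow> (AE x in lborel. x \<in> A \<longrightarrow> P (x, t))"
    by (auto elim!: eventually_mono)
  then have "AE t in lborel. t \<in> B \<longrightarrow> (AE x in lebesgue_on A. P (x, t))"
    by (simp add: AE_lebesgue_on_iff[OF A] AE_completion_iff)
  then show ?thesis
    by (simp add: AE_lebesgue_on_iff[OF B] AE_completion_iff)
qed

text \<open>\<open>lebesgue\<close> on the product space is the completion of the Borel product
  measure and not itself a product measure, so Fubini is applied to a Borel representative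
  \<open>G\<close> of the extension \<open>F\<close> of \<open>f\<close> by zero. For almost every
  \<open>t\<close> the slices of \<open>F\<close> and \<open>G\<close> agree almost everywhere,
  which transfers measurability, integrability and the value of the integral.\<close>

lemma lebesgue_on_Fubini:
  fixes f :: "'a::euclidean_space \<times> 'b::euclidean_space \<Rightarrow> real"
  assumes A: "A \<in> sets borel" and B: "B \<in> sets borel"
    and f: "integrable (lebesgue_on (A \<times> B)) f"
  shows "AE t in lebesgue_on B. integrable (lebesgue_on A) (\<lambda>x. f (x, t))"
    and "integrable (lebesgue_on B) (\<lambda>t. LINT x|lebesgue_on A. f (x, t))"
    and "(LINT t|lebesgue_on B. LINT x|lebesgue_on A. f (x, t)) = (LINT z|lebesgue_on (A \<times> B). f z)"
proof -
  have AB: "A \<times> B \<in> sets borel"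
    using A B by (rule borel_Times)
  define F where "F z = indicator (A \<times> B) z * f z" for z
  have F: "integrable lebesgue F"
    using f AB by (simp add: F_def[abs_def] integrable_restrict_space)
  then obtain G where G: "G \<in> borel_measurable lborel" and FG: "AE z in lborel. F z = G z"
    using completion_ex_borel_measurable_real[of F lborel] by auto
  have FG': "AE z in lebesgue. F z = G z"
    using FG by (simp add: AE_completion_iff)
  have "integrable lebesgue G"
    using F FG' G by (subst integrable_cong_AE[symmetric, of F])
      (auto intro: measurable_completion)
  then have "integrable lborel G"
    using G by (simp add: integrable_completion)
  then have Gi: "integrable (lborel \<Otimes>\<^sub>M lborel) (\<lambda>(x, t). G (x, t))"
    by (simp add: lborel_prod)
  have slice: "AE t in lborel. AE x in lborel. F (x, t) = G (x, t)"
    using FG by (rule AE_lborel_prod_swap)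
  have Gm: "(\<lambda>x. G (x, t)) \<in> borel_measurable lborel" for t
    using G by measurable
  have Fslice: "integrable lebesgue (\<lambda>x. F (x, t)) \<longleftrightarrow> integrable (lborel :: 'a measure) (\<lambda>x. G (x, t))"
      "(LINT x|lebesgue. F (x, t)) = (LINT x|lborel. G (x, t))"
    if t: "AE x in lborel. F (x, t) = G (x, t)" for t
  proof -
    have t': "AE x in lebesgue. F (x, t) = G (x, t)"
      using t by (simp add: AE_completion_iff)
    have Gm': "(\<lambda>x. G (x, t)) \<in> borel_measurable lebesgue"
      by (rule measurable_completion[OF Gm])
    have "AE x in lebesgue. G (x, t) = F (x, t)"
      using t' by eventually_elim simp
    then have Fm': "(\<lambda>x. F (x, t)) \<in> borel_measurable lebesgue"
      by (rule borel_measurable_AE[OF Gm'])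
    show "integrable lebesgue (\<lambda>x. F (x, t)) \<longleftrightarrow> integrable (lborel :: 'a measure) (\<lambda>x. G (x, t))"
      using integrable_cong_AE[OF Fm' Gm' t'] Gm by (simp add: integrable_completion)
    show "(LINT x|lebesgue. F (x, t)) = (LINT x|lborel. G (x, t))"
      using integral_cong_AE[OF Fm' Gm' t'] Gm by (simp add: integral_completion)
  qed
  have Feq: "(\<lambda>x. F (x, t)) = (\<lambda>x. indicator B t * (indicator A x * f (x, t)))" for t
    by (auto simp: F_def indicator_def)
  have "AE t in lborel. integrable (lborel :: 'a measure) (\<lambda>x. G (x, t))"
    using lborel_pair.AE_integrable_snd[OF Gi] .
  with slice have "AE t in lborel. integrable lebesgue (\<lambda>x. F (x, t))"
    by eventually_elim (simp add: Fslice)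
  then have "AE t in lborel. t \<in> B \<longrightarrow> integrable (lebesgue_on A) (\<lambda>x. f (x, t))"
    by eventually_elim (use A in \<open>auto simp: Feq integrable_restrict_space\<close>)
  then show "AE t in lebesgue_on B. integrable (lebesgue_on A) (\<lambda>x. f (x, t))"
    by (simp add: AE_lebesgue_on_iff[OF B] AE_completion_iff)
  have Hi: "integrable lborel (\<lambda>t. LINT x|lborel. G (x, t))"
    using lborel_pair.integrable_snd[OF Gi] .
  have HF: "AE t in lebesgue. (LINT x|lborel. G (x, t)) = indicator B t * (LINT x|lebesgue_on A. f (x, t))"
    unfolding AE_completion_iff
    using slice by eventually_elim (use A in \<open>simp add: Fslice(2)[symmetric] Feq integral_restrict_space\<close>)
  have Hm: "(\<lambda>t. LINT x|lborel. G (x, t)) \<in> borel_measurable lebesgue"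
    using Hi by (auto intro: measurable_completion)
  have Hm': "(\<lambda>t. indicator B t * (LINT x|lebesgue_on A. f (x, t))) \<in> borel_measurable lebesgue"
    using HF by (rule borel_measurable_AE[OF Hm])
  have "integrable lebesgue (\<lambda>t. indicator B t * (LINT x|lebesgue_on A. f (x, t)))"
    using integrable_cong_AE[OF Hm Hm' HF] Hi by (simp add: integrable_completion)
  then show "integrable (lebesgue_on B) (\<lambda>t. LINT x|lebesgue_on A. f (x, t))"
    using B by (simp add: integrable_restrict_space)
  have "(LINT t|lebesgue_on B. LINT x|lebesgue_on A. f (x, t)) =
      (LINT t|lebesgue. indicator B t * (LINT x|lebesgue_on A. f (x, t)))"
    using B by (simp add: integral_restrict_space)
  also have "\<dots> = (LINT t|lebesgue. LINT x|lborel. G (x, t))"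
    using integral_cong_AE[OF Hm Hm' HF] by simp
  also have "\<dots> = (LINT t|lborel. LINT x|lborel. G (x, t))"
    using Hi by (simp add: integral_completion)
  also have "\<dots> = (LINT z|(lborel \<Otimes>\<^sub>M lborel). G z)"
    using lborel_pair.integral_snd[OF Gi] by simp
  also have "\<dots> = (LINT z|lborel. G z)"
    by (simp add: lborel_prod)
  also have "\<dots> = (LINT z|lebesgue. G z)"
    using G by (simp add: integral_completion)
  also have "\<dots> = (LINT z|lebesgue. F z)"
    using FG' F G by (intro integral_cong_AE) (auto intro: measurable_completion elim!: eventually_mono)
  also have "\<dots> = (LINT z|lebesgue_on (A \<times> B). f z)"
    using AB by (simp add: F_def integral_restrict_space)
  finally show "(LINT t|lebesgue_on B. LINT x|lebesgue_on A. f (x, t)) = (LINT z|lebesgue_on (A \<times> B). f z)" .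
qed

subsection \<open>Fourier coefficients on the torus\<close>

definition freq :: "(3 \<Rightarrow> int) \<Rightarrow> real^3"
  where "freq k = (\<chi> i. of_int (k i))"

definition cosk :: "(3 \<Rightarrow> int) \<Rightarrow> real^3 \<Rightarrow> real"
  where "cosk k x = cos (2 * pi * (freq k \<bullet> x))"

definition sink :: "(3 \<Rightarrow> int) \<Rightarrow> real^3 \<Rightarrow> real"
  where "sink k x = sin (2 * pi * (freq k \<bullet> x))"

definition freq_box :: "nat \<Rightarrow> (3 \<Rightarrow> int) set"
  where "freq_box N = PiE UNIV (\<lambda>_. {- int N..int N})"

lemma freq_nth [simp]: "freq k $ i = of_int (k i)"
  by (simp add: freq_def)

lemma finite_freq_box [simp]: "finite (freq_box N)"
  by (simp add: freq_box_def finite_PiE)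

lemma mem_freq_box: "k \<in> freq_box N \<longleftrightarrow> (\<forall>i. \<bar>k i\<bar> \<le> int N)"
  by (auto simp: freq_box_def PiE_iff abs_le_iff minus_le_iff)

lemma freq_eq_0_iff: "freq k = 0 \<longleftrightarrow> k = (\<lambda>_. 0)"
  by (auto simp: vec_eq_iff fun_eq_iff)

lemma continuous_cosk [continuous_intros]: "continuous_on A (cosk k)"
  unfolding cosk_def[abs_def] by (intro continuous_intros)

lemma continuous_sink [continuous_intros]: "continuous_on A (sink k)"
  unfolding sink_def[abs_def] by (intro continuous_intros)

lemma cosk_measurable [measurable]: "cosk k \<in> borel_measurable (lebesgue_on A)"
  and sink_measurable [measurable]: "sink k \<in> borel_measurable (lebesgue_on A)"
  by (auto intro!: measurable_restrict_space1 measurable_completion borel_measurable_continuous_onI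
      continuous_intros)

lemma abs_cosk_le: "\<bar>cosk k x\<bar> \<le> 1" and abs_sink_le: "\<bar>sink k x\<bar> \<le> 1"
  by (simp_all add: cosk_def sink_def)

lemma cosk_0 [simp]: "cosk (\<lambda>_. 0) x = 1" and sink_0 [simp]: "sink (\<lambda>_. 0) x = 0"
  using freq_eq_0_iff[of "\<lambda>_. 0"] by (simp_all add: cosk_def sink_def)

lemma cosk_neg [simp]: "cosk (\<lambda>i. - k i) x = cosk k x"
  and sink_neg [simp]: "sink (\<lambda>i. - k i) x = - sink k x"
proof -
  have "freq (\<lambda>i. - k i) = - freq k"
    by (simp add: vec_eq_iff)
  then show "cosk (\<lambda>i. - k i) x = cosk k x" "sink (\<lambda>i. - k i) x = - sink k x"
    by (simp_all add: cosk_def sink_def)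
qed

lemma freq_add: "freq (\<lambda>i. k i + l i) = freq k + freq l"
  and freq_diff: "freq (\<lambda>i. k i - l i) = freq k - freq l"
  by (simp_all add: vec_eq_iff)

lemma cosk_times_cosk: "cosk k x * cosk l x = (cosk (\<lambda>i. k i - l i) x + cosk (\<lambda>i. k i + l i) x) / 2"
  and sink_times_sink: "sink k x * sink l x = (cosk (\<lambda>i. k i - l i) x - cosk (\<lambda>i. k i + l i) x) / 2"
  and cosk_times_sink: "cosk k x * sink l x = (sink (\<lambda>i. k i + l i) x - sink (\<lambda>i. k i - l i) x) / 2"
  by (simp_all add: cosk_def sink_def freq_add freq_diff inner_add_left inner_diff_left
      distrib_left right_diff_distrib cos_add cos_diff sin_add sin_diff)

lemma integrable_cosk [simp]: "integrable (lebesgue_on torus) (cosk k)"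
  and integrable_sink [simp]: "integrable (lebesgue_on torus) (sink k)"
  by (auto intro!: continuous_imp_integrable continuous_intros)

section \<open>Orthogonality of the trigonometric system\<close>

lemma integral_cis_unit_interval:
  "(LINT s|lborel. indicator {0..1} s *\<^sub>R cis (2 * pi * of_int m * s)) = (if m = 0 then 1 else 0)"
proof (cases "m = 0")
  case True
  then show ?thesis by simp
next
  case False
  let ?c = "2 * pi * of_int m :: real"
  have c: "?c \<noteq> 0" using False by simp
  have "(LINT s|lborel. indicator {0..1} s *\<^sub>R cis (?c * s))
      = (- \<i> / complex_of_real ?c) * cis (?c * 1) - (- \<i> / complex_of_real ?c) * cis (?c * 0)"
  proof (rule integral_FTC_atLeastAtMost)
    fix s :: real
    have cis_eq: "cis (?c * t) = exp (\<i> * (complex_of_real ?c * complex_of_real t))" for t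
      by (simp add: cis_conv_exp)
    have "((\<lambda>t. (- \<i> / complex_of_real ?c) * exp (\<i> * (complex_of_real ?c * complex_of_real t)))
        has_vector_derivative (- \<i> / complex_of_real ?c) *
          (exp (\<i> * (complex_of_real ?c * complex_of_real s)) * (\<i> * (complex_of_real ?c * 1))))
        (at s within {0..1})"
      by (rule has_vector_derivative_mult_right, rule has_vector_derivative_real_field)
         (auto intro!: derivative_eq_intros)
    moreover have "(- \<i> / complex_of_real ?c) *
          (exp (\<i> * (complex_of_real ?c * complex_of_real s)) * (\<i> * (complex_of_real ?c * 1)))
        = exp (\<i> * (complex_of_real ?c * complex_of_real s))"
      using c by (simp add: field_simps)
    ultimately show "((\<lambda>t. (- \<i> / complex_of_real ?c) * cis (?c * t)) has_vector_derivative cis (?c * s))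
        (at s within {0..1})"
      by (simp only: cis_eq)
  qed (auto intro!: continuous_intros)
  also have "\<dots> = 0"
    using cis_multiple_2pi[of "of_int m"] by (simp add: mult.commute mult.left_commute)
  finally show ?thesis using False by simp
qed

text \<open>\<open>lborel\<close> is the image of a product of one-dimensional measures indexed by
  \<open>Basis\<close>; the indicator of the cube and the character both factor along it.\<close>

lemma integral_cis_torus:
  "(LINT x|lebesgue_on torus. cis (2 * pi * (freq k \<bullet> x))) = (if k = (\<lambda>_. 0) then 1 else 0)"
proof -
  let ?B = "Basis :: (real^3) set"
  interpret product_sigma_finite "\<lambda>_::real^3. lborel :: real measure" ..
  have coord: "\<exists>m. freq k \<bullet> b = of_int m" if b: "b \<in> ?B" for b
    using b by (auto simp: Basis_vec_def inner_axis)
  have one: "(LINT s|lborel. indicator {0..1} s *\<^sub>R cis (2 * pi * (freq k \<bullet> b) * s))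
      = (if freq k \<bullet> b = 0 then 1 else 0)" if b: "b \<in> ?B" for b
    using coord[OF b] by (metis integral_cis_unit_interval of_int_eq_0_iff)
  have int: "integrable lborel (\<lambda>s::real. indicator {0..1} s *\<^sub>R cis (2 * pi * (freq k \<bullet> b) * s))" for b
    by (rule borel_integrable_compact) (auto intro!: continuous_intros)
  have meas: "(\<lambda>x::real^3. indicator torus x *\<^sub>R cis (2 * pi * (freq k \<bullet> x))) \<in> borel_measurable borel"
    by (intro borel_measurable_scaleR borel_measurable_indicator borel_measurable_continuous_onI
        continuous_intros) auto
  have pt: "indicator torus (\<Sum>b\<in>?B. f b *\<^sub>R b) *\<^sub>R cis (2 * pi * (freq k \<bullet> (\<Sum>b\<in>?B. f b *\<^sub>R b)))
      = (\<Prod>b\<in>?B. indicator {0..1} (f b) *\<^sub>R cis (2 * pi * (freq k \<bullet> b) * f b))" for f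
  proof -
    have "indicator torus (\<Sum>b\<in>?B. f b *\<^sub>R b) = (\<Prod>b\<in>?B. indicator {0..1} (f b) :: real)"
    proof -
      have inner: "(\<Sum>b\<in>?B. f b *\<^sub>R b) \<bullet> c = f c" if "c \<in> ?B" for c
        using that by simp
      have le: "(0::real^3) \<bullet> c = 0" "(1::real^3) \<bullet> c = 1" if "c \<in> ?B" for c
        using that by (auto simp: Basis_vec_def inner_axis)
      show ?thesis
        by (cases "\<forall>c\<in>?B. f c \<in> {0..1}")
           (auto simp: mem_box inner le indicator_def prod_zero_iff intro!: prod.neutral)
    qed
    moreover have "cis (2 * pi * (freq k \<bullet> (\<Sum>b\<in>?B. f b *\<^sub>R b)))
        = (\<Prod>b\<in>?B. cis (2 * pi * (freq k \<bullet> b) * f b))"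
    proof -
      have "2 * pi * (freq k \<bullet> (\<Sum>b\<in>?B. f b *\<^sub>R b)) = (\<Sum>b\<in>?B. 2 * pi * (freq k \<bullet> b) * f b)"
        by (simp add: inner_sum_right sum_distrib_left mult_ac)
      moreover have "cis (\<Sum>b\<in>A. g b) = (\<Prod>b\<in>A. cis (g b))" if "finite A" for A and g :: "real^3 \<Rightarrow> real"
        using that by induction (auto simp: cis_mult[symmetric])
      ultimately show ?thesis by simp
    qed
    ultimately show ?thesis
      by (simp add: scaleR_conv_of_real prod.distrib)
  qed
  have "(LINT x|lebesgue_on torus. cis (2 * pi * (freq k \<bullet> x)))
      = (LINT x|lebesgue. indicator torus x *\<^sub>R cis (2 * pi * (freq k \<bullet> x)))"
    by (simp add: integral_restrict_space)
  also have "\<dots> = (LINT x|lborel. indicator torus x *\<^sub>R cis (2 * pi * (freq k \<bullet> x)))"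
    using meas by (simp add: integral_completion)
  also have "\<dots> = (LINT f|(\<Pi>\<^sub>M b\<in>?B. lborel). (\<Prod>b\<in>?B. indicator {0..1} (f b) *\<^sub>R cis (2 * pi * (freq k \<bullet> b) * f b)))"
    unfolding lborel_eq[where 'a="real^3"] using meas by (subst integral_distr) (auto simp: pt)
  also have "\<dots> = (\<Prod>b\<in>?B. LINT s|lborel. indicator {0..1} s *\<^sub>R cis (2 * pi * (freq k \<bullet> b) * s))"
    by (rule product_integral_prod) (auto simp: int)
  also have "\<dots> = (\<Prod>b\<in>?B. if freq k \<bullet> b = 0 then 1 else 0)"
    by (rule prod.cong) (auto simp: one)
  also have "\<dots> = (if freq k = 0 then 1 else 0)"
    by (auto simp: euclidean_all_zero_iff intro: euclidean_eqI)
  finally show ?thesis by (simp add: freq_eq_0_iff)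
qed

lemma integral_cosk: "(LINT x|lebesgue_on torus. cosk k x) = (if k = (\<lambda>_. 0) then 1 else 0)"
  and integral_sink: "(LINT x|lebesgue_on torus. sink k x) = 0"
proof -
  have i: "integrable (lebesgue_on torus) (\<lambda>x. cis (2 * pi * (freq k \<bullet> x)))"
    by (intro continuous_imp_integrable continuous_intros)
  show "(LINT x|lebesgue_on torus. cosk k x) = (if k = (\<lambda>_. 0) then 1 else 0)"
    using integral_Re[OF i] by (simp add: integral_cis_torus cosk_def)
  show "(LINT x|lebesgue_on torus. sink k x) = 0"
    using integral_Im[OF i] by (simp add: integral_cis_torus sink_def)
qed

lemma integrable_mult_bounded:
  fixes f g :: "'a \<Rightarrow> real"
  assumes "integrable M f" "g \<in> borel_measurable M" "\<And>x. x \<in> space M \<Longrightarrow> \<bar>g x\<bar> \<le> C"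
  shows "integrable M (\<lambda>x. f x * g x)"
proof (rule Bochner_Integration.integrable_bound)
  show "integrable M (\<lambda>x. C * f x)"
    using assms(1) by simp
  show "AE x in M. norm (f x * g x) \<le> norm (C * f x)"
  proof (rule AE_I2)
    fix x assume "x \<in> space M"
    then have "\<bar>g x\<bar> \<le> \<bar>C\<bar>" using assms(3) by fastforce
    then show "norm (f x * g x) \<le> norm (C * f x)"
      by (simp add: abs_mult mult.commute[of "\<bar>f x\<bar>"] mult_right_mono)
  qed
qed (use assms in simp)

text \<open>Real coefficients, because test functions are real-valued. Sums run over symmetric
  frequency boxes, where each pair k, -k is counted twice; this absorbs the usual factor 2 of real
  Fourier series.\<close>

definition fcos :: "(3 \<Rightarrow> int) \<Rightarrow> (real^3 \<Rightarrow> real) \<Rightarrow> real"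
  where "fcos k f = (LINT x|lebesgue_on torus. f x * cosk k x)"

definition fsin :: "(3 \<Rightarrow> int) \<Rightarrow> (real^3 \<Rightarrow> real) \<Rightarrow> real"
  where "fsin k f = (LINT x|lebesgue_on torus. f x * sink k x)"

lemma integrable_times_cosk:
  "integrable (lebesgue_on torus) f \<Longrightarrow> integrable (lebesgue_on torus) (\<lambda>x. f x * cosk k x)"
  by (rule integrable_mult_bounded[where C = 1]) (auto intro: abs_cosk_le)

lemma integrable_times_sink:
  "integrable (lebesgue_on torus) f \<Longrightarrow> integrable (lebesgue_on torus) (\<lambda>x. f x * sink k x)"
  by (rule integrable_mult_bounded[where C = 1]) (auto intro: abs_sink_le)

lemma fcos_neg [simp]: "fcos (\<lambda>i. - k i) f = fcos k f"
  and fsin_neg [simp]: "fsin (\<lambda>i. - k i) f = - fsin k f"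
  by (simp_all add: fcos_def fsin_def)

lemma fcos_0: "fcos (\<lambda>_. 0) f = (LINT x|lebesgue_on torus. f x)" and fsin_0 [simp]: "fsin (\<lambda>_. 0) f = 0"
  by (simp_all add: fcos_def fsin_def)

section \<open>Trigonometric polynomials and Bessel's inequality\<close>

definition trig_poly :: "(3 \<Rightarrow> int) set \<Rightarrow> ((3 \<Rightarrow> int) \<Rightarrow> real) \<Rightarrow> ((3 \<Rightarrow> int) \<Rightarrow> real) \<Rightarrow> real^3 \<Rightarrow> real"
  where "trig_poly F a s x = (\<Sum>k\<in>F. a k * cosk k x + s k * sink k x)"

lemma continuous_trig_poly: "continuous_on A (trig_poly F a s)"
  unfolding trig_poly_def[abs_def] by (intro continuous_intros)

lemma integrable_trig_poly_mult:
  assumes f: "integrable (lebesgue_on torus) f"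
  shows "integrable (lebesgue_on torus) (\<lambda>x. trig_poly F a s x * f x)"
proof -
  have "(\<lambda>x. trig_poly F a s x * f x) = (\<lambda>x. \<Sum>k\<in>F. a k * (f x * cosk k x) + s k * (f x * sink k x))"
    by (simp add: trig_poly_def sum_distrib_left sum_distrib_right algebra_simps)
  then show ?thesis
    by (simp add: integrable_times_cosk[OF f] integrable_times_sink[OF f])
qed

lemma integral_trig_poly_mult:
  assumes f: "integrable (lebesgue_on torus) f"
  shows "(LINT x|lebesgue_on torus. trig_poly F a s x * f x) = (\<Sum>k\<in>F. a k * fcos k f + s k * fsin k f)"
proof -
  have "(LINT x|lebesgue_on torus. trig_poly F a s x * f x)
      = (LINT x|lebesgue_on torus. (\<Sum>k\<in>F. a k * (f x * cosk k x) + s k * (f x * sink k x)))"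
    by (simp add: trig_poly_def sum_distrib_left sum_distrib_right algebra_simps)
  also have "\<dots> = (\<Sum>k\<in>F. a k * fcos k f + s k * fsin k f)"
    by (simp add: integrable_times_cosk[OF f] integrable_times_sink[OF f] fcos_def fsin_def)
  finally show ?thesis .
qed

lemma neg_mem_freq_box: "(\<lambda>i. - k i) \<in> freq_box N \<longleftrightarrow> k \<in> freq_box N"
  by (simp add: mem_freq_box)

text \<open>The modes l and -l coincide up to the sign of the sine, so both of them match k. At
  frequency zero the two matches coincide: they add up to 1 for the cosine and cancel for the
  sine.\<close>

lemma fcos_cosk: "fcos k (cosk l) = ((if l = k then 1 else 0) + (if l = (\<lambda>i. - k i) then 1 else 0)) / 2"
  and fcos_sink: "fcos k (sink l) = 0" and fsin_cosk: "fsin k (cosk l) = 0"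
  and fsin_sink: "fsin k (sink l) = ((if l = k then 1 else 0) - (if l = (\<lambda>i. - k i) then 1 else 0)) / 2"
  by (auto simp: fcos_def fsin_def cosk_times_cosk sink_times_sink cosk_times_sink integral_cosk integral_sink
      mult.commute[of "sink _ _" "cosk _ _"] fun_eq_iff add_eq_0_iff)

text \<open>\<open>P\<close> is the partial Fourier sum of \<open>f\<close>. The integrals of
  \<open>P * f\<close> and of \<open>P * P\<close> are both \<open>S\<close>, so the nonnegative
  integral of the square of \<open>f - P\<close> equals the integral of the square of
  \<open>f\<close> minus \<open>S\<close>.\<close>

lemma bessel_inequality:
  assumes f: "integrable (lebesgue_on torus) f" and f2: "integrable (lebesgue_on torus) (\<lambda>x. (f x)\<^sup>2)"
  shows "(\<Sum>k\<in>freq_box N. (fcos k f)\<^sup>2 + (fsin k f)\<^sup>2) \<le> (LINT x|lebesgue_on torus. (f x)\<^sup>2)"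
proof -
  let ?F = "freq_box N" and ?a = "\<lambda>k. fcos k f" and ?s = "\<lambda>k. fsin k f"
  define P where "P = trig_poly ?F ?a ?s"
  define S where "S = (\<Sum>k\<in>?F. (fcos k f)\<^sup>2 + (fsin k f)\<^sup>2)"
  have Pc: "continuous_on torus P"
    unfolding P_def by (rule continuous_trig_poly)
  have Pi: "integrable (lebesgue_on torus) P"
    using Pc by (rule continuous_imp_integrable)
  have fP: "(LINT x|lebesgue_on torus. P x * f x) = S"
    by (simp add: P_def integral_trig_poly_mult[OF f] S_def power2_eq_square)
  \<comment> \<open>Orthogonality yields one half from l = k and one half from l = -k. They add up
    to the full coefficient because the box is symmetric, the cosine coefficients are even and the
    sine coefficients are odd in the frequency.\<close>
  have cP: "fcos k P = fcos k f" "fsin k P = fsin k f" if k: "k \<in> ?F" for k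
  proof -
    have "fcos k P = (LINT x|lebesgue_on torus. P x * cosk k x)"
      by (simp add: fcos_def)
    also have "\<dots> = (\<Sum>l\<in>?F. ?a l * fcos l (cosk k) + ?s l * fsin l (cosk k))"
      unfolding P_def by (rule integral_trig_poly_mult) simp
    also have "\<dots> = (\<Sum>l\<in>?F. (if l = k then ?a l / 2 else 0)) + (\<Sum>l\<in>?F. (if l = (\<lambda>i. - k i) then ?a l / 2 else 0))"
      unfolding sum.distrib[symmetric]
      by (intro sum.cong) (auto simp: fcos_cosk fsin_cosk fun_eq_iff)
    also have "\<dots> = fcos k f"
      using k by (simp add: neg_mem_freq_box)
    finally show "fcos k P = fcos k f" .
    have "fsin k P = (LINT x|lebesgue_on torus. P x * sink k x)"
      by (simp add: fsin_def)
    also have "\<dots> = (\<Sum>l\<in>?F. ?a l * fcos l (sink k) + ?s l * fsin l (sink k))"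
      unfolding P_def by (rule integral_trig_poly_mult) simp
    also have "\<dots> = (\<Sum>l\<in>?F. (if l = k then ?s l / 2 else 0)) - (\<Sum>l\<in>?F. (if l = (\<lambda>i. - k i) then ?s l / 2 else 0))"
      unfolding sum_subtractf[symmetric]
      by (intro sum.cong) (auto simp: fcos_sink fsin_sink fun_eq_iff)
    also have "\<dots> = fsin k f"
      using k by (simp add: neg_mem_freq_box)
    finally show "fsin k P = fsin k f" .
  qed
  have PP: "(LINT x|lebesgue_on torus. P x * P x) = S"
    unfolding P_def[of] integral_trig_poly_mult[OF Pi[unfolded P_def]]
    by (simp add: P_def[symmetric] cP S_def power2_eq_square)
  have iPP: "integrable (lebesgue_on torus) (\<lambda>x. P x * P x)"
    by (intro continuous_imp_integrable continuous_intros Pc)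
  have iPf: "integrable (lebesgue_on torus) (\<lambda>x. P x * f x)"
    unfolding P_def by (rule integrable_trig_poly_mult[OF f])
  have "0 \<le> (LINT x|lebesgue_on torus. (f x - P x)\<^sup>2)"
    by simp
  also have "(\<lambda>x. (f x - P x)\<^sup>2) = (\<lambda>x. (f x)\<^sup>2 - 2 * (P x * f x) + P x * P x)"
    by (simp add: fun_eq_iff power2_eq_square algebra_simps)
  also have "(LINT x|lebesgue_on torus. (f x)\<^sup>2 - 2 * (P x * f x) + P x * P x)
      = (LINT x|lebesgue_on torus. (f x)\<^sup>2) - 2 * S + S"
    using f2 iPf iPP by (simp add: fP PP)
  finally show ?thesis by (simp add: S_def)
qed

subsection \<open>A positive trigonometric approximate identity\<close>

text \<open>These are the Fourier coefficients of a multiple of cos(pi s)^(2 N), normalised to mean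
  one: the de la Vallee Poussin kernel.\<close>

definition wt :: "nat \<Rightarrow> int \<Rightarrow> real"
  where "wt N m = real ((2 * N) choose (N + nat \<bar>m\<bar>)) / real ((2 * N) choose N)"

lemma wt_nonneg: "0 \<le> wt N m" and wt_le_1: "wt N m \<le> 1" and wt_0 [simp]: "wt N 0 = 1"
  using binomial_maximum'[of N "N + nat \<bar>m\<bar>"] by (auto simp: wt_def divide_le_eq_1)

lemma wt_eq_0: "int N < \<bar>m\<bar> \<Longrightarrow> wt N m = 0"
  by (simp add: wt_def binomial_eq_0)

text \<open>Induction on |m|: passing from n to n + 1 multiplies the weight by (N - n) / (N + n +
  1), which tends to 1 for fixed n.\<close>

lemma wt_tendsto_1: "(\<lambda>N. wt N m) \<longlonglongrightarrow> 1"
proof -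
  have "(\<lambda>N. wt N (int n)) \<longlonglongrightarrow> 1" for n
  proof (induction n)
    case 0
    then show ?case by simp
  next
    case (Suc n)
    have step: "wt N (int (Suc n)) = wt N (int n) * ((real N - real n) / (real N + real n + 1))" for N
    proof -
      have "Suc (N + n) * ((2 * N) choose (Suc (N + n))) = (2 * N - (N + n)) * ((2 * N) choose (N + n))"
        by (simp only: binomial_absorption binomial_absorb_comp)
      then have "real (Suc (N + n)) * real ((2 * N) choose (Suc (N + n)))
          = real (2 * N - (N + n)) * real ((2 * N) choose (N + n))"
        by (metis of_nat_mult)
      \<comment> \<open>For N < n the natural-number difference is cut off at 0, but then the
        binomial coefficient vanishes as well.\<close>
      moreover have "real (2 * N - (N + n)) * real ((2 * N) choose (N + n))
          = (real N - real n) * real ((2 * N) choose (N + n))"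
        by (cases "n \<le> N") (auto simp: of_nat_diff binomial_eq_0)
      ultimately have "real ((2 * N) choose (Suc (N + n)))
          = real ((2 * N) choose (N + n)) * ((real N - real n) / (real N + real n + 1))"
        by (simp add: field_simps)
      then show ?thesis by (simp add: wt_def nat_add_distrib)
    qed
    have "(\<lambda>N. (real N - real n) / (real N + real n + 1)) \<longlonglongrightarrow> 1"
    proof -
      have "(\<lambda>N. inverse ((real n + 1) + real N)) \<longlonglongrightarrow> 0"
        by (rule tendsto_inverse_0_at_top[OF filterlim_tendsto_add_at_top[OF tendsto_const filterlim_real_sequentially]])
      from tendsto_diff[OF tendsto_const[of 1] tendsto_mult[OF tendsto_const[of "2 * real n + 1"] this]]
      have "(\<lambda>N. 1 - (2 * real n + 1) * inverse ((real n + 1) + real N)) \<longlonglongrightarrow> 1"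
        by simp
      moreover have "1 - (2 * real n + 1) * inverse ((real n + 1) + real N) = (real N - real n) / (real N + real n + 1)" for N
        by (simp add: field_simps)
      ultimately show ?thesis by simp
    qed
    from tendsto_mult[OF Suc this] show ?case
      unfolding step by simp
  qed
  from this[of "nat \<bar>m\<bar>"] show ?thesis
    by (simp add: wt_def)
qed

text \<open>Expand the power 2 N of 2 cos(pi s), written as \<open>cis (pi * s)\<close> plus its
  conjugate. The term j has frequency j - N, and by the symmetry of the binomial coefficients its
  coefficient depends on |j - N| only.\<close>

lemma sum_wt_cis:
  "(\<Sum>m=-int N..int N. of_real (wt N m) * cis (2 * pi * of_int m * s))
    = of_real (4 ^ N / real ((2 * N) choose N) * cos (pi * s) ^ (2 * N))"
proof -
  have "(2 * cos (pi * s)) ^ (2 * N) = 4 ^ N * cos (pi * s) ^ (2 * N)"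
    by (simp add: power_mult power_mult_distrib)
  then have "of_real (4 ^ N * cos (pi * s) ^ (2 * N)) = (of_real (2 * cos (pi * s)) :: complex) ^ (2 * N)"
    by (metis of_real_power)
  also have "of_real (2 * cos (pi * s)) = cis (pi * s) + cis (- (pi * s))"
    by (simp add: complex_eq_iff)
  also have "(cis (pi * s) + cis (- (pi * s))) ^ (2 * N)
      = (\<Sum>j\<le>2 * N. of_nat ((2 * N) choose j) * cis (pi * s) ^ j * cis (- (pi * s)) ^ (2 * N - j))"
    by (rule binomial_ring)
  also have "\<dots> = (\<Sum>j\<le>2 * N. of_nat ((2 * N) choose j) * cis (2 * pi * of_int (int j - int N) * s))"
  proof (rule sum.cong[OF refl])
    fix j assume "j \<in> {..2 * N}"
    then have "real j * (pi * s) + real (2 * N - j) * - (pi * s) = 2 * pi * of_int (int j - int N) * s"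
      by (simp add: of_nat_diff algebra_simps)
    then have "cis (pi * s) ^ j * cis (- (pi * s)) ^ (2 * N - j) = cis (2 * pi * of_int (int j - int N) * s)"
      unfolding Complex.DeMoivre cis_mult by (rule arg_cong)
    then show "of_nat ((2 * N) choose j) * cis (pi * s) ^ j * cis (- (pi * s)) ^ (2 * N - j)
        = of_nat ((2 * N) choose j) * cis (2 * pi * of_int (int j - int N) * s)"
      by (simp add: mult.assoc)
  qed
  also have "\<dots> = (\<Sum>m=-int N..int N. of_nat ((2 * N) choose (N + nat \<bar>m\<bar>)) * cis (2 * pi * of_int m * s))"
  proof (rule sum.reindex_bij_witness[of _ "\<lambda>m. nat (m + int N)" "\<lambda>j. int j - int N"])
    fix j assume j: "j \<in> {..2 * N}"
    have "(2 * N) choose (N + nat \<bar>int j - int N\<bar>) = (2 * N) choose j"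
    proof (cases "N \<le> j")
      case True
      then have "N + nat \<bar>int j - int N\<bar> = j" by linarith
      then show ?thesis by presburger
    next
      case False
      then have "N + nat \<bar>int j - int N\<bar> = 2 * N - j" by linarith
      then show ?thesis using j binomial_symmetric[of j "2 * N"] by (metis atMost_iff)
    qed
    then show "of_nat ((2 * N) choose (N + nat \<bar>int j - int N\<bar>)) * cis (2 * pi * of_int (int j - int N) * s)
        = of_nat ((2 * N) choose j) * cis (2 * pi * of_int (int j - int N) * s)" by simp
  qed auto
  finally have *: "of_real (4 ^ N * cos (pi * s) ^ (2 * N))
      = (\<Sum>m=-int N..int N. of_nat ((2 * N) choose (N + nat \<bar>m\<bar>)) * cis (2 * pi * of_int m * s))" .
  have "(\<Sum>m=-int N..int N. of_real (wt N m) * cis (2 * pi * of_int m * s))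
      = (\<Sum>m=-int N..int N. of_nat ((2 * N) choose (N + nat \<bar>m\<bar>)) * cis (2 * pi * of_int m * s)) / of_nat ((2 * N) choose N)"
    unfolding sum_divide_distrib by (intro sum.cong) (auto simp: wt_def)
  also have "\<dots> = of_real (4 ^ N / real ((2 * N) choose N) * cos (pi * s) ^ (2 * N))"
    unfolding *[symmetric] by simp
  finally show ?thesis .
qed

definition freq_weight :: "nat \<Rightarrow> (3 \<Rightarrow> int) \<Rightarrow> real"
  where "freq_weight N k = (\<Prod>i\<in>UNIV. wt N (k i))"

lemma freq_weight_nonneg: "0 \<le> freq_weight N k" and freq_weight_le_1: "freq_weight N k \<le> 1"
  and freq_weight_0 [simp]: "freq_weight N (\<lambda>_. 0) = 1"
  by (auto simp: freq_weight_def wt_nonneg wt_le_1 intro!: prod_nonneg prod_le_1)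

lemma freq_weight_eq_0: "k \<notin> freq_box N \<Longrightarrow> freq_weight N k = 0"
  by (auto simp: freq_weight_def mem_freq_box not_le intro: wt_eq_0)

lemma freq_weight_tendsto_1: "(\<lambda>N. freq_weight N k) \<longlonglongrightarrow> 1"
  unfolding freq_weight_def using tendsto_prod[of UNIV "\<lambda>i N. wt N (k i)" "\<lambda>_. 1"] wt_tendsto_1 by simp

definition kernel :: "nat \<Rightarrow> real^3 \<Rightarrow> real"
  where "kernel N z = (\<Sum>k\<in>freq_box N. freq_weight N k * cosk k z)"

text \<open>Weights and characters are products over the coordinates and the box is a
  \<open>PiE\<close>, so the triple sum factors into one-dimensional sums. The closed form exhibits
  both positivity, as only even powers of cosines occur, and decay away from the lattice.\<close>

lemma kernel_eq: "kernel N z = (\<Prod>i\<in>UNIV. 4 ^ N / real ((2 * N) choose N) * cos (pi * z $ i) ^ (2 * N))"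
proof -
  have cis_sum: "cis (\<Sum>b\<in>A. g b) = (\<Prod>b\<in>A. cis (g b))" if "finite A" for A and g :: "3 \<Rightarrow> real"
    using that by induction (auto simp: cis_mult[symmetric])
  have "kernel N z = Re (\<Sum>k\<in>freq_box N. of_real (freq_weight N k) * cis (2 * pi * (freq k \<bullet> z)))"
    by (simp add: kernel_def cosk_def)
  also have "(\<Sum>k\<in>freq_box N. of_real (freq_weight N k) * cis (2 * pi * (freq k \<bullet> z)))
      = (\<Sum>k\<in>freq_box N. \<Prod>i\<in>UNIV. of_real (wt N (k i)) * cis (2 * pi * of_int (k i) * z $ i))"
  proof (rule sum.cong[OF refl])
    fix k assume "k \<in> freq_box N"
    have "2 * pi * (freq k \<bullet> z) = (\<Sum>i\<in>UNIV. 2 * pi * of_int (k i) * z $ i)"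
      by (simp add: inner_vec_def sum_distrib_left mult.assoc)
    then show "of_real (freq_weight N k) * cis (2 * pi * (freq k \<bullet> z))
        = (\<Prod>i\<in>UNIV. of_real (wt N (k i)) * cis (2 * pi * of_int (k i) * z $ i))"
      by (simp add: freq_weight_def cis_sum prod.distrib)
  qed
  also have "\<dots> = (\<Prod>i\<in>UNIV. \<Sum>m=-int N..int N. of_real (wt N m) * cis (2 * pi * of_int m * z $ i))"
    unfolding freq_box_def by (rule prod_sum_PiE[symmetric]) auto
  also have "\<dots> = of_real (\<Prod>i\<in>UNIV. 4 ^ N / real ((2 * N) choose N) * cos (pi * z $ i) ^ (2 * N))"
    by (simp only: sum_wt_cis of_real_prod)
  finally show ?thesis by (simp only: Re_complex_of_real)
qed

lemma kernel_nonneg: "0 \<le> kernel N z"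
  unfolding kernel_eq by (intro prod_nonneg) (auto intro!: mult_nonneg_nonneg simp: power_mult)

text \<open>The normalising constant in each coordinate is at most 2 N, by the lower bound on the
  central binomial coefficient. This is polynomial growth, to be defeated by the N-th power of a
  number below 1.\<close>

lemma kernel_le:
  assumes "N > 0"
  shows "kernel N z \<le> (2 * real N) ^ 3 * (\<Prod>i\<in>UNIV. (cos (pi * z $ i))\<^sup>2) ^ N"
proof -
  have "4 ^ N / real ((2 * N) choose N) \<le> 2 * real N"
    using central_binomial_lower_bound[OF assms] assms by (simp add: field_simps)
  then have "kernel N z \<le> (\<Prod>i\<in>(UNIV::3 set). 2 * real N * cos (pi * z $ i) ^ (2 * N))"
    unfolding kernel_eq
    by (intro prod_mono conjI mult_right_mono mult_nonneg_nonneg) (auto simp: power_mult)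
  also have "\<dots> = (2 * real N) ^ 3 * (\<Prod>i\<in>UNIV. (cos (pi * z $ i))\<^sup>2) ^ N"
    by (simp add: prod.distrib power_mult prod_power_distrib)
  finally show ?thesis .
qed

section \<open>Convolution with the kernel\<close>

lemma kernel_diff:
  "kernel N (x - y) = trig_poly (freq_box N) (\<lambda>k. freq_weight N k * cosk k x) (\<lambda>k. freq_weight N k * sink k x) y"
  by (simp add: kernel_def trig_poly_def cosk_def sink_def inner_diff_right right_diff_distrib cos_diff
      distrib_left mult.assoc)

text \<open>Defined through coefficients, which makes it a trigonometric polynomial for every
  \<open>f\<close>; for integrable \<open>f\<close> it is the convolution with
  \<open>kernel N\<close>, by \<open>smoothing_eq\<close>.\<close>

definition smoothing :: "nat \<Rightarrow> (real^3 \<Rightarrow> real) \<Rightarrow> real^3 \<Rightarrow> real"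
  where "smoothing N f = trig_poly (freq_box N) (\<lambda>k. freq_weight N k * fcos k f) (\<lambda>k. freq_weight N k * fsin k f)"

text \<open>The pairing of the smoothed \<open>f\<close> with \<open>g\<close>, in a form symmetric
  in the two functions. Both the time derivative of the regularised helicity and the regularised
  helicity itself turn out to be such pairings.\<close>

definition smooth_pairing :: "nat \<Rightarrow> (real^3 \<Rightarrow> real) \<Rightarrow> (real^3 \<Rightarrow> real) \<Rightarrow> real"
  where "smooth_pairing N f g = (\<Sum>k\<in>freq_box N. freq_weight N k * (fcos k f * fcos k g + fsin k f * fsin k g))"

lemma integrable_kernel_mult:
  "integrable (lebesgue_on torus) f \<Longrightarrow> integrable (lebesgue_on torus) (\<lambda>y. kernel N (x - y) * f y)"
  unfolding kernel_diff by (rule integrable_trig_poly_mult)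

lemma smoothing_eq:
  assumes f: "integrable (lebesgue_on torus) f"
  shows "smoothing N f x = (LINT y|lebesgue_on torus. kernel N (x - y) * f y)"
  unfolding kernel_diff integral_trig_poly_mult[OF f]
  by (simp add: smoothing_def trig_poly_def mult_ac)

lemma integrable_smoothing: "integrable (lebesgue_on torus) (smoothing N f)"
  unfolding smoothing_def by (intro continuous_imp_integrable continuous_trig_poly)

lemma integrable_const_torus [simp]: "integrable (lebesgue_on torus) (\<lambda>_::real^3. c :: real)"
  by (intro continuous_imp_integrable continuous_intros)

lemma measure_torus [simp]: "measure (lebesgue_on torus) torus = 1"
  using integral_cosk[of "\<lambda>_. 0"] by simp

lemma fcos_const: "fcos k (\<lambda>_. c) = (if k = (\<lambda>_. 0) then c else 0)" and fsin_const: "fsin k (\<lambda>_. c) = 0"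
  by (simp_all add: fcos_def fsin_def integral_cosk integral_sink)

lemma zero_in_freq_box [simp]: "(\<lambda>_. 0) \<in> freq_box N"
  by (simp add: mem_freq_box)

lemma smoothing_const [simp]: "smoothing N (\<lambda>_. c) x = c"
proof -
  have "smoothing N (\<lambda>_. c) x = (\<Sum>k\<in>freq_box N. if k = (\<lambda>_. 0) then c else 0)"
    unfolding smoothing_def trig_poly_def
    by (intro sum.cong) (auto simp: fcos_const fsin_const)
  then show ?thesis by simp
qed

lemma integral_smoothing_mult:
  "integrable (lebesgue_on torus) g \<Longrightarrow>
    (LINT x|lebesgue_on torus. smoothing N f x * g x) = smooth_pairing N f g"
  by (simp add: smoothing_def integral_trig_poly_mult smooth_pairing_def distrib_left mult.assoc)

lemma integral_smoothing: "(LINT x|lebesgue_on torus. smoothing N f x) = (LINT x|lebesgue_on torus. f x)"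
proof -
  have "(LINT x|lebesgue_on torus. smoothing N f x * 1) = smooth_pairing N f (\<lambda>_. 1)"
    by (rule integral_smoothing_mult) simp
  also have "\<dots> = (\<Sum>k\<in>freq_box N. if k = (\<lambda>_. 0) then fcos k f else 0)"
    unfolding smooth_pairing_def by (intro sum.cong) (auto simp: fcos_const fsin_const)
  finally show ?thesis by (simp add: fcos_0)
qed

lemma kernel_mean: "(LINT y|lebesgue_on torus. kernel N (x - y)) = 1"
  using smoothing_eq[of "\<lambda>_. 1" N x] by simp

lemma abs_smoothing_le:
  assumes f: "integrable (lebesgue_on torus) f"
  shows "\<bar>smoothing N f x\<bar> \<le> smoothing N (\<lambda>x. \<bar>f x\<bar>) x"
proof -
  have "\<bar>smoothing N f x\<bar> \<le> (LINT y|lebesgue_on torus. \<bar>kernel N (x - y) * f y\<bar>)"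
    unfolding smoothing_eq[OF f] by (rule integral_abs_bound)
  then show ?thesis
    using f by (simp add: smoothing_eq abs_mult kernel_nonneg)
qed

lemma smoothing_mono:
  assumes "integrable (lebesgue_on torus) f" "integrable (lebesgue_on torus) g"
    and "\<And>y. y \<in> torus \<Longrightarrow> f y \<le> g y"
  shows "smoothing N f x \<le> smoothing N g x"
  using assms unfolding smoothing_eq[OF assms(1)] smoothing_eq[OF assms(2)]
  by (intro integral_mono integrable_kernel_mult mult_left_mono kernel_nonneg) auto

lemma smoothing_bounded:
  assumes g: "continuous_on torus g" and G: "\<And>y. y \<in> torus \<Longrightarrow> \<bar>g y\<bar> \<le> G"
  shows "\<bar>smoothing N g x\<bar> \<le> G"
proof -
  have gi: "integrable (lebesgue_on torus) g"
    using g by (rule continuous_imp_integrable)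
  have "\<bar>smoothing N g x\<bar> \<le> smoothing N (\<lambda>x. \<bar>g x\<bar>) x"
    by (rule abs_smoothing_le[OF gi])
  also have "\<dots> \<le> smoothing N (\<lambda>_. G) x"
    using gi G by (intro smoothing_mono) auto
  finally show ?thesis by simp
qed

text \<open>For \<open>x\<close> in the open cube, \<open>x - y\<close> stays away from the non-zero lattice points while \<open>y\<close>
  ranges over the closed cube, so \<open>g\<close> need not be periodic here.\<close>

lemma smoothing_tendsto:
  assumes g: "continuous_on torus g" and x: "x \<in> box 0 1"
  shows "(\<lambda>N. smoothing N g x) \<longlonglongrightarrow> g x"
proof (rule LIMSEQ_I)
  fix e :: real assume e: "0 < e"
  have gi: "integrable (lebesgue_on torus) g"
    using g by (rule continuous_imp_integrable)
  have xt: "x \<in> torus" using x box_subset_cbox by blast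
  have "compact (g ` torus)"
    using g by (intro compact_continuous_image) auto
  then obtain G where G: "\<And>y. y \<in> torus \<Longrightarrow> \<bar>g y\<bar> \<le> G"
    using compact_imp_bounded bounded_iff by (metis imageI real_norm_def)
  have G0: "0 \<le> G" using G[OF xt] by linarith
  obtain d where d: "d > 0" "\<And>y. y \<in> torus \<Longrightarrow> dist y x < d \<Longrightarrow> \<bar>g y - g x\<bar> < e / 2"
    using g xt e unfolding continuous_on_iff dist_real_def by (metis half_gt_zero)
  define Y where "Y = torus - ball x d"
  define \<kappa> where "\<kappa> y = (\<Prod>i\<in>UNIV. (cos (pi * (x - y) $ i))\<^sup>2)" for y
  have Y: "compact Y"
    unfolding Y_def by (intro compact_diff) auto
  have \<kappa>0: "0 \<le> \<kappa> y" for y by (simp add: \<kappa>_def prod_nonneg)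
  have \<kappa>1: "\<kappa> y < 1" if y: "y \<in> Y" for y
  proof -
    have "x \<noteq> y" using y d(1) by (auto simp: Y_def)
    then obtain i where i: "x $ i \<noteq> y $ i" by (auto simp: vec_eq_iff)
    \<comment> \<open>Here the open cube matters: the coordinates of \<open>x\<close> and
      \<open>y\<close> differ by less than 1, so the sine below has no zero.\<close>
    have "0 < x $ i" "x $ i < 1" "0 \<le> y $ i" "y $ i \<le> 1"
      using x y by (auto simp: Y_def mem_box_cart)
    then have ab: "\<bar>x $ i - y $ i\<bar> < 1" "0 < \<bar>x $ i - y $ i\<bar>" using i by auto
    have "(cos (pi * (x - y) $ i))\<^sup>2 < 1"
    proof -
      have "sin (pi * \<bar>x $ i - y $ i\<bar>) > 0"
        using ab by (intro sin_gt_zero) auto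
      then have "sin (pi * (x $ i - y $ i)) \<noteq> 0"
        by (cases "x $ i - y $ i \<ge> 0") (auto simp: abs_if right_diff_distrib sin_diff mult.commute)
      then have "0 < (sin (pi * (x $ i - y $ i)))\<^sup>2" by simp
      then show ?thesis using sin_cos_squared_add[of "pi * (x $ i - y $ i)"] unfolding vector_minus_component by linarith
    qed
    moreover have "\<kappa> y = (cos (pi * (x - y) $ i))\<^sup>2 * (\<Prod>j\<in>UNIV - {i}. (cos (pi * (x - y) $ j))\<^sup>2)"
      unfolding \<kappa>_def by (rule prod.remove) auto
    moreover have "\<dots> \<le> (cos (pi * (x - y) $ i))\<^sup>2 * 1"
      by (intro mult_left_mono prod_le_1) (auto simp: abs_square_le_1)
    ultimately show ?thesis by simp
  qed
  obtain q where q: "0 \<le> q" "q < 1" "\<And>y. y \<in> Y \<Longrightarrow> \<kappa> y \<le> q"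
  proof (cases "Y = {}")
    case True then show ?thesis using that[of 0] by auto
  next
    case False
    have "continuous_on Y \<kappa>" unfolding \<kappa>_def by (intro continuous_intros)
    from continuous_attains_sup[OF Y False this] obtain y where "y \<in> Y" "\<And>z. z \<in> Y \<Longrightarrow> \<kappa> z \<le> \<kappa> y"
      by auto
    then show ?thesis
      using that[of "\<kappa> y"] \<kappa>0[of y] \<kappa>1[of y] by auto
  qed
  have lim: "(\<lambda>N. 2 * G * ((2 * real N) ^ 3 * q ^ N)) \<longlonglongrightarrow> 0"
  proof (cases "q = 0")
    case True
    have "(\<lambda>N. 2 * G * ((2 * real N) ^ 3 * q ^ N)) = (\<lambda>N. 0)"
      by (simp add: True power_0_left fun_eq_iff)
    then show ?thesis by simp
  next
    case False
    \<comment> \<open>The cube root turns N^3 q^N into the cube of N r^N, whose limit is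
      known.\<close>
    define r where "r = root 3 q"
    have r: "r ^ 3 = q" "\<bar>r\<bar> < 1" "0 \<le> r"
      using q False by (simp_all add: r_def)
    have "(\<lambda>N. (real N * r ^ N) ^ 3) \<longlonglongrightarrow> 0 ^ 3"
      using powser_times_n_limit_0[of r] r by (intro tendsto_power) simp
    then have "(\<lambda>N. real N ^ 3 * q ^ N) \<longlonglongrightarrow> 0"
      unfolding r(1)[symmetric] by (simp add: power_mult_distrib flip: power_mult) (simp add: mult.commute)
    from tendsto_mult[OF tendsto_const[of "16 * G"] this] show ?thesis
      by (simp add: power_mult_distrib algebra_simps)
  qed
  then obtain N0 where N0: "\<And>N. N \<ge> N0 \<Longrightarrow> \<bar>2 * G * ((2 * real N) ^ 3 * q ^ N)\<bar> < e / 2"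
    using e LIMSEQ_D[OF lim, of "e / 2"] by auto
  show "\<exists>no. \<forall>n\<ge>no. norm (smoothing n g x - g x) < e"
  proof (intro exI allI impI)
    fix N assume N: "N \<ge> max N0 1"
    \<comment> \<open>Bound for the part away from \<open>x\<close>: the oscillation of
      \<open>g\<close> is at most 2 G, and the remaining factor comes from
      \<open>kernel_le\<close>.\<close>
    let ?C = "2 * G * ((2 * real N) ^ 3 * q ^ N)"
    have gd: "integrable (lebesgue_on torus) (\<lambda>y. g y - g x)" using gi by simp
    have "smoothing N g x - g x = (LINT y|lebesgue_on torus. kernel N (x - y) * g y)
        - g x * (LINT y|lebesgue_on torus. kernel N (x - y))"
      by (simp add: smoothing_eq[OF gi] kernel_mean)
    also have "\<dots> = (LINT y|lebesgue_on torus. kernel N (x - y) * (g y - g x))"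
      using integrable_kernel_mult[OF gi, of N x] integrable_kernel_mult[of "\<lambda>_. 1" N x]
      by (simp add: algebra_simps)
    finally have "\<bar>smoothing N g x - g x\<bar> \<le> (LINT y|lebesgue_on torus. \<bar>kernel N (x - y) * (g y - g x)\<bar>)"
      using integral_abs_bound by metis
    also have "\<dots> \<le> (LINT y|lebesgue_on torus. kernel N (x - y) * (e / 2) + ?C)"
    proof (rule integral_mono)
      show "integrable (lebesgue_on torus) (\<lambda>y. \<bar>kernel N (x - y) * (g y - g x)\<bar>)"
        by (intro integrable_abs integrable_kernel_mult gd)
      show "integrable (lebesgue_on torus) (\<lambda>y. kernel N (x - y) * (e / 2) + ?C)"
        by (intro Bochner_Integration.integrable_add integrable_kernel_mult integrable_const_torus)
      fix y assume "y \<in> space (lebesgue_on torus)"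
      then have y: "y \<in> torus" by simp
      have C0: "0 \<le> ?C" using G0 q by simp
      show "\<bar>kernel N (x - y) * (g y - g x)\<bar> \<le> kernel N (x - y) * (e / 2) + ?C"
      proof (cases "dist y x < d")
        case True
        then have "kernel N (x - y) * \<bar>g y - g x\<bar> \<le> kernel N (x - y) * (e / 2)"
          using d(2)[OF y] by (intro mult_left_mono kernel_nonneg) auto
        then show ?thesis using C0 unfolding abs_mult abs_of_nonneg[OF kernel_nonneg] by linarith
      next
        case False
        then have yY: "y \<in> Y" using y by (auto simp: Y_def dist_commute)
        have "kernel N (x - y) \<le> (2 * real N) ^ 3 * \<kappa> y ^ N"
          unfolding \<kappa>_def using N by (intro kernel_le) auto
        also have "\<dots> \<le> (2 * real N) ^ 3 * q ^ N"
          using q(3)[OF yY] \<kappa>0 by (intro mult_left_mono power_mono) auto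
        finally have "kernel N (x - y) * \<bar>g y - g x\<bar> \<le> ((2 * real N) ^ 3 * q ^ N) * (2 * G)"
          using G[OF y] G[OF xt] q by (intro mult_mono) auto
        moreover have "0 \<le> kernel N (x - y) * (e / 2)"
          using e by (simp add: kernel_nonneg)
        moreover have "((2 * real N) ^ 3 * q ^ N) * (2 * G) = ?C" by simp
        ultimately show ?thesis unfolding abs_mult abs_of_nonneg[OF kernel_nonneg] by linarith
      qed
    qed
    also have "\<dots> = e / 2 + ?C"
      using integrable_kernel_mult[of "\<lambda>_. 1" N x] by (simp add: kernel_mean)
    also have "\<dots> < e" using N0[of N] N by auto
    finally show "norm (smoothing N g x - g x) < e" by simp
  qed
qed

subsection \<open>Pairing of \<open>L\<^sup>3\<close> with \<open>L\<^sup>3\<^sup>/\<^sup>2\<close>\<close>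

lemma smooth_pairing_diff_left:
  assumes "integrable (lebesgue_on torus) f" "integrable (lebesgue_on torus) g"
  shows "smooth_pairing N (\<lambda>x. f x - g x) h = smooth_pairing N f h - smooth_pairing N g h"
proof -
  have "fcos k (\<lambda>x. f x - g x) = fcos k f - fcos k g" "fsin k (\<lambda>x. f x - g x) = fsin k f - fsin k g" for k
    using assms by (simp_all add: fcos_def fsin_def left_diff_distrib integrable_times_cosk integrable_times_sink)
  then show ?thesis
    by (simp add: smooth_pairing_def flip: sum_subtractf) (simp add: algebra_simps)
qed

text \<open>Young's inequality for the exponents 3 and 3/2 with a free parameter and unsharp
  constants. With d = sqrt c, the product a d^2 is at most d^3 / sqrt l if sqrt l * a \<le> d, and
  at most l a^3 otherwise.\<close>

lemma young_three_halves:
  fixes a c :: real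
  assumes "0 \<le> a" "0 \<le> c" "0 < l"
  shows "a * c \<le> l * a ^ 3 + c powr (3/2) / sqrt l"
proof -
  define d where "d = sqrt c"
  have c: "c = d\<^sup>2" and d: "0 \<le> d" using assms by (auto simp: d_def)
  have d3: "c powr (3/2) = d ^ 3"
  proof (cases "d = 0")
    case False
    then have "c powr (3/2) = (d powr 2) powr (3/2)"
      using d by (simp add: c powr_realpow)
    also have "\<dots> = d powr 3" by (simp only: powr_powr) simp
    also have "\<dots> = d ^ 3" using d False by simp
    finally show ?thesis .
  qed (simp add: c)
  have l: "0 < sqrt l" using assms by simp
  show ?thesis
  proof (cases "sqrt l * a \<le> d")
    case True
    then have "a \<le> d / sqrt l" using l by (simp add: field_simps)
    then have "a * d\<^sup>2 \<le> d / sqrt l * d\<^sup>2" by (intro mult_right_mono) auto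
    also have "\<dots> = d ^ 3 / sqrt l" by (simp add: power2_eq_square power3_eq_cube)
    finally show ?thesis using assms by (simp add: c d3[unfolded c] add_increasing)
  next
    case False
    then have "d\<^sup>2 \<le> (sqrt l * a)\<^sup>2" using d by (intro power_mono) auto
    then have "a * d\<^sup>2 \<le> a * (l * a\<^sup>2)" using assms by (intro mult_left_mono) (auto simp: power_mult_distrib)
    then show ?thesis using assms l by (simp add: c d3[unfolded c] power2_eq_square power3_eq_cube add_increasing2 mult_ac)
  qed
qed

lemma integrable_of_powr:
  fixes f :: "'a \<Rightarrow> 'b::euclidean_space"
  assumes M: "finite_measure M" and f: "f \<in> borel_measurable M"
    and fp: "integrable M (\<lambda>x. norm (f x) powr p)" and p: "1 \<le> p"
  shows "integrable M f"
proof (rule Bochner_Integration.integrable_bound)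
  show "integrable M (\<lambda>x. 1 + norm (f x) powr p)"
    using fp finite_measure.integrable_const[OF M, of "1::real"] by simp
  have "norm (f x) \<le> 1 + norm (f x) powr p" for x
  proof (cases "norm (f x) \<le> 1")
    case False
    then have "norm (f x) powr 1 \<le> norm (f x) powr p" using p by (intro powr_mono) auto
    then show ?thesis using False by simp
  qed (simp add: add_increasing2)
  then show "AE x in M. norm (f x) \<le> norm (1 + norm (f x) powr p)" by (simp add: abs_of_nonneg)
qed (use f in simp)

lemma finite_measure_torus: "finite_measure (lebesgue_on torus)"
  by (rule finite_measure_lebesgue_on) simp

lemma integrable_abs_cube_iff:
  fixes f :: "'a \<Rightarrow> real"
  shows "integrable M (\<lambda>x. \<bar>f x\<bar> ^ 3) \<longleftrightarrow> integrable M (\<lambda>x. norm (f x) powr 3)"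
  by (simp add: powr_numeral)

text \<open>Young's inequality is applied under the integral against the kernel, which is positive
  and has mass one, and smoothing preserves integrals. The bound is therefore independent of
  \<open>N\<close>, and \<open>l\<close> stays free to make one of the two terms small.\<close>

lemma abs_smooth_pairing_le:
  assumes f: "f \<in> borel_measurable (lebesgue_on torus)" and f3: "integrable (lebesgue_on torus) (\<lambda>x. \<bar>f x\<bar> ^ 3)"
    and g: "g \<in> borel_measurable (lebesgue_on torus)" and g3: "integrable (lebesgue_on torus) (\<lambda>x. \<bar>g x\<bar> powr (3/2))"
    and l: "0 < l"
  shows "\<bar>smooth_pairing N f g\<bar> \<le> l * (LINT x|lebesgue_on torus. \<bar>f x\<bar> ^ 3)
      + (LINT x|lebesgue_on torus. \<bar>g x\<bar> powr (3/2)) / sqrt l"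
proof -
  have fi: "integrable (lebesgue_on torus) f"
    by (rule integrable_of_powr[OF finite_measure_torus f f3[unfolded integrable_abs_cube_iff]]) simp
  have gi: "integrable (lebesgue_on torus) g"
    by (rule integrable_of_powr[OF finite_measure_torus g, of "3/2"]) (use g3 in auto)
  have l3: "integrable (lebesgue_on torus) (\<lambda>y. l * \<bar>f y\<bar> ^ 3)" using f3 by simp
  have pt: "\<bar>smoothing N f x * g x\<bar> \<le> smoothing N (\<lambda>y. l * \<bar>f y\<bar> ^ 3) x + \<bar>g x\<bar> powr (3/2) / sqrt l" for x
  proof -
    have "\<bar>smoothing N f x * g x\<bar> \<le> smoothing N (\<lambda>y. \<bar>f y\<bar>) x * \<bar>g x\<bar>"
      unfolding abs_mult by (intro mult_right_mono abs_smoothing_le fi) simp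
    also have "\<dots> = (LINT y|lebesgue_on torus. kernel N (x - y) * (\<bar>f y\<bar> * \<bar>g x\<bar>))"
      using fi by (simp add: smoothing_eq mult.assoc[symmetric])
    also have "\<dots> \<le> (LINT y|lebesgue_on torus. kernel N (x - y) * (l * \<bar>f y\<bar> ^ 3 + \<bar>g x\<bar> powr (3/2) / sqrt l))"
      using fi f3 l by (intro integral_mono integrable_kernel_mult mult_left_mono young_three_halves kernel_nonneg) auto
    also have "\<dots> = smoothing N (\<lambda>y. l * \<bar>f y\<bar> ^ 3) x + \<bar>g x\<bar> powr (3/2) / sqrt l"
      using integrable_kernel_mult[OF l3, of N x] integrable_kernel_mult[of "\<lambda>_. 1" N x]
      by (simp add: smoothing_eq[OF l3] distrib_left kernel_mean del: times_divide_eq_right)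
    finally show ?thesis .
  qed
  have "\<bar>smooth_pairing N f g\<bar> \<le> (LINT x|lebesgue_on torus. \<bar>smoothing N f x * g x\<bar>)"
    unfolding integral_smoothing_mult[OF gi, symmetric] by (rule integral_abs_bound)
  also have "\<dots> \<le> (LINT x|lebesgue_on torus. smoothing N (\<lambda>y. l * \<bar>f y\<bar> ^ 3) x + \<bar>g x\<bar> powr (3/2) / sqrt l)"
    using g3 pt integrable_trig_poly_mult[OF gi]
    by (intro integral_mono Bochner_Integration.integrable_add integrable_smoothing integrable_abs)
      (auto simp: smoothing_def)
  also have "\<dots> = l * (LINT x|lebesgue_on torus. \<bar>f x\<bar> ^ 3) + (LINT x|lebesgue_on torus. \<bar>g x\<bar> powr (3/2)) / sqrt l"
    using g3 by (simp add: integrable_smoothing integral_smoothing)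
  finally show ?thesis .
qed

lemma abs_clamp_diff_le: "\<bar>a - max (- M) (min M a)\<bar> \<le> \<bar>a\<bar>" if "0 \<le> M" for a M :: real
  using that by (auto simp: max_def min_def)

lemma cube_abs_diff_le:
  fixes a b c :: real
  shows "\<bar>a - c\<bar> ^ 3 \<le> 8 * \<bar>a - b\<bar> ^ 3 + 8 * \<bar>b - c\<bar> ^ 3"
proof -
  define m where "m = max \<bar>a - b\<bar> \<bar>b - c\<bar>"
  have "\<bar>a - c\<bar> \<le> 2 * m" by (auto simp: m_def max_def abs_if split: if_splits)
  then have "\<bar>a - c\<bar> ^ 3 \<le> (2 * m) ^ 3" by (intro power_mono) auto
  also have "\<dots> = 8 * m ^ 3" by (simp add: power_mult_distrib)
  also have "m ^ 3 \<le> \<bar>a - b\<bar> ^ 3 + \<bar>b - c\<bar> ^ 3" by (auto simp: m_def max_def)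
  finally show ?thesis by simp
qed

text \<open>Truncation makes \<open>f\<close> bounded. The continuous functions supplied by
  \<open>measurable_on\<close> converge only almost everywhere, but after the same truncation they
  are dominated by a constant, which is integrable since \<open>S\<close> has finite
  measure.\<close>

lemma continuous_dense_L3:
  fixes f :: "'a::euclidean_space \<Rightarrow> real"
  assumes S: "S \<in> lmeasurable"
    and f: "f \<in> borel_measurable (lebesgue_on S)" and f3: "integrable (lebesgue_on S) (\<lambda>x. \<bar>f x\<bar> ^ 3)"
    and e: "0 < e"
  obtains g where "continuous_on UNIV g" "integrable (lebesgue_on S) (\<lambda>x. \<bar>f x - g x\<bar> ^ 3)"
    "(LINT x|lebesgue_on S. \<bar>f x - g x\<bar> ^ 3) < e"
proof -
  have Ss: "S \<in> sets lebesgue" using S by (rule fmeasurableD)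
  interpret finite_measure "lebesgue_on S" using S by (rule finite_measure_lebesgue_on)
  define cl where "cl M a = max (- M) (min M a)" for M a :: real
  have cl_cont: "continuous_on UNIV (cl M)" for M
    unfolding cl_def[abs_def] by (intro continuous_intros)
  have cl_meas [measurable]: "cl M \<in> borel_measurable borel" for M
    by (intro borel_measurable_continuous_onI cl_cont)
  note f[measurable]
  have lim1: "(\<lambda>n. LINT x|lebesgue_on S. \<bar>f x - cl (real n) (f x)\<bar> ^ 3) \<longlonglongrightarrow> (LINT x|lebesgue_on S. 0)"
  proof (rule integral_dominated_convergence[where w = "\<lambda>x. \<bar>f x\<bar> ^ 3"])
    show "AE x in lebesgue_on S. (\<lambda>n. \<bar>f x - cl (real n) (f x)\<bar> ^ 3) \<longlonglongrightarrow> 0"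
    proof (rule AE_I2)
      fix x
      obtain N where N: "\<bar>f x\<bar> \<le> real N" using real_arch_simple by blast
      have "\<forall>\<^sub>F n in sequentially. \<bar>f x - cl (real n) (f x)\<bar> ^ 3 = 0"
        using eventually_ge_at_top[of N] by eventually_elim (use N in \<open>auto simp: cl_def max_def min_def\<close>)
      then show "(\<lambda>n. \<bar>f x - cl (real n) (f x)\<bar> ^ 3) \<longlonglongrightarrow> 0" by (rule tendsto_eventually)
    qed
    show "AE x in lebesgue_on S. norm (\<bar>f x - cl (real n) (f x)\<bar> ^ 3) \<le> \<bar>f x\<bar> ^ 3" for n
      by (rule AE_I2) (auto simp: cl_def intro!: power_mono abs_clamp_diff_le)
  qed (use f3 in auto)
  \<comment> \<open>\<open>cube_abs_diff_le\<close> costs a factor 8 on each of the two errors, so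
    two errors below e / 16 add up to less than e.\<close>
  then have "\<exists>n. (LINT x|lebesgue_on S. \<bar>f x - cl (real n) (f x)\<bar> ^ 3) < e / 16"
    using e order_tendstoD(2)[OF lim1, of "e / 16"] by (auto simp: eventually_sequentially)
  then obtain n where n: "(LINT x|lebesgue_on S. \<bar>f x - cl (real n) (f x)\<bar> ^ 3) < e / 16" ..
  define M where "M = real n"
  have M0: "0 \<le> M" by (simp add: M_def)
  have "f measurable_on S"
    using f Ss by (simp add: measurable_on_iff_borel_measurable)
  then obtain N h where N: "negligible N" and h: "\<And>m. continuous_on UNIV (h m)"
    and hlim: "\<And>x. x \<notin> N \<Longrightarrow> (\<lambda>m. h m x) \<longlonglongrightarrow> (if x \<in> S then f x else 0)"
    unfolding measurable_on_def by metis
  have hc: "continuous_on UNIV (\<lambda>x. cl M (h m x))" for m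
    using continuous_on_compose2[OF cl_cont h] by simp
  have hm [measurable]: "(\<lambda>x. cl M (h m x)) \<in> borel_measurable (lebesgue_on S)" for m
    by (intro measurable_restrict_space1 measurable_completion borel_measurable_continuous_onI hc)
      (simp add: hc borel_measurable_continuous_onI)
  have clM: "\<bar>cl M a\<bar> \<le> M" for a using M0 by (auto simp: cl_def)
  have bd: "\<bar>cl M a - cl M b\<bar> ^ 3 \<le> (2 * M) ^ 3" for a b
    using clM[of a] clM[of b] by (intro power_mono) auto
  have lim2: "(\<lambda>m. LINT x|lebesgue_on S. \<bar>cl M (f x) - cl M (h m x)\<bar> ^ 3) \<longlonglongrightarrow> (LINT x|lebesgue_on S. 0)"
  proof (rule integral_dominated_convergence[where w = "\<lambda>x. (2 * M) ^ 3"])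
    have "AE x in lebesgue. x \<notin> N"
      using N by (simp add: negligible_iff_null_sets AE_not_in)
    then have "AE x in lebesgue_on S. x \<notin> N"
      using Ss by (auto simp: AE_restrict_space_iff elim: eventually_mono)
    then show "AE x in lebesgue_on S. (\<lambda>m. \<bar>cl M (f x) - cl M (h m x)\<bar> ^ 3) \<longlonglongrightarrow> 0"
      using AE_space
    proof eventually_elim
      fix x assume x: "x \<notin> N" "x \<in> space (lebesgue_on S)"
      then have "(\<lambda>m. h m x) \<longlonglongrightarrow> f x" using hlim[of x] by auto
      then have "(\<lambda>m. cl M (h m x)) \<longlonglongrightarrow> cl M (f x)"
        using cl_cont by (auto simp: continuous_on_eq_continuous_at intro: isCont_tendsto_compose)
      from tendsto_power[OF tendsto_rabs[OF tendsto_diff[OF tendsto_const[of "cl M (f x)"] this]], of 3]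
      show "(\<lambda>m. \<bar>cl M (f x) - cl M (h m x)\<bar> ^ 3) \<longlonglongrightarrow> 0" by simp
    qed
  qed (use bd in auto)
  then have "\<exists>m. (LINT x|lebesgue_on S. \<bar>cl M (f x) - cl M (h m x)\<bar> ^ 3) < e / 16"
    using e order_tendstoD(2)[OF lim2, of "e / 16"] by (auto simp: eventually_sequentially)
  then obtain m where m: "(LINT x|lebesgue_on S. \<bar>cl M (f x) - cl M (h m x)\<bar> ^ 3) < e / 16" ..
  define g where "g x = cl M (h m x)" for x
  have i1: "integrable (lebesgue_on S) (\<lambda>x. \<bar>f x - cl M (f x)\<bar> ^ 3)"
    by (rule Bochner_Integration.integrable_bound[OF f3])
      (auto simp: cl_def intro!: power_mono abs_clamp_diff_le M0)
  have i2: "integrable (lebesgue_on S) (\<lambda>x. \<bar>cl M (f x) - g x\<bar> ^ 3)"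
    unfolding g_def
    by (rule Bochner_Integration.integrable_bound[OF integrable_const[of "(2 * M) ^ 3"]])
      (use bd M0 in auto)
  have le: "\<bar>f x - g x\<bar> ^ 3 \<le> 8 * \<bar>f x - cl M (f x)\<bar> ^ 3 + 8 * \<bar>cl M (f x) - g x\<bar> ^ 3" for x
    by (rule cube_abs_diff_le)
  have i3: "integrable (lebesgue_on S) (\<lambda>x. 8 * \<bar>f x - cl M (f x)\<bar> ^ 3 + 8 * \<bar>cl M (f x) - g x\<bar> ^ 3)"
    using i1 i2 by simp
  have i4: "integrable (lebesgue_on S) (\<lambda>x. \<bar>f x - g x\<bar> ^ 3)"
    by (rule Bochner_Integration.integrable_bound[OF i3]) (use le in \<open>auto simp: g_def\<close>)
  have "(LINT x|lebesgue_on S. \<bar>f x - g x\<bar> ^ 3)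
      \<le> (LINT x|lebesgue_on S. 8 * \<bar>f x - cl M (f x)\<bar> ^ 3 + 8 * \<bar>cl M (f x) - g x\<bar> ^ 3)"
    by (intro integral_mono i3 i4 le)
  also have "\<dots> < e" using i1 i2 n m by (simp add: M_def g_def)
  finally show ?thesis
    using that[of g] hc[of m] i4 by (simp add: g_def)
qed

lemma AE_torus_interior: "AE x in lebesgue_on torus. x \<in> box 0 (1::real^3)"
proof -
  have "AE x in lebesgue. x \<notin> torus - box 0 (1::real^3)"
    using null_sets_cbox_Diff_box[of 0 "1::real^3"] by (intro AE_not_in null_sets_completionI)
  then show ?thesis by (auto simp: AE_restrict_space_iff elim!: eventually_mono)
qed

lemma abs_integral_mult_le:
  fixes f g :: "'a \<Rightarrow> real"
  assumes f: "f \<in> borel_measurable M" and f3: "integrable M (\<lambda>x. \<bar>f x\<bar> ^ 3)"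
    and g: "g \<in> borel_measurable M" and g3: "integrable M (\<lambda>x. \<bar>g x\<bar> powr (3/2))"
    and l: "0 < l"
  shows "integrable M (\<lambda>x. f x * g x)"
    and "\<bar>LINT x|M. f x * g x\<bar> \<le> l * (LINT x|M. \<bar>f x\<bar> ^ 3) + (LINT x|M. \<bar>g x\<bar> powr (3/2)) / sqrt l"
proof -
  have le: "\<bar>f x * g x\<bar> \<le> l * \<bar>f x\<bar> ^ 3 + \<bar>g x\<bar> powr (3/2) / sqrt l" for x
    unfolding abs_mult using l by (intro young_three_halves) auto
  have i: "integrable M (\<lambda>x. l * \<bar>f x\<bar> ^ 3 + \<bar>g x\<bar> powr (3/2) / sqrt l)"
    using f3 g3 by simp
  show fg: "integrable M (\<lambda>x. f x * g x)"
    by (rule Bochner_Integration.integrable_bound[OF i]) (use le f g l in \<open>auto intro!: AE_I2 order_trans[OF le] simp del: abs_mult\<close>)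
  have "\<bar>LINT x|M. f x * g x\<bar> \<le> (LINT x|M. \<bar>f x * g x\<bar>)" by (rule integral_abs_bound)
  also have "\<dots> \<le> (LINT x|M. l * \<bar>f x\<bar> ^ 3 + \<bar>g x\<bar> powr (3/2) / sqrt l)"
    by (intro integral_mono i integrable_abs fg le)
  also have "\<dots> = l * (LINT x|M. \<bar>f x\<bar> ^ 3) + (LINT x|M. \<bar>g x\<bar> powr (3/2)) / sqrt l"
    using f3 g3 by simp
  finally show "\<bar>LINT x|M. f x * g x\<bar> \<le> l * (LINT x|M. \<bar>f x\<bar> ^ 3) + (LINT x|M. \<bar>g x\<bar> powr (3/2)) / sqrt l" .
qed

text \<open>Dominated convergence. Pointwise convergence is known only in the open cube, but the
  faces, where a non-periodic \<open>g\<close> may cause trouble, are a null set.\<close>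

lemma smooth_pairing_tendsto_continuous:
  assumes g: "continuous_on torus g" and h: "integrable (lebesgue_on torus) h"
  shows "(\<lambda>N. smooth_pairing N g h) \<longlonglongrightarrow> (LINT x|lebesgue_on torus. g x * h x)"
proof -
  have "compact (g ` torus)"
    using g by (intro compact_continuous_image) auto
  then obtain G where G: "\<And>y. y \<in> torus \<Longrightarrow> \<bar>g y\<bar> \<le> G"
    using compact_imp_bounded bounded_iff by (metis imageI real_norm_def)
  have gi: "integrable (lebesgue_on torus) g"
    using g by (rule continuous_imp_integrable)
  have "(\<lambda>N. LINT x|lebesgue_on torus. smoothing N g x * h x) \<longlonglongrightarrow> (LINT x|lebesgue_on torus. g x * h x)"
  proof (rule integral_dominated_convergence[where w = "\<lambda>x. G * \<bar>h x\<bar>"])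
    show "AE x in lebesgue_on torus. (\<lambda>N. smoothing N g x * h x) \<longlonglongrightarrow> g x * h x"
      using AE_torus_interior by eventually_elim (intro tendsto_mult tendsto_const smoothing_tendsto g)
    show "AE x in lebesgue_on torus. norm (smoothing N g x * h x) \<le> G * \<bar>h x\<bar>" for N
      using smoothing_bounded[OF g G] by (auto simp: abs_mult intro!: mult_right_mono)
    show "(\<lambda>x. smoothing N g x * h x) \<in> borel_measurable (lebesgue_on torus)" for N
      using integrable_smoothing[of N g] h by auto
  qed (use gi h in auto)
  then show ?thesis by (simp add: integral_smoothing_mult[OF h])
qed

lemma smooth_pairing_tendsto:
  assumes f: "f \<in> borel_measurable (lebesgue_on torus)" and f3: "integrable (lebesgue_on torus) (\<lambda>x. \<bar>f x\<bar> ^ 3)"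
    and h: "h \<in> borel_measurable (lebesgue_on torus)" and h3: "integrable (lebesgue_on torus) (\<lambda>x. \<bar>h x\<bar> powr (3/2))"
  shows "(\<lambda>N. smooth_pairing N f h) \<longlonglongrightarrow> (LINT x|lebesgue_on torus. f x * h x)"
proof (rule LIMSEQ_I)
  fix e0 :: real assume "0 < e0"
  define e where "e = e0 / 8"
  have e: "0 < e" using \<open>0 < e0\<close> by (simp add: e_def)
  define H where "H = (LINT x|lebesgue_on torus. \<bar>h x\<bar> powr (3/2))"
  have H0: "0 \<le> H" by (simp add: H_def)
  \<comment> \<open>The order of choices matters: \<open>l\<close> is fixed first, so that H / sqrt
    l is at most e, and then \<open>g\<close> is taken so close to \<open>f\<close> that even
    \<open>l\<close> times the error is small. The total error is at most 2 e + 2 e + e.\<close>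
  define l where "l = ((H + 1) / e)\<^sup>2"
  have l: "0 < l" "sqrt l = (H + 1) / e" using H0 e by (auto simp: l_def)
  have Hl: "H / sqrt l \<le> e" using H0 e unfolding l(2) by (simp add: field_simps)
  obtain g where g: "continuous_on UNIV g" and gi3: "integrable (lebesgue_on torus) (\<lambda>x. \<bar>f x - g x\<bar> ^ 3)"
    and gl: "(LINT x|lebesgue_on torus. \<bar>f x - g x\<bar> ^ 3) < e / l"
    using continuous_dense_L3[OF _ f f3, of "e / l"] e l by auto
  have gl': "l * (LINT x|lebesgue_on torus. \<bar>f x - g x\<bar> ^ 3) < e"
    using gl l by (simp add: field_simps)
  have gc: "continuous_on torus g" using g continuous_on_subset by blast
  have gi: "integrable (lebesgue_on torus) g" using gc by (rule continuous_imp_integrable)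
  have fi: "integrable (lebesgue_on torus) f"
    by (rule integrable_of_powr[OF finite_measure_torus f f3[unfolded integrable_abs_cube_iff]]) simp
  have hi: "integrable (lebesgue_on torus) h"
    by (rule integrable_of_powr[OF finite_measure_torus h, of "3/2"]) (use h3 in auto)
  have fg: "(\<lambda>x. f x - g x) \<in> borel_measurable (lebesgue_on torus)" using fi gi by auto
  have A: "\<bar>smooth_pairing N f h - smooth_pairing N g h\<bar> < 2 * e" for N
    using abs_smooth_pairing_le[OF fg gi3 h h3 l(1), of N] Hl gl'
    unfolding smooth_pairing_diff_left[OF fi gi] H_def[symmetric] by linarith
  have fh: "integrable (lebesgue_on torus) (\<lambda>x. f x * h x)"
    by (rule abs_integral_mult_le(1)[OF f f3 h h3 l(1)])
  have fgh: "integrable (lebesgue_on torus) (\<lambda>x. (f x - g x) * h x)"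
    by (rule abs_integral_mult_le(1)[OF fg gi3 h h3 l(1)])
  have gh: "integrable (lebesgue_on torus) (\<lambda>x. g x * h x)"
    using Bochner_Integration.integrable_diff[OF fh fgh] by (simp add: algebra_simps)
  have "(LINT x|lebesgue_on torus. (f x - g x) * h x)
      = (LINT x|lebesgue_on torus. f x * h x) - (LINT x|lebesgue_on torus. g x * h x)"
    using fh gh by (simp add: left_diff_distrib)
  then have B: "\<bar>(LINT x|lebesgue_on torus. f x * h x) - (LINT x|lebesgue_on torus. g x * h x)\<bar> < 2 * e"
    using abs_integral_mult_le(2)[OF fg gi3 h h3 l(1)] Hl gl' unfolding H_def[symmetric] by linarith
  obtain N0 where N0: "\<And>N. N \<ge> N0 \<Longrightarrow> \<bar>smooth_pairing N g h - (LINT x|lebesgue_on torus. g x * h x)\<bar> < e"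
    using LIMSEQ_D[OF smooth_pairing_tendsto_continuous[OF gc hi] e] by auto
  show "\<exists>no. \<forall>n\<ge>no. norm (smooth_pairing n f h - (LINT x|lebesgue_on torus. f x * h x)) < e0"
  proof (intro exI allI impI)
    fix N assume "N0 \<le> N"
    have "e0 = 8 * e" by (simp add: e_def)
    with N0[OF \<open>N0 \<le> N\<close>] A[of N] B e
    show "norm (smooth_pairing N f h - (LINT x|lebesgue_on torus. f x * h x)) < e0"
      unfolding real_norm_def by linarith
  qed
qed

subsection \<open>Smooth test functions\<close>

text \<open>The whole sequence of derivatives is carried along, so that passing to a derivative or
  an antiderivative is a shift of the sequence.\<close>

definition smooth_real :: "(real \<Rightarrow> real) \<Rightarrow> bool"
  where "smooth_real f \<longleftrightarrow> (\<exists>h. h 0 = f \<and> (\<forall>n t. (h n has_real_derivative h (Suc n) t) (at t)))"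

text \<open>A derivative operator is chosen on the set \<open>V\<close> and iterated; closure under
  differentiation keeps the iterates inside.\<close>

lemma smooth_real_coinduct:
  assumes "f \<in> V" and V: "\<And>f. f \<in> V \<Longrightarrow> \<exists>g\<in>V. \<forall>t. (f has_real_derivative g t) (at t)"
  shows "smooth_real f"
proof -
  obtain D where D: "\<And>f. f \<in> V \<Longrightarrow> D f \<in> V \<and> (\<forall>t. (f has_real_derivative D f t) (at t))"
    using V by metis
  have "(D ^^ n) f \<in> V" for n
    by (induction n) (auto simp: assms(1) D)
  then show ?thesis
    unfolding smooth_real_def using D by (intro exI[of _ "\<lambda>n. (D ^^ n) f"]) auto
qed

lemma smooth_real_deriv:
  assumes "smooth_real f"
  obtains g where "smooth_real g" "\<And>t. (f has_real_derivative g t) (at t)"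
proof -
  obtain h where h: "h 0 = f" "\<And>n t. (h n has_real_derivative h (Suc n) t) (at t)"
    using assms unfolding smooth_real_def by blast
  have "smooth_real (h 1)"
    unfolding smooth_real_def by (rule exI[of _ "\<lambda>n. h (Suc n)"]) (auto simp: h)
  then show ?thesis using that h by (metis One_nat_def)
qed

lemma smooth_real_antideriv:
  assumes "smooth_real g" "\<And>t. (f has_real_derivative g t) (at t)"
  shows "smooth_real f"
proof -
  obtain h where h: "h 0 = g" "\<And>n t. (h n has_real_derivative h (Suc n) t) (at t)"
    using assms unfolding smooth_real_def by blast
  show ?thesis
    unfolding smooth_real_def
  proof (intro exI[of _ "\<lambda>n. case n of 0 \<Rightarrow> f | Suc m \<Rightarrow> h m"] conjI allI)
    fix n t
    show "((case n of 0 \<Rightarrow> f | Suc m \<Rightarrow> h m) has_real_derivative (case Suc n of 0 \<Rightarrow> f | Suc m \<Rightarrow> h m) t) (at t)"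
      using assms(2) h by (cases n) auto
  qed simp
qed

lemma smooth_real_imp_continuous: "smooth_real f \<Longrightarrow> continuous_on A f"
  by (metis smooth_real_deriv DERIV_continuous_on has_field_derivative_at_within)

text \<open>The factor, a polynomial in 1/t, turns the standard flat function exp(-1/t) into a
  family that is closed under differentiation.\<close>

definition flat_exp :: "real poly \<Rightarrow> real \<Rightarrow> real"
  where "flat_exp p t = (if t > 0 then poly p (1 / t) * exp (- (1 / t)) else 0)"

lemma poly_times_exp_minus_tendsto_0: "((\<lambda>x. poly p x * exp (- x)) \<longlongrightarrow> (0::real)) at_top"
proof -
  have "((\<lambda>x. \<Sum>i\<le>degree p. coeff p i * (x ^ i / exp x)) \<longlongrightarrow> (\<Sum>i\<le>degree p. coeff p i * 0)) at_top"
    by (intro tendsto_sum tendsto_mult tendsto_const tendsto_power_div_exp_0)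
  then show ?thesis
    by (simp add: poly_altdef sum_distrib_right exp_minus divide_inverse mult.assoc)
qed

text \<open>For t > 0 the chain rule produces the factor 1/t^2, which is \<open>[:0, 0, 1:]\<close>
  evaluated at 1/t, times p - p' at 1/t. At 0 the right-hand difference quotient is x p(x) exp(-x)
  with x = 1/h, which vanishes as x grows.\<close>

lemma flat_exp_deriv:
  "(flat_exp p has_real_derivative flat_exp ([:0, 0, 1:] * (p - pderiv p)) t) (at t)"
proof -
  consider "t < 0" | "t = 0" | "t > 0" by linarith
  then show ?thesis
  proof cases
    case 1
    have "((\<lambda>t. 0) has_real_derivative 0) (at t)" by simp
    then have "(flat_exp p has_real_derivative 0) (at t)"
      by (rule has_field_derivative_transform_within_open[of _ _ _ "{..<0}"]) (use 1 in \<open>auto simp: flat_exp_def\<close>)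
    then show ?thesis using 1 by (simp add: flat_exp_def)
  next
    case 3
    have "((\<lambda>t. poly p (1 / t) * exp (- (1 / t))) has_real_derivative
        flat_exp ([:0, 0, 1:] * (p - pderiv p)) t) (at t)"
      using 3 by (auto intro!: derivative_eq_intros poly_DERIV[THEN DERIV_chain2]
          simp: flat_exp_def algebra_simps power2_eq_square divide_simps)
    then show ?thesis
      by (rule has_field_derivative_transform_within_open[of _ _ _ "{0<..}"]) (use 3 in \<open>auto simp: flat_exp_def\<close>)
  next
    case 2
    have R: "((\<lambda>h. flat_exp p h / h) \<longlongrightarrow> 0) (at_right 0)"
    proof -
      have "((\<lambda>h. poly (pCons 0 p) (inverse h) * exp (- inverse h)) \<longlongrightarrow> 0) (at_right 0)"
        by (rule filterlim_compose[OF poly_times_exp_minus_tendsto_0 filterlim_inverse_at_top_right])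
      then show ?thesis
        by (rule filterlim_cong[THEN iffD1, OF refl refl, rotated])
          (auto simp: flat_exp_def eventually_at_right_less inverse_eq_divide intro!: eventually_at_right_less[THEN eventually_mono])
    qed
    have L: "((\<lambda>h. flat_exp p h / h) \<longlongrightarrow> 0) (at_left 0)"
      by (rule tendsto_eventually) (auto simp: flat_exp_def eventually_at_left_field intro!: exI[of _ "-1"])
    have "((\<lambda>h. flat_exp p h / h) \<longlongrightarrow> 0) (at 0)"
      using L R by (rule filterlim_split_at)
    then show ?thesis using 2
      by (simp add: DERIV_def flat_exp_def)
  qed
qed

lemma flat_exp_smult: "flat_exp (smult c p) t = c * flat_exp p t"
  by (simp add: flat_exp_def)

text \<open>The product rule stays within sums of such products: the factors a and -a of the chain
  rule move into the polynomials by \<open>smult\<close>.\<close>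

inductive_set bump_space :: "real \<Rightarrow> real \<Rightarrow> real \<Rightarrow> (real \<Rightarrow> real) set" for a \<alpha> \<beta>
  where
    base: "(\<lambda>t. flat_exp p (a * (t - \<alpha>)) * flat_exp q (a * (\<beta> - t))) \<in> bump_space a \<alpha> \<beta>"
  | add: "f \<in> bump_space a \<alpha> \<beta> \<Longrightarrow> g \<in> bump_space a \<alpha> \<beta> \<Longrightarrow> (\<lambda>t. f t + g t) \<in> bump_space a \<alpha> \<beta>"

lemma bump_space_deriv:
  "f \<in> bump_space a \<alpha> \<beta> \<Longrightarrow> \<exists>g\<in>bump_space a \<alpha> \<beta>. \<forall>t. (f has_real_derivative g t) (at t)"
proof (induction rule: bump_space.induct)
  case (base p q)
  let ?d = "\<lambda>p. [:0, 0, 1:] * (p - pderiv p) :: real poly"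
  let ?g = "\<lambda>t. flat_exp (smult a (?d p)) (a * (t - \<alpha>)) * flat_exp q (a * (\<beta> - t))
      + flat_exp (smult (- a) p) (a * (t - \<alpha>)) * flat_exp (?d q) (a * (\<beta> - t))"
  have "?g \<in> bump_space a \<alpha> \<beta>"
    by (intro bump_space.add bump_space.base)
  moreover have "((\<lambda>t. flat_exp p (a * (t - \<alpha>)) * flat_exp q (a * (\<beta> - t))) has_real_derivative ?g t) (at t)" for t
  proof -
    have 1: "((\<lambda>t. flat_exp p (a * (t - \<alpha>))) has_real_derivative flat_exp (?d p) (a * (t - \<alpha>)) * a) (at t)"
      by (rule DERIV_chain2[OF flat_exp_deriv]) (auto intro!: derivative_eq_intros)
    have 2: "((\<lambda>t. flat_exp q (a * (\<beta> - t))) has_real_derivative flat_exp (?d q) (a * (\<beta> - t)) * (- a)) (at t)"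
      by (rule DERIV_chain2[OF flat_exp_deriv]) (auto intro!: derivative_eq_intros)
    show ?thesis
      using DERIV_mult[OF 1 2] by (simp only: flat_exp_smult mult_ac add.commute mult_minus_left mult_minus_right)
  qed
  ultimately show ?case by (intro bexI[of _ ?g] allI)
next
  case (add f g)
  then obtain f' g' where "f' \<in> bump_space a \<alpha> \<beta>" "g' \<in> bump_space a \<alpha> \<beta>"
    "\<And>t. (f has_real_derivative f' t) (at t)" "\<And>t. (g has_real_derivative g' t) (at t)" by blast
  then show ?case
    by (intro bexI[of _ "\<lambda>t. f' t + g' t"] allI DERIV_add bump_space.add) auto
qed

text \<open>For positive \<open>a\<close> the support lies between \<alpha> and \<beta>. As the
  steepness \<open>a\<close> grows, both exponentials tend to 1 inside, so that the bumps approach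
  the indicator of the open interval.\<close>

definition bump :: "real \<Rightarrow> real \<Rightarrow> real \<Rightarrow> real \<Rightarrow> real"
  where "bump a \<alpha> \<beta> t = flat_exp 1 (a * (t - \<alpha>)) * flat_exp 1 (a * (\<beta> - t))"

lemma smooth_bump: "smooth_real (bump a \<alpha> \<beta>)"
  unfolding bump_def[abs_def]
  by (rule smooth_real_coinduct[OF bump_space.base]) (rule bump_space_deriv)

lemma bump_nonneg: "0 \<le> bump a \<alpha> \<beta> t" and bump_le_1: "bump a \<alpha> \<beta> t \<le> 1"
  by (auto simp: bump_def flat_exp_def mult_le_one)

lemma bump_eq_0: "a > 0 \<Longrightarrow> t \<notin> {\<alpha><..<\<beta>} \<Longrightarrow> bump a \<alpha> \<beta> t = 0"
  by (auto simp: bump_def flat_exp_def zero_less_mult_iff)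

lemma bump_pos: "a > 0 \<Longrightarrow> \<alpha> < t \<Longrightarrow> t < \<beta> \<Longrightarrow> 0 < bump a \<alpha> \<beta> t"
  by (auto simp: bump_def flat_exp_def)

section \<open>Test functions in time and separated test functions in space-time\<close>

definition time_test :: "real \<Rightarrow> (real \<Rightarrow> real) \<Rightarrow> bool"
  where "time_test T \<eta> \<longleftrightarrow> smooth_real \<eta> \<and> (\<exists>s r. 0 < s \<and> r < T \<and> (\<forall>t. \<eta> t \<noteq> 0 \<longrightarrow> s \<le> t \<and> t \<le> r))"

lemma time_test_bump:
  assumes "0 < a" "0 < \<alpha>" "\<beta> < T"
  shows "time_test T (bump a \<alpha> \<beta>)"
proof -
  have "\<alpha> \<le> t \<and> t \<le> \<beta>" if "bump a \<alpha> \<beta> t \<noteq> 0" for t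
    using that bump_eq_0[OF assms(1), of t \<alpha> \<beta>] by force
  then show ?thesis
    unfolding time_test_def using smooth_bump assms by blast
qed

lemma sum_Basis_prod_cases:
  assumes "v \<in> (Basis :: ((real^3) \<times> real) set)"
  obtains i where "v = (axis i 1, 0)" | "v = (0, 1)"
  using assms by (auto simp: Basis_prod_def Basis_vec_def)

lemma cosk_has_derivative:
  "(cosk k has_derivative (\<lambda>d. - (2 * pi * (freq k \<bullet> d)) * sink k x)) (at x)"
  and sink_has_derivative:
  "(sink k has_derivative (\<lambda>d. 2 * pi * (freq k \<bullet> d) * cosk k x)) (at x)"
  unfolding cosk_def[abs_def] sink_def[abs_def]
  by (auto intro!: derivative_eq_intros)

text \<open>Both trigonometric functions are kept, because a spatial derivative turns the pair
  \<open>(a, b)\<close> into a multiple of \<open>(b, - a)\<close>: the family is closed under all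
  derivatives.\<close>

definition sep_test :: "(3 \<Rightarrow> int) \<Rightarrow> (real \<Rightarrow> real) \<Rightarrow> real \<Rightarrow> real \<Rightarrow> (real^3) \<times> real \<Rightarrow> real"
  where "sep_test k \<eta> a b z = \<eta> (snd z) * (a * cosk k (fst z) + b * sink k (fst z))"

lemma sep_test_has_derivative:
  assumes "\<And>t. (\<eta> has_real_derivative \<eta>' t) (at t)"
  shows "(sep_test k \<eta> a b has_derivative
    (\<lambda>d. sep_test k \<eta>' a b z * snd d + 2 * pi * (freq k \<bullet> fst d) * sep_test k \<eta> b (- a) z)) (at z)"
proof -
  have 1: "((\<lambda>z::(real^3)\<times>real. \<eta> (snd z)) has_derivative (\<lambda>d. \<eta>' (snd z) * snd d)) (at z)"
    using has_derivative_compose[of snd snd z UNIV \<eta> "\<lambda>h. \<eta>' (snd z) * h"] assms[of "snd z"]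
    by (simp add: has_field_derivative_def has_derivative_snd)
  have 2: "((\<lambda>z::(real^3)\<times>real. cosk k (fst z)) has_derivative (\<lambda>d. - (2 * pi * (freq k \<bullet> fst d)) * sink k (fst z))) (at z)"
    by (rule has_derivative_compose[OF _ cosk_has_derivative]) (auto intro!: derivative_eq_intros)
  have 3: "((\<lambda>z::(real^3)\<times>real. sink k (fst z)) has_derivative (\<lambda>d. 2 * pi * (freq k \<bullet> fst d) * cosk k (fst z))) (at z)"
    by (rule has_derivative_compose[OF _ sink_has_derivative]) (auto intro!: derivative_eq_intros)
  show ?thesis
    unfolding sep_test_def[abs_def]
    by (rule has_derivative_eq_rhs, rule has_derivative_mult[OF 1 has_derivative_add[OF has_derivative_mult_right[OF 2] has_derivative_mult_right[OF 3]]])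
      (simp add: fun_eq_iff algebra_simps)
qed

lemma dir_deriv_sep_test:
  assumes "\<And>t. (\<eta> has_real_derivative \<eta>' t) (at t)"
  shows "dir_deriv (0, 1) (sep_test k \<eta> a b) = sep_test k \<eta>' a b"
    and "dir_deriv (axis i 1, 0) (sep_test k \<eta> a b) = sep_test k \<eta> (2 * pi * of_int (k i) * b) (- (2 * pi * of_int (k i) * a))"
  by (simp_all add: fun_eq_iff dir_deriv_def inner_axis sep_test_def algebra_simps
      frechet_derivative_at[OF sep_test_has_derivative[OF assms], symmetric])

lemma smooth_sep_test:
  assumes "smooth_real \<eta>"
  shows "smooth (sep_test k \<eta> a b)"
proof -
  \<comment> \<open>Differentiation changes \<eta> in the time direction and \<open>a\<close>,
    \<open>b\<close> in the space directions, so the induction quantifies over all three.\<close>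
  have "\<forall>\<eta> a b. smooth_real \<eta> \<longrightarrow> C_k n (sep_test k \<eta> a b)" for n
  proof (induction n)
    case 0
    show ?case
    proof (intro allI impI)
      fix \<eta> :: "real \<Rightarrow> real" and a b assume "smooth_real \<eta>"
      then obtain g where "\<And>t. (\<eta> has_real_derivative g t) (at t)" using smooth_real_deriv by blast
      then show "C_k 0 (sep_test k \<eta> a b)"
        unfolding C_k.simps
        by (intro continuous_at_imp_continuous_on ballI has_derivative_continuous[OF sep_test_has_derivative])
    qed
  next
    case (Suc n)
    show ?case
    proof (intro allI impI)
      fix \<eta> :: "real \<Rightarrow> real" and a b assume \<eta>: "smooth_real \<eta>"
      then obtain g where g: "smooth_real g" "\<And>t. (\<eta> has_real_derivative g t) (at t)"
        using smooth_real_deriv by blast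
      show "C_k (Suc n) (sep_test k \<eta> a b)"
        unfolding C_k.simps
      proof (intro conjI allI ballI)
        fix z show "sep_test k \<eta> a b differentiable at z"
          using sep_test_has_derivative[OF g(2)] unfolding differentiable_def by blast
      next
        fix v :: "(real^3) \<times> real" assume "v \<in> Basis"
        then show "C_k n (dir_deriv v (sep_test k \<eta> a b))"
          by (cases rule: sum_Basis_prod_cases) (use Suc g \<eta> in \<open>auto simp: dir_deriv_sep_test[OF g(2)]\<close>)
      qed
    qed
  qed
  then show ?thesis using assms by (auto simp: smooth_def)
qed

lemma cosk_periodic: "cosk k (x + axis i 1) = cosk k x" and sink_periodic: "sink k (x + axis i 1) = sink k x"
proof -
  have *: "2 * pi * (freq k \<bullet> (x + axis i 1)) = 2 * pi * (freq k \<bullet> x) + 2 * pi * of_int (k i)"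
    by (simp add: inner_add_right inner_axis algebra_simps)
  have "sin (2 * pi * of_int (k i)) = 0" "cos (2 * pi * of_int (k i)) = 1"
    using sin_int_2pin cos_int_2pin by (auto simp: mult_ac)
  then show "cosk k (x + axis i 1) = cosk k x" "sink k (x + axis i 1) = sink k x"
    unfolding cosk_def sink_def * by (simp_all add: cos_add sin_add)
qed

lemma space_time_test_sep_test:
  assumes "time_test T \<eta>"
  shows "space_time_test T (sep_test k \<eta> a b)"
proof -
  obtain s r where "0 < s" "r < T" "\<And>t. \<eta> t \<noteq> 0 \<Longrightarrow> s \<le> t \<and> t \<le> r" and sm: "smooth_real \<eta>"
    using assms unfolding time_test_def by blast
  then show ?thesis
    unfolding space_time_test_def
    by (intro conjI smooth_sep_test exI[of _ s] exI[of _ r]) (auto simp: sep_test_def cosk_periodic sink_periodic)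
qed

lemma torus_test_cosk: "torus_test (cosk k)" and torus_test_sink: "torus_test (sink k)"
  and dir_deriv_cosk: "dir_deriv (axis i 1) (cosk k) x = - (2 * pi * of_int (k i)) * sink k x"
  and dir_deriv_sink: "dir_deriv (axis i 1) (sink k) x = 2 * pi * of_int (k i) * cosk k x"
proof -
  \<comment> \<open>As for \<open>sep_test\<close>, a two-parameter family closed under
    differentiation treats the cosine and the sine at once.\<close>
  define h where "h a b x = a * cosk k x + b * sink k x" for a b x
  have hd: "(h a b has_derivative (\<lambda>d. 2 * pi * (freq k \<bullet> d) * h b (- a) x)) (at x)" for a b x
    unfolding h_def[abs_def]
    by (rule has_derivative_eq_rhs, rule has_derivative_add[OF has_derivative_mult_right[OF cosk_has_derivative]
        has_derivative_mult_right[OF sink_has_derivative]]) (simp add: fun_eq_iff algebra_simps)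
  have dd: "dir_deriv (axis i 1) (h a b) = h (2 * pi * of_int (k i) * b) (- (2 * pi * of_int (k i) * a))" for i a b
    by (simp add: fun_eq_iff dir_deriv_def inner_axis h_def algebra_simps frechet_derivative_at[OF hd, symmetric])
  have "\<forall>a b. C_k n (h a b)" for n
  proof (induction n)
    case 0
    show ?case using hd by (auto intro!: continuous_at_imp_continuous_on has_derivative_continuous)
  next
    case (Suc n)
    have "h a b differentiable at x" for a b x
      using hd unfolding differentiable_def by blast
    moreover have "C_k n (dir_deriv v (h a b))" if "v \<in> Basis" for v a b
      using that Suc by (auto simp: Basis_vec_def dd)
    ultimately show ?case by simp
  qed
  then have sm: "smooth (h a b)" for a b by (simp add: smooth_def)
  have c: "h 1 0 = cosk k" and s: "h 0 1 = sink k" by (auto simp: h_def)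
  show "torus_test (cosk k)" "torus_test (sink k)"
    using sm[of 1 0] sm[of 0 1] unfolding c s by (auto simp: torus_test_def cosk_periodic sink_periodic)
  show "dir_deriv (axis i 1) (cosk k) x = - (2 * pi * of_int (k i)) * sink k x"
    "dir_deriv (axis i 1) (sink k) x = 2 * pi * of_int (k i) * cosk k x"
    using dd[of i 1 0] dd[of i 0 1] unfolding c s by (simp_all add: h_def)
qed

subsection \<open>Weak derivatives in time\<close>

abbreviation time_measure :: "real \<Rightarrow> real measure"
  where "time_measure T \<equiv> lebesgue_on {0<..<T}"

lemma finite_measure_time: "finite_measure (time_measure T)"
  by (rule finite_measure_lebesgue_on) simp

lemma measure_time: "0 < T \<Longrightarrow> measure (time_measure T) {0<..<T} = T"
  by (simp add: measure_restrict_space)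

text \<open>The positive and the negative part of \<open>W\<close> are densities of two finite
  measures that agree on all half-lines. The measures are therefore equal, and so are their
  densities almost everywhere.\<close>

lemma AE_zero_if_interval_integrals_zero:
  fixes W :: "real \<Rightarrow> real"
  assumes W: "integrable (time_measure T) W"
    and zero: "\<And>\<alpha> \<beta>. 0 \<le> \<alpha> \<Longrightarrow> \<alpha> < \<beta> \<Longrightarrow> \<beta> \<le> T \<Longrightarrow>
      (LINT t|time_measure T. indicator {\<alpha><..<\<beta>} t * W t) = 0"
  shows "AE t in time_measure T. W t = 0"
proof -
  define w where "w t = indicator {0<..<T} t * W t" for t
  have w: "integrable lebesgue w"
    using W by (simp add: w_def[abs_def] integrable_restrict_space)
  \<comment> \<open>The densities are taken with respect to \<open>lborel\<close>, which calls for a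
    Borel representative of the merely Lebesgue measurable \<open>w\<close>.\<close>
  then obtain V where V: "V \<in> borel_measurable lborel" and wV: "AE t in lborel. w t = V t"
    using completion_ex_borel_measurable_real[of w lborel] by auto
  have wV': "AE t in lebesgue. w t = V t"
    using wV by (simp add: AE_completion_iff)
  have Vm: "V \<in> borel_measurable lebesgue"
    using V by (rule measurable_completion)
  have "integrable lebesgue V"
    using integrable_cong_AE[OF _ Vm wV'] w by auto
  then have Vi: "integrable lborel V"
    using V by (simp add: integrable_completion)
  have V0: "(LINT t|lborel. indicator {x<..} t * V t) = 0" for x
  proof -
    have m: "(\<lambda>t. indicator {x<..} t * V t) \<in> borel_measurable lborel"
      using V by measurable
    have "(LINT t|lborel. indicator {x<..} t * V t) = (LINT t|lebesgue. indicator {x<..} t * V t)"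
      by (rule integral_completion[OF m, symmetric])
    also have "\<dots> = (LINT t|lebesgue. indicator {x<..} t * w t)"
      using wV' w Vm by (intro integral_cong_AE borel_measurable_times borel_measurable_indicator)
        (auto elim!: eventually_mono)
    also have "\<dots> = (LINT t|lebesgue. indicator {0<..<T} t *\<^sub>R (indicator {x<..} t * W t))"
      by (simp add: w_def mult_ac)
    also have "\<dots> = (LINT t|time_measure T. indicator {x<..} t * W t)"
      by (simp add: integral_restrict_space)
    also have "\<dots> = (LINT t|time_measure T. indicator {max 0 x<..<T} t * W t)"
      by (intro Bochner_Integration.integral_cong) (auto simp: indicator_def)
    also have "\<dots> = 0"
    proof (cases "max 0 x < T")
      case False
      then have "indicator {max 0 x<..<T} = (\<lambda>t::real. 0 :: real)" by (auto simp: indicator_def fun_eq_iff)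
      then show ?thesis by simp
    qed (intro zero, auto)
    finally show ?thesis .
  qed
  define p where "p t = max 0 (V t)" for t
  define n where "n t = max 0 (- V t)" for t
  have pm[measurable]: "p \<in> borel_measurable borel" and nm[measurable]: "n \<in> borel_measurable borel"
    using V by (auto simp: p_def[abs_def] n_def[abs_def])
  have pi: "integrable lborel p" and ni: "integrable lborel n"
    unfolding p_def[abs_def] n_def[abs_def] using Vi by auto
  have p0: "0 \<le> p t" and n0: "0 \<le> n t" for t by (simp_all add: p_def n_def)
  have em: "emeasure (density lborel (\<lambda>t. ennreal (f t))) {x<..} = ennreal (LINT t|lborel. indicator {x<..} t * f t)"
    if f: "integrable lborel f" "\<And>t. 0 \<le> f t" for f :: "real \<Rightarrow> real" and x
  proof -
    have [measurable]: "f \<in> borel_measurable borel" using f(1) by auto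
    have i: "integrable lborel (\<lambda>t. indicator {x<..} t * f t)"
      using integrable_mult_indicator[of "{x<..}" lborel f] f(1) by simp
    have "emeasure (density lborel (\<lambda>t. ennreal (f t))) {x<..} = (\<integral>\<^sup>+t. ennreal (f t) * indicator {x<..} t \<partial>lborel)"
      by (subst emeasure_density) auto
    also have "\<dots> = (\<integral>\<^sup>+t. ennreal (indicator {x<..} t * f t) \<partial>lborel)"
      by (intro nn_integral_cong) (auto simp: indicator_def)
    also have "\<dots> = ennreal (LINT t|lborel. indicator {x<..} t * f t)"
      by (rule nn_integral_eq_integral[OF i]) (use f(2) in auto)
    finally show ?thesis .
  qed
  have eqi: "(LINT t|lborel. indicator {x<..} t * p t) = (LINT t|lborel. indicator {x<..} t * n t)" for x
  proof -
    have "integrable lborel (\<lambda>t. indicator {x<..} t * p t)" "integrable lborel (\<lambda>t. indicator {x<..} t * n t)"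
      using integrable_mult_indicator[of "{x<..}" lborel p] integrable_mult_indicator[of "{x<..}" lborel n] pi ni by auto
    then have "(LINT t|lborel. indicator {x<..} t * p t) - (LINT t|lborel. indicator {x<..} t * n t)
        = (LINT t|lborel. indicator {x<..} t * p t - indicator {x<..} t * n t)"
      by simp
    also have "\<dots> = (LINT t|lborel. indicator {x<..} t * V t)"
      by (intro Bochner_Integration.integral_cong) (auto simp: p_def n_def max_def algebra_simps)
    finally show ?thesis using V0 by simp
  qed
  have "density lborel (\<lambda>t. ennreal (p t)) = density lborel (\<lambda>t. ennreal (n t))"
  proof (rule measure_eqI_lessThan)
    fix x
    show "emeasure (density lborel (\<lambda>t. ennreal (p t))) {x<..} = emeasure (density lborel (\<lambda>t. ennreal (n t))) {x<..}"
      using eqi[of x] em[OF pi p0, of x] em[OF ni n0, of x] by simp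
    show "emeasure (density lborel (\<lambda>t. ennreal (p t))) {x<..} < \<infinity>"
      using em[OF pi p0, of x] by simp
  qed auto
  moreover have "(\<integral>\<^sup>+ t. ennreal (p t) \<partial>lborel) \<noteq> \<infinity>"
    using nn_integral_eq_integral[OF pi] p0 by simp
  ultimately have "AE t in lborel. ennreal (p t) = ennreal (n t)"
    by (subst finite_density_unique[symmetric]) auto
  then have "AE t in lborel. V t = 0"
    by eventually_elim (auto simp: p_def n_def max_def split: if_splits)
  with wV have "AE t in lborel. t \<in> {0<..<T} \<longrightarrow> W t = 0"
    by eventually_elim (auto simp: w_def)
  then show ?thesis
    by (simp add: AE_restrict_space_iff AE_completion_iff)
qed

lemma smooth_real_measurable: "smooth_real f \<Longrightarrow> f \<in> borel_measurable (lebesgue_on A)"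
  by (intro measurable_restrict_space1 measurable_completion) (simp add: borel_measurable_continuous_onI smooth_real_imp_continuous)

lemma flat_exp_1_tendsto: "(flat_exp 1 \<longlongrightarrow> 1) at_top"
proof -
  have "((\<lambda>t::real. exp (- (1 / t))) \<longlongrightarrow> exp (- 0)) at_top"
    by (intro tendsto_intros tendsto_divide_0[OF tendsto_const filterlim_at_top_imp_at_infinity[OF filterlim_ident]])
  moreover have "\<forall>\<^sub>F t in at_top. exp (- (1 / t)) = flat_exp 1 t"
    using eventually_gt_at_top[of 0] by eventually_elim (simp add: flat_exp_def)
  ultimately show ?thesis by (simp add: tendsto_cong)
qed

text \<open>Bumps of growing steepness converge boundedly to the indicator of an interval, so
  dominated convergence leads back to integrals over intervals.\<close>

lemma AE_zero_if_test_integrals_zero: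
  assumes W: "integrable (time_measure T) W"
    and zero: "\<And>\<eta>. time_test T \<eta> \<Longrightarrow> (LINT t|time_measure T. \<eta> t * W t) = 0"
  shows "AE t in time_measure T. W t = 0"
proof (rule AE_zero_if_interval_integrals_zero[OF W])
  fix \<alpha> \<beta> :: real assume ab: "0 \<le> \<alpha>" "\<alpha> < \<beta>" "\<beta> \<le> T"
  define d where "d = \<beta> - \<alpha>"
  have d: "d > 0" using ab by (simp add: d_def)
  \<comment> \<open>The inward margin keeps the supports compact in (0, T) even if \<alpha> = 0 or
    \<beta> = T; it shrinks to zero, so that no point of the open interval is lost in the
    limit.\<close>
  define e where "e n = d / (real n + 2)" for n
  define \<psi> where "\<psi> n = bump (real n + 1) (\<alpha> + e n) (\<beta> - e n)" for n
  have e: "0 < e n" for n using d by (simp add: e_def add_pos_nonneg)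
  have e0: "e \<longlonglongrightarrow> 0"
  proof -
    have "(\<lambda>n. d * inverse (2 + real n)) \<longlonglongrightarrow> d * 0"
      by (intro tendsto_intros tendsto_inverse_0_at_top filterlim_tendsto_add_at_top[OF tendsto_const filterlim_real_sequentially])
    then show ?thesis by (simp add: e_def[abs_def] divide_inverse add.commute)
  qed
  have tt: "time_test T (\<psi> n)" for n
    unfolding \<psi>_def using ab e[of n] by (intro time_test_bump) auto
  have one: "(\<lambda>n. flat_exp 1 ((real n + 1) * (c - e n))) \<longlonglongrightarrow> 1" if "c > 0" for c
  proof (rule filterlim_compose[OF flat_exp_1_tendsto])
    have "(\<lambda>n. c - e n) \<longlonglongrightarrow> c - 0" by (intro tendsto_intros e0)
    moreover have "filterlim (\<lambda>n. real n + 1) at_top sequentially"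
      using filterlim_tendsto_add_at_top[OF tendsto_const[of 1] filterlim_real_sequentially] by (simp add: add.commute)
    ultimately show "filterlim (\<lambda>n. (real n + 1) * (c - e n)) at_top sequentially"
      using filterlim_tendsto_pos_mult_at_top[of "\<lambda>n. c - e n" c sequentially "\<lambda>n. real n + 1"] that
      by (simp add: mult.commute)
  qed
  have lim: "(\<lambda>n. \<psi> n t) \<longlonglongrightarrow> indicator {\<alpha><..<\<beta>} t" for t
  proof (cases "t \<in> {\<alpha><..<\<beta>}")
    case True
    have "(\<lambda>n. flat_exp 1 ((real n + 1) * ((t - \<alpha>) - e n)) * flat_exp 1 ((real n + 1) * ((\<beta> - t) - e n))) \<longlonglongrightarrow> 1 * 1"
      using True by (intro tendsto_mult one) auto
    then show ?thesis using True by (simp add: \<psi>_def bump_def algebra_simps)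
  next
    case False
    then have "\<psi> n t = 0" for n
      unfolding \<psi>_def using e[of n] by (intro bump_eq_0) auto
    then show ?thesis using False by simp
  qed
  have "(\<lambda>n. LINT t|time_measure T. \<psi> n t * W t) \<longlonglongrightarrow> (LINT t|time_measure T. indicator {\<alpha><..<\<beta>} t * W t)"
  proof (rule integral_dominated_convergence[where w = "\<lambda>t. \<bar>W t\<bar>"])
    show "AE t in time_measure T. (\<lambda>n. \<psi> n t * W t) \<longlonglongrightarrow> indicator {\<alpha><..<\<beta>} t * W t"
      by (intro AE_I2 tendsto_mult lim tendsto_const)
    show "AE t in time_measure T. norm (\<psi> n t * W t) \<le> \<bar>W t\<bar>" for n
      using bump_nonneg bump_le_1 by (auto simp: \<psi>_def abs_mult intro!: mult_left_le_one_le)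
    show "(\<lambda>t. \<psi> n t * W t) \<in> borel_measurable (time_measure T)" for n
      using W smooth_real_measurable tt unfolding time_test_def by (intro borel_measurable_times) auto
    show "(\<lambda>t. indicator {\<alpha><..<\<beta>} t * W t) \<in> borel_measurable (time_measure T)"
      by (intro borel_measurable_times borel_measurable_integrable[OF W] measurable_restrict_space1[OF measurable_completion[OF borel_measurable_indicator]])
        simp
  qed (use W in auto)
  then show "(LINT t|time_measure T. indicator {\<alpha><..<\<beta>} t * W t) = 0"
    unfolding zero[OF tt] using LIMSEQ_unique tendsto_const by blast
qed

text \<open>The cut-off at \<open>t\<close> is an indicator under a fixed measure rather than a
  change of domain, so Fubini applies on the square of that measure.\<close>

definition prim :: "real \<Rightarrow> (real \<Rightarrow> real) \<Rightarrow> real \<Rightarrow> real"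
  where "prim T g t = (LINT s|time_measure T. indicator {..t} s * g s)"

lemma ident_time_measurable: "(\<lambda>t. t) \<in> borel_measurable (time_measure T)"
  by (intro measurable_restrict_space1 measurable_completion) simp

lemma indicator_atMost_eq: "indicator {..t} s = (if s \<le> t then 1 else 0 :: real)"
  by (simp add: indicator_def)

lemma
  fixes g :: "real \<Rightarrow> real"
  assumes g: "integrable (time_measure T) g"
  shows integrable_indicator_atMost: "integrable (time_measure T) (\<lambda>s. indicator {..t} s * g s)"
    and integrable_indicator_atLeast: "integrable (time_measure T) (\<lambda>s. indicator {..s} t * g s)"
proof -
  note ident_time_measurable [measurable]
  have [measurable]: "g \<in> borel_measurable (time_measure T)" using g by auto
  show "integrable (time_measure T) (\<lambda>s. indicator {..t} s * g s)"
    unfolding indicator_atMost_eq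
    by (rule Bochner_Integration.integrable_bound[OF g]) auto
  show "integrable (time_measure T) (\<lambda>s. indicator {..s} t * g s)"
    unfolding indicator_atMost_eq
    by (rule Bochner_Integration.integrable_bound[OF g]) auto
qed

lemma abs_prim_le:
  assumes g: "integrable (time_measure T) g"
  shows "\<bar>prim T g t\<bar> \<le> (LINT s|time_measure T. \<bar>g s\<bar>)"
proof -
  have "\<bar>prim T g t\<bar> \<le> (LINT s|time_measure T. \<bar>indicator {..t} s * g s\<bar>)"
    unfolding prim_def by (rule integral_abs_bound)
  also have "\<dots> \<le> (LINT s|time_measure T. \<bar>g s\<bar>)"
    using g integrable_indicator_atMost[OF g] by (intro integral_mono) (auto simp: indicator_def)
  finally show ?thesis .
qed

lemma pair_time: "pair_sigma_finite (time_measure T) (time_measure T)"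
  using finite_measure_time[THEN finite_measure.axioms(1)] by (simp add: pair_sigma_finite_def)

lemma prim_measurable:
  assumes g: "g \<in> borel_measurable (time_measure T)"
  shows "prim T g \<in> borel_measurable (time_measure T)"
proof -
  interpret sigma_finite_measure "time_measure T"
    using finite_measure_time by (rule finite_measure.axioms(1))
  note g [measurable] ident_time_measurable [measurable]
  show ?thesis
    unfolding prim_def[abs_def] indicator_atMost_eq
    by (rule borel_measurable_lebesgue_integral) measurable
qed

lemma integrable_AE_bounded:
  fixes f :: "real \<Rightarrow> real"
  assumes "f \<in> borel_measurable (time_measure T)" "AE t in time_measure T. \<bar>f t\<bar> \<le> B"
  shows "integrable (time_measure T) f"
  using finite_measure.integrable_const_bound[OF finite_measure_time, of f B T] assms by simp

lemma integrable_mult_AE_bounded: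
  fixes f g :: "real \<Rightarrow> real"
  assumes f: "f \<in> borel_measurable (time_measure T)" "AE t in time_measure T. \<bar>f t\<bar> \<le> B"
    and g: "integrable (time_measure T) g"
  shows "integrable (time_measure T) (\<lambda>t. f t * g t)"
proof (rule Bochner_Integration.integrable_bound[of _ "\<lambda>t. B * g t"])
  show "AE t in time_measure T. norm (f t * g t) \<le> norm (B * g t)"
    using f(2)
  proof eventually_elim
    fix t assume "\<bar>f t\<bar> \<le> B"
    then have "\<bar>f t\<bar> \<le> \<bar>B\<bar>" by linarith
    then show "norm (f t * g t) \<le> norm (B * g t)"
      unfolding real_norm_def abs_mult by (rule mult_right_mono) simp
  qed
qed (use f g in auto)

lemma integrable_prim:
  fixes g :: "real \<Rightarrow> real"
  shows "integrable (time_measure T) g \<Longrightarrow> integrable (time_measure T) (prim T g)"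
  using abs_prim_le[of T g] by (intro integrable_AE_bounded[where B = "LINT s|time_measure T. \<bar>g s\<bar>"]) (auto intro: prim_measurable)

text \<open>Fubini on the triangle s \<le> t.\<close>

lemma prim_swap:
  assumes p: "integrable (time_measure T) p" and q: "integrable (time_measure T) q"
  shows "(LINT t|time_measure T. q t * prim T p t)
    = (LINT s|time_measure T. p s * (LINT t|time_measure T. indicator {..t} s * q t))"
proof -
  interpret pair_sigma_finite "time_measure T" "time_measure T" by (rule pair_time)
  note [measurable] = ident_time_measurable borel_measurable_integrable[OF p] borel_measurable_integrable[OF q]
  have bound: "integrable (time_measure T \<Otimes>\<^sub>M time_measure T) (\<lambda>(s, t). p s * q t)"
    using p q by (intro Fubini_integrable) (auto simp: abs_mult)
  have "integrable (time_measure T \<Otimes>\<^sub>M time_measure T) (\<lambda>(s, t). (if s \<le> t then 1 else 0) * (p s * q t))"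
    by (rule Bochner_Integration.integrable_bound[OF bound]) (auto simp: split_beta')
  from Fubini_integral[OF this]
  have "(LINT t|time_measure T. LINT s|time_measure T. (if s \<le> t then 1 else 0) * (p s * q t))
      = (LINT s|time_measure T. LINT t|time_measure T. (if s \<le> t then 1 else 0) * (p s * q t))" .
  also have "(\<lambda>t. LINT s|time_measure T. (if s \<le> t then 1 else 0) * (p s * q t)) = (\<lambda>t. q t * prim T p t)"
    by (simp add: prim_def indicator_atMost_eq fun_eq_iff mult.assoc[symmetric] mult.commute[of "q _"])
  also have "(\<lambda>s. LINT t|time_measure T. (if s \<le> t then 1 else 0) * (p s * q t))
      = (\<lambda>s. p s * (LINT t|time_measure T. indicator {..t} s * q t))"
    by (simp add: indicator_atMost_eq fun_eq_iff mult.left_commute)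
  finally show ?thesis .
qed

lemma smooth_real_add: "smooth_real f \<Longrightarrow> smooth_real g \<Longrightarrow> smooth_real (\<lambda>t. f t + g t)"
  unfolding smooth_real_def
proof (elim exE conjE)
  fix h h' assume "h 0 = f" "h' 0 = g"
    "\<forall>n t. (h n has_real_derivative h (Suc n) t) (at t)" "\<forall>n t. (h' n has_real_derivative h' (Suc n) t) (at t)"
  then show "\<exists>h. h 0 = (\<lambda>t. f t + g t) \<and> (\<forall>n t. (h n has_real_derivative h (Suc n) t) (at t))"
    by (intro exI[of _ "\<lambda>n t. h n t + h' n t"]) (auto intro!: DERIV_add)
qed

lemma smooth_real_cmult: "smooth_real f \<Longrightarrow> smooth_real (\<lambda>t. c * f t)"
  unfolding smooth_real_def
proof (elim exE conjE)
  fix h assume "h 0 = f" "\<forall>n t. (h n has_real_derivative h (Suc n) t) (at t)"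
  then show "\<exists>h. h 0 = (\<lambda>t. c * f t) \<and> (\<forall>n t. (h n has_real_derivative h (Suc n) t) (at t))"
    by (intro exI[of _ "\<lambda>n t. c * h n t"]) (auto intro!: DERIV_cmult)
qed

lemma time_test_add: "time_test T f \<Longrightarrow> time_test T g \<Longrightarrow> time_test T (\<lambda>t. f t + g t)"
proof -
  assume "time_test T f" "time_test T g"
  then obtain s r s' r' where *: "smooth_real f" "0 < s" "r < T" "\<And>t. f t \<noteq> 0 \<Longrightarrow> s \<le> t \<and> t \<le> r"
    "smooth_real g" "0 < s'" "r' < T" "\<And>t. g t \<noteq> 0 \<Longrightarrow> s' \<le> t \<and> t \<le> r'"
    unfolding time_test_def by metis
  have "min s s' \<le> t \<and> t \<le> max r r'" if "f t + g t \<noteq> 0" for t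
    using that *(4)[of t] *(8)[of t] by (cases "f t = 0") (auto simp: min_le_iff_disj le_max_iff_disj)
  then show ?thesis
    unfolding time_test_def using * smooth_real_add
    by (intro conjI exI[of _ "min s s'"] exI[of _ "max r r'"]) auto
qed

lemma time_test_cmult: "time_test T f \<Longrightarrow> time_test T (\<lambda>t. c * f t)"
  unfolding time_test_def by (auto simp: smooth_real_cmult)

lemma time_test_integrable_mult:
  assumes "time_test T \<eta>" and f: "integrable (time_measure T) f"
  shows "integrable (time_measure T) (\<lambda>t. \<eta> t * f t)"
proof -
  have sm: "smooth_real \<eta>" using assms(1) by (simp add: time_test_def)
  have "compact (\<eta> ` {0..T})"
    by (intro compact_continuous_image smooth_real_imp_continuous sm) simp
  then obtain B where "\<And>t. t \<in> {0..T} \<Longrightarrow> \<bar>\<eta> t\<bar> \<le> B"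
    using compact_imp_bounded bounded_iff by (metis imageI real_norm_def)
  then show ?thesis
    using f smooth_real_measurable[OF sm] by (intro integrable_mult_AE_bounded[where B = B]) auto
qed

lemma integrable_const_time [simp]: "integrable (time_measure T) (\<lambda>_. c :: real)"
  using finite_measure.integrable_const[OF finite_measure_time] .

lemma FTC_time:
  assumes F: "\<And>t. (F has_real_derivative f t) (at t)" and f: "continuous_on UNIV f"
    and r: "0 \<le> r" "r \<le> T"
  shows "(LINT t|time_measure T. indicator {..t} r * f t) = F T - F r"
proof -
  have fm[measurable]: "f \<in> borel_measurable borel" using f by (rule borel_measurable_continuous_onI)
  have "(LINT t|time_measure T. indicator {..t} r * f t) = (LINT t|lebesgue. indicator {0<..<T} t *\<^sub>R (indicator {r..} t * f t))"
    by (simp add: integral_restrict_space indicator_def)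
  also have "\<dots> = (LINT t|lborel. indicator {0<..<T} t *\<^sub>R (indicator {r..} t * f t))"
    by (rule integral_completion) measurable
  also have "\<dots> = (LINT t|lborel. indicator {r..T} t *\<^sub>R f t)"
  proof (rule integral_cong_AE)
    show "AE t in lborel. indicator {0<..<T} t *\<^sub>R (indicator {r..} t * f t) = indicator {r..T} t *\<^sub>R f t"
      using AE_lborel_singleton[of 0] AE_lborel_singleton[of T]
      by eventually_elim (use r in \<open>auto simp: indicator_def\<close>)
  qed measurable
  also have "\<dots> = F T - F r"
  proof (rule integral_FTC_atLeastAtMost[OF r(2)])
    show "(F has_vector_derivative f x) (at x within {r..T})" for x
      using F[of x] by (simp add: has_real_derivative_iff_has_vector_derivative has_vector_derivative_at_within)
    show "continuous_on {r..T} f" using f by (rule continuous_on_subset) simp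
  qed
  finally show ?thesis .
qed

text \<open>An antiderivative is constant on either side of the support of \<zeta>. Vanishing mean
  makes the two constants equal, and subtracting their common value leaves compact support.\<close>

lemma time_test_antiderivative:
  assumes \<zeta>: "time_test T \<zeta>" and z: "(LINT t|time_measure T. \<zeta> t) = 0" and T: "0 < T"
  obtains \<eta> where "time_test T \<eta>" "\<And>t. (\<eta> has_real_derivative \<zeta> t) (at t)"
    "\<And>r. 0 < r \<Longrightarrow> r < T \<Longrightarrow> (LINT t|time_measure T. indicator {..t} r * \<zeta> t) = - \<eta> r"
proof -
  obtain s r where sr: "smooth_real \<zeta>" "0 < s" "r < T" "\<And>t. \<zeta> t \<noteq> 0 \<Longrightarrow> s \<le> t \<and> t \<le> r"
    using \<zeta> unfolding time_test_def by blast
  have c: "continuous_on UNIV \<zeta>" using sr(1) by (rule smooth_real_imp_continuous)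
  obtain F where F: "\<And>t. (F has_real_derivative \<zeta> t) (at t)"
    using einterval_antiderivative[of "- \<infinity>" \<infinity> \<zeta>] c
    by (auto simp: continuous_on_eq_continuous_at has_real_derivative_iff_has_vector_derivative)
  have FT: "F T = F 0"
  proof -
    have "(LINT t|time_measure T. \<zeta> t) = (LINT t|time_measure T. indicator {..t} 0 * \<zeta> t)"
      by (intro Bochner_Integration.integral_cong) auto
    then show ?thesis using FTC_time[OF F c, of 0 T] T z by simp
  qed
  define \<eta> where "\<eta> t = F t - F 0" for t
  have d: "(\<eta> has_real_derivative \<zeta> t) (at t)" for t
    unfolding \<eta>_def[abs_def] using F[of t] by (auto intro!: derivative_eq_intros)
  have const: "F t = F t'" if "S = {..<s} \<or> S = {r<..}" "t \<in> S" "t' \<in> S" for S t t'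
  proof -
    have cv: "convex S" using that(1) by auto
    have "(F has_real_derivative 0) (at x within S)" if "x \<in> S" for x
    proof -
      have "\<zeta> x = 0" using sr(4)[of x] \<open>S = {..<s} \<or> S = {r<..}\<close> that by (cases "\<zeta> x = 0") auto
      then show ?thesis using F[of x] by (auto intro: has_field_derivative_at_within)
    qed
    then show ?thesis
      using has_field_derivative_zero_constant[OF cv, of F] that by metis
  qed
  have "s \<le> t \<and> t \<le> r" if "\<eta> t \<noteq> 0" for t
  proof (rule ccontr)
    assume "\<not> (s \<le> t \<and> t \<le> r)"
    then consider "t < s" | "r < t" by linarith
    then show False
    proof cases
      case 1
      then show False using const[of "{..<s}" t 0] sr that by (auto simp: \<eta>_def)
    next
      case 2
      then show False using const[of "{r<..}" t T] sr that FT by (auto simp: \<eta>_def)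
    qed
  qed
  then have "time_test T \<eta>"
    unfolding time_test_def using smooth_real_antideriv[OF sr(1) d] sr by blast
  moreover have "(LINT t|time_measure T. indicator {..t} r * \<zeta> t) = - \<eta> r" if "0 < r" "r < T" for r
    using FTC_time[OF F c, of r T] that FT by (simp add: \<eta>_def)
  ultimately show ?thesis using that d by blast
qed

text \<open>\<open>weak\<close> tests only with derivatives of test functions, that is, with test
  functions of mean zero. An arbitrary \<psi> is brought to mean zero by a multiple of one fixed
  bump \<rho>, and this correction accounts for the constant.\<close>

lemma du_Bois_Reymond:
  assumes T: "0 < T" and F: "integrable (time_measure T) F" and G: "integrable (time_measure T) G"
    and weak: "\<And>\<eta> \<eta>'. time_test T \<eta> \<Longrightarrow> (\<And>t. (\<eta> has_real_derivative \<eta>' t) (at t)) \<Longrightarrow>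
      (LINT t|time_measure T. \<eta>' t * F t) = - (LINT t|time_measure T. \<eta> t * G t)"
  shows "\<exists>c. AE t in time_measure T. F t = c + prim T G t"
proof -
  define \<rho> where "\<rho> = bump 1 (T / 3) (2 * T / 3)"
  have \<rho>: "time_test T \<rho>" unfolding \<rho>_def using T by (intro time_test_bump) auto
  define R where "R = (LINT t|time_measure T. \<rho> t)"
  have test_int: "integrable (time_measure T) \<psi>" if "time_test T \<psi>" for \<psi>
    using time_test_integrable_mult[OF that, of "\<lambda>_. 1"] by simp
  have "R \<noteq> 0"
  proof
    assume "R = 0"
    then have "AE t in time_measure T. \<rho> t = 0"
      unfolding R_def using test_int[OF \<rho>] by (subst (asm) integral_nonneg_eq_0_iff_AE) (auto simp: \<rho>_def bump_nonneg)
    then have "AE t in lborel. t \<in> {0<..<T} \<longrightarrow> \<rho> t = 0"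
      by (simp add: AE_restrict_space_iff AE_completion_iff)
    then have "AE t in lborel. t \<notin> {T/3<..<2*T/3}"
      by eventually_elim (use bump_pos[of 1 "T/3" _ "2*T/3"] T in \<open>force simp: \<rho>_def\<close>)
    then have "{T/3<..<2*T/3} \<in> null_sets lborel"
      by (subst AE_iff_null_sets) auto
    then have "emeasure lborel {T/3<..<2*T/3} = 0" by (rule null_setsD1)
    then show False using T by (simp add: emeasure_lborel_Ioo)
  qed
  define W where "W t = F t - prim T G t" for t
  have W: "integrable (time_measure T) W"
    unfolding W_def[abs_def] using F integrable_prim[OF G] by simp
  \<comment> \<open>The only candidate: testing W = c with \<rho> forces this value.\<close>
  define c where "c = (LINT t|time_measure T. \<rho> t * W t) / R"
  have main: "(LINT t|time_measure T. \<psi> t * (W t - c)) = 0" if \<psi>: "time_test T \<psi>" for \<psi>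
  proof -
    define m where "m = (LINT t|time_measure T. \<psi> t)"
    define \<zeta> where "\<zeta> t = \<psi> t + (- m / R) * \<rho> t" for t
    have \<zeta>: "time_test T \<zeta>"
      unfolding \<zeta>_def[abs_def] by (intro time_test_add time_test_cmult \<psi> \<rho>)
    have "(LINT t|time_measure T. \<zeta> t) = 0"
      unfolding \<zeta>_def using test_int[OF \<psi>] test_int[OF \<rho>] \<open>R \<noteq> 0\<close>
      by (simp add: R_def[symmetric] m_def[symmetric] del: mult_minus_left)
    from time_test_antiderivative[OF \<zeta> this T]
    obtain \<eta> where \<eta>: "time_test T \<eta>" "\<And>t. (\<eta> has_real_derivative \<zeta> t) (at t)"
      "\<And>r. 0 < r \<Longrightarrow> r < T \<Longrightarrow> (LINT t|time_measure T. indicator {..t} r * \<zeta> t) = - \<eta> r" by blast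
    have "(LINT t|time_measure T. \<zeta> t * prim T G t)
        = (LINT s|time_measure T. G s * (LINT t|time_measure T. indicator {..t} s * \<zeta> t))"
      by (rule prim_swap[OF G test_int[OF \<zeta>]])
    also have "\<dots> = (LINT s|time_measure T. - (\<eta> s * G s))"
      by (intro Bochner_Integration.integral_cong) (auto simp: \<eta>(3))
    also have "\<dots> = (LINT t|time_measure T. \<zeta> t * F t)"
      using weak[OF \<eta>(1,2)] by simp
    finally have "(LINT t|time_measure T. \<zeta> t * W t) = 0"
      unfolding W_def using time_test_integrable_mult[OF \<zeta> F] time_test_integrable_mult[OF \<zeta> integrable_prim[OF G]]
      by (simp add: right_diff_distrib)
    also have "(LINT t|time_measure T. \<zeta> t * W t) = (LINT t|time_measure T. \<psi> t * W t) + (- m / R) * (LINT t|time_measure T. \<rho> t * W t)"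
    proof -
      have "(\<lambda>t. \<zeta> t * W t) = (\<lambda>t. \<psi> t * W t + (- m / R) * (\<rho> t * W t))"
        by (simp add: \<zeta>_def fun_eq_iff distrib_right left_diff_distrib)
      then show ?thesis
        using time_test_integrable_mult[OF \<psi> W] time_test_integrable_mult[OF \<rho> W]
        by (simp only: Bochner_Integration.integral_add Bochner_Integration.integral_mult_right_zero Bochner_Integration.integrable_mult_right)
    qed
    finally have "(LINT t|time_measure T. \<psi> t * W t) = c * m"
      by (simp add: c_def)
    then show ?thesis
      using time_test_integrable_mult[OF \<psi> W] test_int[OF \<psi>] by (simp add: right_diff_distrib m_def)
  qed
  have "AE t in time_measure T. W t - c = 0"
    by (rule AE_zero_if_test_integrals_zero) (use W main in auto)
  then have "AE t in time_measure T. F t = c + prim T G t"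
    by eventually_elim (simp add: W_def)
  then show ?thesis ..
qed

lemma prim_cong_AE:
  assumes "AE s in time_measure T. f s = g s"
    "f \<in> borel_measurable (time_measure T)" "g \<in> borel_measurable (time_measure T)"
  shows "prim T f t = prim T g t"
  unfolding prim_def
proof (rule integral_cong_AE)
  note ident_time_measurable [measurable] assms(2,3) [measurable]
  show "(\<lambda>s. indicator {..t} s * f s) \<in> borel_measurable (time_measure T)"
    "(\<lambda>s. indicator {..t} s * g s) \<in> borel_measurable (time_measure T)"
    unfolding indicator_atMost_eq by measurable
  show "AE s in time_measure T. indicator {..t} s * f s = indicator {..t} s * g s"
    using assms(1) by eventually_elim simp
qed

lemma prim_add:
  assumes "integrable (time_measure T) f" "integrable (time_measure T) g"
  shows "prim T (\<lambda>s. f s + g s) t = prim T f t + prim T g t"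
  using integrable_indicator_atMost[OF assms(1), of t] integrable_indicator_atMost[OF assms(2), of t]
  by (simp add: prim_def distrib_left)

lemma prim_cmult: "prim T (\<lambda>s. c * f s) t = c * prim T f t"
  by (simp add: prim_def mult.left_commute)

lemma AE_time_neq: "AE s in time_measure T. s \<noteq> r"
proof -
  have "AE s in lebesgue. s \<noteq> r"
    unfolding AE_completion_iff by (rule AE_lborel_singleton)
  then show ?thesis by (auto simp: AE_restrict_space_iff elim: eventually_mono)
qed

lemma integrable_mult_prim:
  assumes p: "integrable (time_measure T) p" and q: "integrable (time_measure T) q"
  shows "integrable (time_measure T) (\<lambda>s. prim T p s * q s)"
  by (rule integrable_mult_AE_bounded[OF prim_measurable[OF borel_measurable_integrable[OF p]] AE_I2[OF abs_prim_le[OF p]] q])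

text \<open>Integration by parts for primitives of integrable functions: the product is an integral
  over the square [0, t]^2, which the diagonal cuts into two triangles.\<close>

lemma prim_mult:
  assumes p: "integrable (time_measure T) p" and q: "integrable (time_measure T) q"
  shows "prim T p t * prim T q t = prim T (\<lambda>s. p s * prim T q s + prim T p s * q s) t"
proof -
  \<comment> \<open>\<open>q'\<close> is \<open>q\<close> cut off at \<open>t\<close>, and
    \<open>B r\<close> is the part of its integral beyond \<open>r\<close>. In the splitting at
    \<open>r\<close> the common point is a null set.\<close>
  define q' where "q' s = indicator {..t} s * q s" for s
  define B where "B r = (LINT s|time_measure T. indicator {..s} r * q' s)" for r
  have q': "integrable (time_measure T) q'"
    unfolding q'_def by (rule integrable_indicator_atMost[OF q])
  have split: "prim T q t = prim T q' r + B r" for r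
  proof -
    have "prim T q t = (LINT s|time_measure T. q' s)" by (simp add: prim_def q'_def)
    also have "\<dots> = (LINT s|time_measure T. indicator {..r} s * q' s + indicator {..s} r * q' s)"
    proof (rule integral_cong_AE)
      show "AE s in time_measure T. q' s = indicator {..r} s * q' s + indicator {..s} r * q' s"
        using AE_time_neq[of r T] by eventually_elim (auto simp: indicator_def)
    qed (use q' integrable_indicator_atMost[OF q', of r] integrable_indicator_atLeast[OF q', of r] in auto)
    also have "\<dots> = prim T q' r + B r"
      using integrable_indicator_atMost[OF q', of r] integrable_indicator_atLeast[OF q', of r]
      by (simp add: prim_def B_def)
    finally show ?thesis .
  qed
  have pQ: "integrable (time_measure T) (\<lambda>s. p s * prim T q s)"
    using integrable_mult_prim[OF q p] by (simp add: mult.commute)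
  have Pq: "integrable (time_measure T) (\<lambda>s. prim T p s * q s)"
    by (rule integrable_mult_prim[OF p q])
  have Bz: "B r = 0" if "t < r" for r
  proof -
    have "B r = (LINT s|time_measure T. 0)"
      unfolding B_def q'_def using that by (intro Bochner_Integration.integral_cong) (auto simp: indicator_def)
    then show ?thesis by simp
  qed
  have A: "prim T q' r = prim T q r" if "r \<le> t" for r
    unfolding prim_def q'_def using that by (intro Bochner_Integration.integral_cong) (auto simp: indicator_def)
  have eq: "indicator {..t} r * p r * prim T q t = indicator {..t} r * (p r * prim T q r) + p r * B r" for r
  proof (cases "r \<le> t")
    case True
    then show ?thesis using split[of r] A[of r] by (simp add: distrib_left)
  qed (use Bz in auto)
  have pB: "integrable (time_measure T) (\<lambda>r. p r * B r)"
  proof -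
    have "integrable (time_measure T) (\<lambda>r. indicator {..t} r * p r * prim T q t - indicator {..t} r * (p r * prim T q r))"
      by (intro Bochner_Integration.integrable_diff integrable_mult_left impI integrable_indicator_atMost p pQ)
    then show ?thesis by (simp add: eq)
  qed
  have "prim T p t * prim T q t = (LINT r|time_measure T. indicator {..t} r * p r * prim T q t)"
    by (simp add: prim_def[of T p])
  also have "\<dots> = (LINT r|time_measure T. indicator {..t} r * (p r * prim T q r) + p r * B r)"
    by (simp only: eq)
  also have "\<dots> = prim T (\<lambda>s. p s * prim T q s) t + (LINT r|time_measure T. p r * B r)"
    using integrable_indicator_atMost[OF pQ, of t] pB by (simp add: prim_def)
  also have "(LINT r|time_measure T. p r * B r) = (LINT s|time_measure T. q' s * prim T p s)"
    unfolding B_def by (rule prim_swap[OF p q', symmetric])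
  also have "\<dots> = prim T (\<lambda>s. prim T p s * q s) t"
    unfolding prim_def[of T "\<lambda>s. prim T p s * q s"] q'_def by (simp add: mult_ac)
  also have "prim T (\<lambda>s. p s * prim T q s) t + \<dots> = prim T (\<lambda>s. p s * prim T q s + prim T p s * q s) t"
    using prim_add[OF pQ Pq] by simp
  finally show ?thesis .
qed

text \<open>Membership in W^(1,1)(0, T), stated through the absolutely continuous representative.
  The product rule and the bounds on oscillation and on averaging errors are read off from this
  form; \<open>du_Bois_Reymond\<close> leads to it from the distributional one.\<close>

definition has_weak_deriv :: "real \<Rightarrow> (real \<Rightarrow> real) \<Rightarrow> (real \<Rightarrow> real) \<Rightarrow> bool"
  where "has_weak_deriv T f g \<longleftrightarrow> integrable (time_measure T) f \<and> integrable (time_measure T) g \<and>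
    (\<exists>c. AE t in time_measure T. f t = c + prim T g t)"

lemma has_weak_deriv_integrable:
  "has_weak_deriv T f g \<Longrightarrow> integrable (time_measure T) f"
  "has_weak_deriv T f g \<Longrightarrow> integrable (time_measure T) g"
  by (simp_all add: has_weak_deriv_def)

lemma has_weak_deriv_bounded:
  assumes "has_weak_deriv T f g"
  obtains B where "AE t in time_measure T. \<bar>f t\<bar> \<le> B"
proof -
  obtain c where c: "AE t in time_measure T. f t = c + prim T g t" and g: "integrable (time_measure T) g"
    using assms by (auto simp: has_weak_deriv_def)
  have "AE t in time_measure T. \<bar>f t\<bar> \<le> \<bar>c\<bar> + (LINT s|time_measure T. \<bar>g s\<bar>)"
    using c
  proof eventually_elim
    fix t assume "f t = c + prim T g t"
    then show "\<bar>f t\<bar> \<le> \<bar>c\<bar> + (LINT s|time_measure T. \<bar>g s\<bar>)" using abs_prim_le[OF g, of t] by linarith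
  qed
  then show ?thesis by (rule that)
qed

lemma has_weak_deriv_zero: "has_weak_deriv T (\<lambda>_. 0) (\<lambda>_. 0)"
  by (auto simp: has_weak_deriv_def prim_def intro!: exI[of _ 0])

lemma has_weak_deriv_add:
  assumes "has_weak_deriv T f f'" "has_weak_deriv T h h'"
  shows "has_weak_deriv T (\<lambda>t. f t + h t) (\<lambda>t. f' t + h' t)"
proof -
  obtain c d where "AE t in time_measure T. f t = c + prim T f' t" "AE t in time_measure T. h t = d + prim T h' t"
    using assms by (auto simp: has_weak_deriv_def)
  then have "AE t in time_measure T. f t + h t = (c + d) + prim T (\<lambda>t. f' t + h' t) t"
    by eventually_elim (use assms in \<open>simp add: prim_add has_weak_deriv_def\<close>)
  then show ?thesis using assms unfolding has_weak_deriv_def by blast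
qed

lemma has_weak_deriv_cmult:
  assumes "has_weak_deriv T f f'"
  shows "has_weak_deriv T (\<lambda>t. a * f t) (\<lambda>t. a * f' t)"
proof -
  obtain c where "AE t in time_measure T. f t = c + prim T f' t"
    using assms by (auto simp: has_weak_deriv_def)
  then have "AE t in time_measure T. a * f t = a * c + prim T (\<lambda>t. a * f' t) t"
    by eventually_elim (simp add: prim_cmult distrib_left)
  then show ?thesis using assms unfolding has_weak_deriv_def by auto
qed

lemma has_weak_deriv_diff:
  assumes "has_weak_deriv T f f'" "has_weak_deriv T h h'"
  shows "has_weak_deriv T (\<lambda>t. f t - h t) (\<lambda>t. f' t - h' t)"
  using has_weak_deriv_add[OF assms(1) has_weak_deriv_cmult[OF assms(2), of "-1"]] by simp

lemma has_weak_deriv_sum: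
  assumes "\<And>i. i \<in> A \<Longrightarrow> has_weak_deriv T (f i) (f' i)"
  shows "has_weak_deriv T (\<lambda>t. \<Sum>i\<in>A. f i t) (\<lambda>t. \<Sum>i\<in>A. f' i t)"
  using assms
  by (induction A rule: infinite_finite_induct) (auto intro: has_weak_deriv_zero has_weak_deriv_add)

lemma has_weak_deriv_mult:
  assumes f: "has_weak_deriv T f f'" and h: "has_weak_deriv T h h'"
  shows "has_weak_deriv T (\<lambda>t. f t * h t) (\<lambda>t. f' t * h t + f t * h' t)"
proof -
  obtain c d where c: "AE t in time_measure T. f t = c + prim T f' t" and d: "AE t in time_measure T. h t = d + prim T h' t"
    using assms by (auto simp: has_weak_deriv_def)
  note i = has_weak_deriv_integrable[OF f] has_weak_deriv_integrable[OF h]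
  obtain B where B: "AE t in time_measure T. \<bar>f t\<bar> \<le> B" using f by (rule has_weak_deriv_bounded)
  obtain D where D: "AE t in time_measure T. \<bar>h t\<bar> \<le> D" using h by (rule has_weak_deriv_bounded)
  have fh: "integrable (time_measure T) (\<lambda>t. f t * h t)"
    by (rule integrable_mult_AE_bounded[OF _ B i(3)]) (use i in auto)
  have fh': "integrable (time_measure T) (\<lambda>t. f t * h' t)"
    by (rule integrable_mult_AE_bounded[OF _ B i(4)]) (use i in auto)
  have f'h: "integrable (time_measure T) (\<lambda>t. f' t * h t)"
    using integrable_mult_AE_bounded[OF _ D i(2)] i by (simp add: mult.commute)
  have pQ: "integrable (time_measure T) (\<lambda>s. f' s * prim T h' s)"
    using integrable_mult_prim[OF i(4) i(2)] by (simp add: mult.commute)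
  have Pq: "integrable (time_measure T) (\<lambda>s. prim T f' s * h' s)"
    by (rule integrable_mult_prim[OF i(2) i(4)])
  \<comment> \<open>Both factors are constants plus primitives; after expanding, only the product of
    the two primitives needs \<open>prim_mult\<close>.\<close>
  have AEg: "AE t in time_measure T. f' t * h t + f t * h' t
      = c * h' t + (d * f' t + (f' t * prim T h' t + prim T f' t * h' t))"
    using c d by eventually_elim (simp add: algebra_simps)
  have "prim T (\<lambda>t. f' t * h t + f t * h' t) t
      = prim T (\<lambda>t. c * h' t + (d * f' t + (f' t * prim T h' t + prim T f' t * h' t))) t" for t
    by (rule prim_cong_AE[OF AEg]) (use i fh' f'h pQ Pq in auto)
  also have "\<dots> t = c * prim T h' t + (d * prim T f' t + prim T f' t * prim T h' t)" for t
  proof -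
    have "prim T (\<lambda>t. c * h' t + (d * f' t + (f' t * prim T h' t + prim T f' t * h' t))) t
        = prim T (\<lambda>t. c * h' t) t + (prim T (\<lambda>t. d * f' t) t + prim T (\<lambda>t. f' t * prim T h' t + prim T f' t * h' t) t)"
      using i pQ Pq by (simp add: prim_add)
    then show ?thesis by (simp add: prim_cmult prim_mult[OF i(2) i(4)])
  qed
  finally have P: "prim T (\<lambda>t. f' t * h t + f t * h' t) t
      = c * prim T h' t + (d * prim T f' t + prim T f' t * prim T h' t)" for t .
  have "AE t in time_measure T. f t * h t = c * d + prim T (\<lambda>t. f' t * h t + f t * h' t) t"
    using c d by eventually_elim (unfold P, simp add: algebra_simps)
  then show ?thesis using fh fh' f'h unfolding has_weak_deriv_def by auto
qed

section \<open>Mean oscillation in time\<close>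

definition oscillation :: "real \<Rightarrow> (real \<Rightarrow> real) \<Rightarrow> real"
  where "oscillation T f = (LINT t|time_measure T. \<bar>f t - (LINT s|time_measure T. f s) / T\<bar>)"

lemma integral_const_time: "0 < T \<Longrightarrow> (LINT t|time_measure T. (c::real)) = T * c"
  by (simp add: measure_time)

text \<open>The mean is nearly the best constant: it differs from \<open>c\<close> by at most the
  average of |f - c|, whence the factor 2.\<close>

lemma oscillation_le_shift:
  assumes T: "0 < T" and f: "integrable (time_measure T) f"
  shows "oscillation T f \<le> 2 * (LINT t|time_measure T. \<bar>f t - c\<bar>)"
proof -
  let ?m = "(LINT s|time_measure T. f s) / T"
  have fc: "integrable (time_measure T) (\<lambda>t. f t - c)" using f by simp
  have "c - ?m = - (LINT s|time_measure T. f s - c) / T"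
    using T f by (simp add: integral_const_time measure_time field_simps)
  then have "\<bar>c - ?m\<bar> = \<bar>LINT s|time_measure T. f s - c\<bar> / T" using T by simp
  also have "\<dots> \<le> (LINT t|time_measure T. \<bar>f t - c\<bar>) / T"
    using T by (intro divide_right_mono integral_abs_bound) simp
  finally have m: "T * \<bar>c - ?m\<bar> \<le> (LINT t|time_measure T. \<bar>f t - c\<bar>)"
    using T by (simp add: field_simps)
  have "oscillation T f \<le> (LINT t|time_measure T. \<bar>f t - c\<bar> + \<bar>c - ?m\<bar>)"
    unfolding oscillation_def using f by (intro integral_mono) auto
  also have "\<dots> = (LINT t|time_measure T. \<bar>f t - c\<bar>) + T * \<bar>c - ?m\<bar>"
    using fc T by (simp add: integral_const_time measure_time)
  finally show ?thesis using m by simp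
qed

text \<open>Lipschitz continuity in L^1, with one contribution from the functions and one from their
  means. Through this estimate conservation passes to limits.\<close>

lemma oscillation_diff_le:
  assumes T: "0 < T" and f: "integrable (time_measure T) f" and g: "integrable (time_measure T) g"
  shows "oscillation T f \<le> oscillation T g + 2 * (LINT t|time_measure T. \<bar>f t - g t\<bar>)"
proof -
  let ?f = "(LINT s|time_measure T. f s) / T" and ?g = "(LINT s|time_measure T. g s) / T"
  have fg: "integrable (time_measure T) (\<lambda>t. f t - g t)" using f g by simp
  have "\<bar>?g - ?f\<bar> = \<bar>LINT s|time_measure T. f s - g s\<bar> / T"
    using T f g by (simp add: diff_divide_distrib[symmetric] abs_minus_commute)
  also have "\<dots> \<le> (LINT t|time_measure T. \<bar>f t - g t\<bar>) / T"
    using T by (intro divide_right_mono integral_abs_bound) simp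
  finally have m: "T * \<bar>?g - ?f\<bar> \<le> (LINT t|time_measure T. \<bar>f t - g t\<bar>)"
    using T by (simp add: field_simps)
  have "oscillation T f \<le> (LINT t|time_measure T. \<bar>g t - ?g\<bar> + (\<bar>f t - g t\<bar> + \<bar>?g - ?f\<bar>))"
    unfolding oscillation_def using f g by (intro integral_mono) auto
  also have "\<dots> = oscillation T g + ((LINT t|time_measure T. \<bar>f t - g t\<bar>) + T * \<bar>?g - ?f\<bar>)"
    using fg g T by (simp add: integral_const_time measure_time oscillation_def)
  finally show ?thesis using m by simp
qed

lemma oscillation_has_weak_deriv:
  assumes T: "0 < T" and f: "has_weak_deriv T f g"
  shows "oscillation T f \<le> 2 * T * (LINT t|time_measure T. \<bar>g t\<bar>)"
proof -
  obtain c where c: "AE t in time_measure T. f t = c + prim T g t"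
    using f by (auto simp: has_weak_deriv_def)
  note i = has_weak_deriv_integrable[OF f]
  have "oscillation T f \<le> 2 * (LINT t|time_measure T. \<bar>f t - c\<bar>)"
    by (rule oscillation_le_shift[OF T i(1)])
  also have "(LINT t|time_measure T. \<bar>f t - c\<bar>) \<le> (LINT t|time_measure T. (LINT s|time_measure T. \<bar>g s\<bar>))"
  proof (rule integral_mono_AE)
    show "AE t in time_measure T. \<bar>f t - c\<bar> \<le> (LINT s|time_measure T. \<bar>g s\<bar>)"
      using c by eventually_elim (simp add: abs_prim_le[OF i(2)])
  qed (use i in auto)
  finally show ?thesis using T by (simp add: integral_const_time measure_time)
qed

lemma oscillation_nonneg: "0 \<le> oscillation T f"
  by (simp add: oscillation_def)

lemma AE_const_if_oscillation_0:
  assumes f: "integrable (time_measure T) f" and z: "oscillation T f = 0"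
  shows "\<exists>c. AE t in time_measure T. f t = c"
proof -
  have "AE t in time_measure T. \<bar>f t - (LINT s|time_measure T. f s) / T\<bar> = 0"
    using z f unfolding oscillation_def by (subst (asm) integral_nonneg_eq_0_iff_AE) auto
  then show ?thesis by auto
qed

subsection \<open>Strong compactness from bounded variation\<close>

definition cell :: "nat \<Rightarrow> real \<Rightarrow> real \<Rightarrow> int"
  where "cell n T t = \<lfloor>real n * t / T\<rfloor>"

definition cell_ind :: "nat \<Rightarrow> real \<Rightarrow> real \<Rightarrow> real \<Rightarrow> real"
  where "cell_ind n T t s = (if cell n T s = cell n T t then 1 else 0)"

text \<open>A conditional expectation with respect to the partition into cells of length T / n,
  written as an integral operator with a symmetric kernel.\<close>

definition cell_avg :: "nat \<Rightarrow> real \<Rightarrow> (real \<Rightarrow> real) \<Rightarrow> real \<Rightarrow> real"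
  where "cell_avg n T f t = real n / T * (LINT s|time_measure T. cell_ind n T t s * f s)"

lemma cell_ind_commute: "cell_ind n T t s = cell_ind n T s t"
  by (simp add: cell_ind_def eq_commute)

lemma cell_measurable: "cell n T \<in> time_measure T \<rightarrow>\<^sub>M count_space UNIV"
proof -
  note ident_time_measurable [measurable]
  show ?thesis unfolding cell_def[abs_def] by measurable
qed

lemma cell_ind_measurable: "cell_ind n T t \<in> borel_measurable (time_measure T)"
proof -
  note cell_measurable [measurable]
  show ?thesis unfolding cell_ind_def[abs_def] by measurable
qed

lemma abs_cell_ind_le: "\<bar>cell_ind n T t s\<bar> \<le> 1" and cell_ind_nonneg: "0 \<le> cell_ind n T t s"
  by (simp_all add: cell_ind_def)

lemma integrable_cell_ind_mult:
  assumes "integrable (time_measure T) f"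
  shows "integrable (time_measure T) (\<lambda>s. cell_ind n T t s * f s)"
  by (rule integrable_mult_AE_bounded[OF cell_ind_measurable AE_I2[OF abs_cell_ind_le] assms])

lemma integral_cell_ind:
  assumes T: "0 < T" and n: "0 < n" and t: "t \<in> {0<..<T}"
  shows "(LINT s|time_measure T. cell_ind n T t s) = T / real n"
proof -
  define m where "m = cell n T t"
  define a where "a = real_of_int m * T / real n"
  define b where "b = (real_of_int m + 1) * T / real n"
  have cell_iff: "cell n T s = m \<longleftrightarrow> a \<le> s \<and> s < b" for s
    unfolding cell_def a_def b_def floor_eq_iff using T n by (simp add: field_simps)
  have m0: "0 \<le> m" using t T n by (simp add: m_def cell_def)
  have "real n * t / T < real n" using t T n by (simp add: field_simps)
  then have "m < int n" by (simp add: m_def cell_def floor_less_iff)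
  then have "real_of_int m + 1 \<le> real n" by linarith
  then have "b \<le> real n * T / real n"
    unfolding b_def using T n by (intro divide_right_mono mult_right_mono) auto
  then have ab: "0 \<le> a" "b \<le> T" "a \<le> b" "b - a = T / real n"
    using T n m0 by (auto simp: a_def b_def field_simps)
  have "(LINT s|time_measure T. cell_ind n T t s)
      = (LINT s|lebesgue. indicator {0<..<T} s *\<^sub>R indicator {a..<b} s)"
    by (simp add: integral_restrict_space)
      (intro Bochner_Integration.integral_cong, auto simp: cell_ind_def m_def[symmetric] cell_iff indicator_def)
  also have "\<dots> = (LINT s|lborel. indicator {0<..<T} s *\<^sub>R indicator {a..<b} s)"
    by (rule integral_completion) measurable
  also have "\<dots> = (LINT s|lborel. indicator {a..b} s)"
  proof (rule integral_cong_AE)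
    show "AE s in lborel. indicator {0<..<T} s *\<^sub>R indicator {a..<b} s = (indicator {a..b} s :: real)"
      using AE_lborel_singleton[of 0] AE_lborel_singleton[of b]
      by eventually_elim (use ab in \<open>auto simp: indicator_def\<close>)
  qed measurable
  also have "\<dots> = T / real n" using ab by simp
  finally show ?thesis .
qed

lemma cell_ind_integral_swap:
  assumes p: "integrable (time_measure T) p" and q: "integrable (time_measure T) q"
  shows "(LINT t|time_measure T. q t * (LINT s|time_measure T. cell_ind n T t s * p s))
    = (LINT s|time_measure T. p s * (LINT t|time_measure T. cell_ind n T s t * q t))"
    and "integrable (time_measure T) (\<lambda>t. LINT s|time_measure T. cell_ind n T t s * p s)"
proof -
  interpret pair_sigma_finite "time_measure T" "time_measure T" by (rule pair_time)
  note [measurable] = cell_measurable borel_measurable_integrable[OF p] borel_measurable_integrable[OF q]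
  have *: "integrable (time_measure T \<Otimes>\<^sub>M time_measure T) (\<lambda>(s, t). cell_ind n T t s * (p s * q t))"
    if "integrable (time_measure T) q" for q
  proof -
    note [measurable] = borel_measurable_integrable[OF that]
    have bound: "integrable (time_measure T \<Otimes>\<^sub>M time_measure T) (\<lambda>(s, t). p s * q t)"
      using p that by (intro Fubini_integrable) (auto simp: abs_mult)
    have m: "(\<lambda>(s, t). cell_ind n T t s * (p s * q t)) \<in> borel_measurable (time_measure T \<Otimes>\<^sub>M time_measure T)"
      unfolding cell_ind_def[abs_def] by measurable
    show ?thesis
      by (rule Bochner_Integration.integrable_bound[OF bound m]) (auto simp: cell_ind_def)
  qed
  from Fubini_integral[OF *[OF q]]
  have "(LINT t|time_measure T. LINT s|time_measure T. cell_ind n T t s * (p s * q t))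
      = (LINT s|time_measure T. LINT t|time_measure T. cell_ind n T t s * (p s * q t))" .
  also have "(\<lambda>t. LINT s|time_measure T. cell_ind n T t s * (p s * q t))
      = (\<lambda>t. q t * (LINT s|time_measure T. cell_ind n T t s * p s))"
    by (simp add: fun_eq_iff mult.assoc[symmetric] mult.commute[of "q _"])
  also have "(\<lambda>s. LINT t|time_measure T. cell_ind n T t s * (p s * q t))
      = (\<lambda>s. p s * (LINT t|time_measure T. cell_ind n T s t * q t))"
    by (simp add: fun_eq_iff mult.left_commute cell_ind_commute[of n T _ _])
  finally show "(LINT t|time_measure T. q t * (LINT s|time_measure T. cell_ind n T t s * p s))
    = (LINT s|time_measure T. p s * (LINT t|time_measure T. cell_ind n T s t * q t))" .
  show "integrable (time_measure T) (\<lambda>t. LINT s|time_measure T. cell_ind n T t s * p s)"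
    using integrable_snd[OF *[of "\<lambda>_. 1"]] by simp
qed

lemma integrable_cell_avg:
  "integrable (time_measure T) f \<Longrightarrow> integrable (time_measure T) (cell_avg n T f)"
  unfolding cell_avg_def[abs_def] by (intro integrable_mult_right impI cell_ind_integral_swap(2))

text \<open>Symmetry of \<open>cell_ind\<close> and Fubini. The averaging moves onto the test
  function, where weak convergence can be used.\<close>

lemma cell_avg_adjoint:
  assumes "integrable (time_measure T) p" "integrable (time_measure T) q"
  shows "(LINT t|time_measure T. q t * cell_avg n T p t) = (LINT t|time_measure T. cell_avg n T q t * p t)"
proof -
  have "(LINT t|time_measure T. q t * cell_avg n T p t)
      = real n / T * (LINT t|time_measure T. q t * (LINT s|time_measure T. cell_ind n T t s * p s))"
    unfolding cell_avg_def by (subst integral_mult_right_zero[symmetric]) (simp add: mult.left_commute)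
  also have "\<dots> = (LINT t|time_measure T. cell_avg n T q t * p t)"
    unfolding cell_ind_integral_swap(1)[OF assms] cell_avg_def
    by (subst integral_mult_right_zero[symmetric]) (simp add: mult_ac)
  finally show ?thesis .
qed

lemma cell_avg_1: "0 < T \<Longrightarrow> 0 < n \<Longrightarrow> t \<in> {0<..<T} \<Longrightarrow> cell_avg n T (\<lambda>_. c) t = c"
  using integral_cell_ind[of T n t] by (simp add: cell_avg_def)

lemma abs_cell_avg_le:
  assumes T: "0 < T" and n: "0 < n" and f: "integrable (time_measure T) f" and b: "\<And>s. \<bar>f s\<bar> \<le> B"
    and t: "t \<in> {0<..<T}"
  shows "\<bar>cell_avg n T f t\<bar> \<le> B"
proof -
  have "\<bar>LINT s|time_measure T. cell_ind n T t s * f s\<bar> \<le> (LINT s|time_measure T. \<bar>cell_ind n T t s * f s\<bar>)"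
    by (rule integral_abs_bound)
  also have "\<dots> \<le> (LINT s|time_measure T. cell_ind n T t s * B)"
    using integrable_cell_ind_mult[OF f, of n t] integrable_cell_ind_mult[of T "\<lambda>_. B" n t] b
    by (intro integral_mono integrable_abs) (auto simp: abs_mult cell_ind_nonneg intro!: mult_mono)
  also have "\<dots> = T / real n * B"
    using integral_cell_ind[OF T n t] by simp
  finally have "real n / T * \<bar>LINT s|time_measure T. cell_ind n T t s * f s\<bar> \<le> real n / T * (T / real n * B)"
    using T n by (intro mult_left_mono) auto
  then show ?thesis using T n by (simp add: cell_avg_def abs_mult)
qed

lemma cell_between:
  assumes "0 < T" "cell n T s = cell n T t" "s \<le> r" "r \<le> t"
  shows "cell n T r = cell n T t"
proof -
  have "cell n T s \<le> cell n T r" "cell n T r \<le> cell n T t"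
    unfolding cell_def using assms by (auto intro!: floor_mono divide_right_mono mult_left_mono)
  then show ?thesis using assms(2) by simp
qed

text \<open>Within a cell, \<open>f\<close> varies by at most the integral of |g| over that cell.
  When this is integrated in \<open>t\<close>, each value of |g| is counted with the cell length T /
  n.\<close>

lemma integral_abs_minus_cell_avg_le:
  assumes T: "0 < T" and n: "0 < n" and f: "has_weak_deriv T f g"
  shows "(LINT t|time_measure T. \<bar>f t - cell_avg n T f t\<bar>) \<le> T / real n * (LINT t|time_measure T. \<bar>g t\<bar>)"
proof -
  obtain c where c: "AE t in time_measure T. f t = c + prim T g t"
    using f by (auto simp: has_weak_deriv_def)
  note i = has_weak_deriv_integrable[OF f]
  define E where "E t = (LINT r|time_measure T. cell_ind n T t r * \<bar>g r\<bar>)" for t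
  have gi: "integrable (time_measure T) (\<lambda>r. \<bar>g r\<bar>)" using i by simp
  have Ei: "integrable (time_measure T) E"
    unfolding E_def[abs_def] by (rule cell_ind_integral_swap(2)[OF gi gi])
  have P: "\<bar>prim T g t - prim T g s\<bar> \<le> E t" if "cell n T s = cell n T t" for s t
  proof -
    have "\<bar>prim T g t - prim T g s\<bar> = \<bar>LINT r|time_measure T. indicator {..t} r * g r - indicator {..s} r * g r\<bar>"
      using integrable_indicator_atMost[OF i(2), of t] integrable_indicator_atMost[OF i(2), of s] by (simp add: prim_def)
    also have "\<dots> \<le> (LINT r|time_measure T. \<bar>indicator {..t} r * g r - indicator {..s} r * g r\<bar>)"
      by (rule integral_abs_bound)
    also have "\<dots> \<le> E t"
      unfolding E_def
    proof (intro integral_mono integrable_cell_ind_mult gi integrable_abs Bochner_Integration.integrable_diff integrable_indicator_atMost i)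
      fix r
      show "\<bar>indicator {..t} r * g r - indicator {..s} r * g r\<bar> \<le> cell_ind n T t r * \<bar>g r\<bar>"
        using cell_between[OF T, of n s t r] cell_between[OF T, of n t s r] that
        by (auto simp: indicator_def cell_ind_def)
    qed
    finally show ?thesis .
  qed
  have "AE t in time_measure T. \<bar>f t - cell_avg n T f t\<bar> \<le> E t"
    using c AE_space
  proof eventually_elim
    fix t assume ft: "f t = c + prim T g t" and "t \<in> space (time_measure T)"
    then have t: "t \<in> {0<..<T}" by simp
    have ii: "integrable (time_measure T) (\<lambda>s. cell_ind n T t s * (f t - f s))"
      using i by (intro integrable_cell_ind_mult) simp
    have "f t - cell_avg n T f t = cell_avg n T (\<lambda>_. f t) t - cell_avg n T f t"
      by (simp add: cell_avg_1[OF T n t])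
    also have "\<dots> = real n / T * (LINT s|time_measure T. cell_ind n T t s * (f t - f s))"
      using integrable_cell_ind_mult[OF i(1), of n t] integrable_cell_ind_mult[of T "\<lambda>_. f t" n t]
      by (simp add: cell_avg_def right_diff_distrib)
    finally have "\<bar>f t - cell_avg n T f t\<bar> \<le> real n / T * (LINT s|time_measure T. \<bar>cell_ind n T t s * (f t - f s)\<bar>)"
      using T integral_abs_bound[of "time_measure T" "\<lambda>s. cell_ind n T t s * (f t - f s)"]
      by (simp add: abs_mult mult_left_mono divide_right_mono)
    also have "(LINT s|time_measure T. \<bar>cell_ind n T t s * (f t - f s)\<bar>) \<le> (LINT s|time_measure T. cell_ind n T t s * E t)"
    proof (rule integral_mono_AE)
      show "AE s in time_measure T. \<bar>cell_ind n T t s * (f t - f s)\<bar> \<le> cell_ind n T t s * E t"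
        using c
      proof eventually_elim
        fix s assume "f s = c + prim T g s"
        then show "\<bar>cell_ind n T t s * (f t - f s)\<bar> \<le> cell_ind n T t s * E t"
          using P[of s t] ft by (simp add: cell_ind_def)
      qed
      show "integrable (time_measure T) (\<lambda>s. cell_ind n T t s * E t)"
        by (rule integrable_cell_ind_mult) simp
    qed (use ii in simp)
    finally show "\<bar>f t - cell_avg n T f t\<bar> \<le> E t"
      using T n integral_cell_ind[OF T n t] by (simp add: mult_left_mono divide_right_mono)
  qed
  then have "(LINT t|time_measure T. \<bar>f t - cell_avg n T f t\<bar>) \<le> (LINT t|time_measure T. E t)"
    using i Ei integrable_cell_avg[OF i(1)] by (intro integral_mono_AE) auto
  also have "(LINT t|time_measure T. E t) = (LINT s|time_measure T. \<bar>g s\<bar> * (LINT t|time_measure T. cell_ind n T s t))"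
    using cell_ind_integral_swap(1)[OF gi, of "\<lambda>_. 1" n] by (simp add: E_def)
  also have "\<dots> = (LINT s|time_measure T. \<bar>g s\<bar> * (T / real n))"
    by (intro Bochner_Integration.integral_cong) (auto simp: integral_cell_ind[OF T n])
  also have "\<dots> = T / real n * (LINT t|time_measure T. \<bar>g t\<bar>)"
    by simp
  finally show ?thesis .
qed

text \<open>A bound on the derivatives in \<open>L\<^sup>1\<close> upgrades weak convergence to strong convergence: averaging
  over cells of length \<open>T / n\<close> costs at most \<open>C * T / n\<close>, and the averages converge pointwise.\<close>

lemma weak_imp_strong_convergence:
  fixes f g :: "nat \<Rightarrow> real \<Rightarrow> real" and F :: "real \<Rightarrow> real"
  assumes T: "0 < T" and f: "\<And>j. has_weak_deriv T (f j) (g j)"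
    and C: "\<And>j. (LINT t|time_measure T. \<bar>g j t\<bar>) \<le> C"
    and F: "integrable (time_measure T) F"
    and weak: "\<And>\<theta> :: real \<Rightarrow> real. \<theta> \<in> borel_measurable (time_measure T) \<Longrightarrow> (\<And>t. \<bar>\<theta> t\<bar> \<le> 1) \<Longrightarrow>
      (\<lambda>j. LINT t|time_measure T. \<theta> t * f j t) \<longlonglongrightarrow> (LINT t|time_measure T. \<theta> t * F t)"
  shows "(\<lambda>j. LINT t|time_measure T. \<bar>f j t - F t\<bar>) \<longlonglongrightarrow> 0"
    and "\<exists>B. (\<forall>j. AE t in time_measure T. \<bar>f j t\<bar> \<le> B) \<and> (AE t in time_measure T. \<bar>F t\<bar> \<le> B)"
proof -
  note i = has_weak_deriv_integrable(1)[OF f]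
  have th_int: "integrable (time_measure T) (\<lambda>t. \<theta> t * h t)" "integrable (time_measure T) \<theta>"
    if "\<theta> \<in> borel_measurable (time_measure T)" "\<And>t. \<bar>\<theta> t\<bar> \<le> 1" "integrable (time_measure T) h" for \<theta> h :: "real \<Rightarrow> real"
    using integrable_mult_AE_bounded[OF that(1) AE_I2[OF that(2)] that(3)]
      integrable_AE_bounded[OF that(1) AE_I2[OF that(2)]] by this+
  show bdd: "\<exists>B. (\<forall>j. AE t in time_measure T. \<bar>f j t\<bar> \<le> B) \<and> (AE t in time_measure T. \<bar>F t\<bar> \<le> B)"
  proof -
    have "Bseq (\<lambda>j. LINT t|time_measure T. f j t)"
      using convergentI[OF weak[of "\<lambda>_. 1"]] by (intro convergent_imp_Bseq) simp
    then obtain D where D: "\<And>j. \<bar>LINT t|time_measure T. f j t\<bar> \<le> D"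
      by (auto simp: Bseq_def)
    \<comment> \<open>D / T bounds the mean of \<open>f j\<close>. The additive constant
      \<open>c\<close> differs from the mean by at most \<open>C\<close>, and the primitive
      contributes another \<open>C\<close>.\<close>
    define B where "B = D / T + 2 * C"
    have fB: "AE t in time_measure T. \<bar>f j t\<bar> \<le> B" for j
    proof -
      obtain c where c: "AE t in time_measure T. f j t = c + prim T (g j) t"
        using f[of j] by (auto simp: has_weak_deriv_def)
      have gj: "integrable (time_measure T) (g j)" using f has_weak_deriv_integrable by blast
      have P: "\<bar>prim T (g j) t\<bar> \<le> C" for t
        using abs_prim_le[OF gj, of t] C[of j] by linarith
      have "(LINT t|time_measure T. f j t) = (LINT t|time_measure T. c + prim T (g j) t)"
        using c i[of j] integrable_prim[OF gj] by (intro integral_cong_AE) auto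
      also have "\<dots> = T * c + (LINT t|time_measure T. prim T (g j) t)"
        using integrable_prim[OF gj] T by (simp add: measure_time)
      finally have "T * c = (LINT t|time_measure T. f j t) - (LINT t|time_measure T. prim T (g j) t)" by simp
      moreover have "\<bar>LINT t|time_measure T. prim T (g j) t\<bar> \<le> T * C"
      proof -
        have "\<bar>LINT t|time_measure T. prim T (g j) t\<bar> \<le> (LINT t|time_measure T. \<bar>prim T (g j) t\<bar>)"
          by (rule integral_abs_bound)
        also have "\<dots> \<le> (LINT t|time_measure T. C)"
          using P integrable_prim[OF gj] by (intro integral_mono) auto
        finally show ?thesis using T by (simp add: measure_time)
      qed
      ultimately have "\<bar>T * c\<bar> \<le> D + T * C" using D[of j] by linarith
      then have "\<bar>c\<bar> \<le> D / T + C" using T by (simp add: abs_mult field_simps)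
      show ?thesis using c
      proof eventually_elim
        fix t assume "f j t = c + prim T (g j) t"
        then show "\<bar>f j t\<bar> \<le> B" using P[of t] \<open>\<bar>c\<bar> \<le> D / T + C\<close> by (simp add: B_def)
      qed
    qed
    \<comment> \<open>The bound passes to the weak limit by duality: test with the sign \<sigma> on
      the set where it fails.\<close>
    have FB: "AE t in time_measure T. \<sigma> * F t \<le> B" if \<sigma>: "\<sigma> = 1 \<or> \<sigma> = -1" for \<sigma> :: real
    proof -
      define \<theta> where "\<theta> t = (if \<sigma> * F t > B then \<sigma> else 0)" for t
      have Fm[measurable]: "F \<in> borel_measurable (time_measure T)" using F by auto
      have \<theta>m: "\<theta> \<in> borel_measurable (time_measure T)" unfolding \<theta>_def[abs_def] by measurable
      have \<theta>1: "\<bar>\<theta> t\<bar> \<le> 1" for t using \<sigma> by (auto simp: \<theta>_def)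
      have \<sigma>\<theta>: "0 \<le> \<sigma> * \<theta> t" for t using \<sigma> by (auto simp: \<theta>_def)
      have \<sigma>i: "integrable (time_measure T) (\<lambda>t. \<sigma> * \<theta> t)" using th_int(2)[OF \<theta>m \<theta>1 F] by simp
      have "(LINT t|time_measure T. \<theta> t * F t) \<le> (LINT t|time_measure T. \<sigma> * \<theta> t * B)"
      proof (rule LIMSEQ_le_const2[OF weak[OF \<theta>m \<theta>1]], intro exI allI impI)
        fix j
        show "(LINT t|time_measure T. \<theta> t * f j t) \<le> (LINT t|time_measure T. \<sigma> * \<theta> t * B)"
        proof (rule integral_mono_AE)
          show "AE t in time_measure T. \<theta> t * f j t \<le> \<sigma> * \<theta> t * B"
            using fB[of j]
          proof eventually_elim
            fix t assume "\<bar>f j t\<bar> \<le> B"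
            then show "\<theta> t * f j t \<le> \<sigma> * \<theta> t * B" using \<sigma> by (auto simp: \<theta>_def)
          qed
        qed (use th_int(1)[OF \<theta>m \<theta>1 i] \<sigma>i in auto)
      qed
      moreover have ii: "integrable (time_measure T) (\<lambda>t. \<theta> t * F t - \<sigma> * \<theta> t * B)"
        using th_int(1)[OF \<theta>m \<theta>1 F] \<sigma>i by simp
      moreover have nn: "0 \<le> \<theta> t * F t - \<sigma> * \<theta> t * B" for t
        using \<sigma> by (auto simp: \<theta>_def)
      ultimately have "(LINT t|time_measure T. \<theta> t * F t - \<sigma> * \<theta> t * B) = 0"
        using th_int(1)[OF \<theta>m \<theta>1 F] \<sigma>i by (intro antisym integral_nonneg_AE) auto
      then have "AE t in time_measure T. \<theta> t * F t - \<sigma> * \<theta> t * B = 0"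
        using ii nn by (subst (asm) integral_nonneg_eq_0_iff_AE) auto
      then show ?thesis
        by eventually_elim (use \<sigma> in \<open>auto simp: \<theta>_def split: if_splits\<close>)
    qed
    have "AE t in time_measure T. \<bar>F t\<bar> \<le> B"
      using FB[of 1] FB[of "-1"] by auto
    then show ?thesis using fB by blast
  qed
  then obtain B where B: "\<And>j. AE t in time_measure T. \<bar>f j t\<bar> \<le> B" by blast
  have fB: "(LINT t|time_measure T. \<bar>f j t\<bar>) \<le> T * B" for j
  proof -
    have "(LINT t|time_measure T. \<bar>f j t\<bar>) \<le> (LINT t|time_measure T. B)"
      using B[of j] i[of j] by (intro integral_mono_AE) auto
    then show ?thesis using T by (simp add: measure_time)
  qed
  show "(\<lambda>j. LINT t|time_measure T. \<bar>f j t - F t\<bar>) \<longlonglongrightarrow> 0"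
  proof (rule LIMSEQ_I)
    fix e :: real assume e: "0 < e"
    \<comment> \<open>The averaging error is at most C T / n and has to stay below e / 3; the
      summand 1 makes \<open>n\<close> positive.\<close>
    obtain n where n: "3 * (C * T) / e + 1 < real n" using reals_Archimedean2 by blast
    have C0: "0 \<le> C" using C[of 0] by (rule order_trans[rotated]) simp
    have "0 \<le> 3 * (C * T) / e" using C0 T e by simp
    then have n0: "0 < n" using n by (cases n) auto
    have "3 * (C * T) / e < real n" using n by linarith
    then have Cn: "T / real n * C < e / 3" using n0 e by (simp add: field_simps)
    define a where "a = cell_avg n T"
    have dev: "(LINT t|time_measure T. \<bar>f j t - a (f j) t\<bar>) \<le> T / real n * C" for j
    proof -
      have "(LINT t|time_measure T. \<bar>f j t - a (f j) t\<bar>) \<le> T / real n * (LINT t|time_measure T. \<bar>g j t\<bar>)"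
        unfolding a_def by (rule integral_abs_minus_cell_avg_le[OF T n0 f])
      also have "\<dots> \<le> T / real n * C" using T by (intro mult_left_mono C) simp
      finally show ?thesis .
    qed
    have ai: "integrable (time_measure T) (a h)" if "integrable (time_measure T) h" for h
      unfolding a_def by (rule integrable_cell_avg[OF that])
    \<comment> \<open>No weak derivative of \<open>F\<close> is at hand. The averaging error of the
      \<open>f j\<close> is carried over by weak lower semicontinuity, testing with the sign of
      \<open>F - a F\<close>.\<close>
    have devF: "(LINT t|time_measure T. \<bar>F t - a F t\<bar>) \<le> T / real n * C"
    proof -
      define \<theta> where "\<theta> t = sgn (F t - a F t)" for t
      have [measurable]: "(\<lambda>t. F t - a F t) \<in> borel_measurable (time_measure T)" using F ai[OF F] by auto
      have \<theta>m: "\<theta> \<in> borel_measurable (time_measure T)" unfolding \<theta>_def[abs_def] by measurable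
      have \<theta>1: "\<bar>\<theta> t\<bar> \<le> 1" for t by (simp add: \<theta>_def sgn_if)
      have \<theta>i: "integrable (time_measure T) \<theta>" by (rule th_int(2)[OF \<theta>m \<theta>1 F])
      \<comment> \<open>\<open>weak\<close> asks for a test function bounded by 1 everywhere,
        whereas the averages of \<theta> are controlled only inside (0, T); hence the extension by
        zero.\<close>
      define \<theta>' where "\<theta>' t = (if t \<in> {0<..<T} then a \<theta> t else 0)" for t
      have eq: "(LINT t|time_measure T. \<theta> t * a h t) = (LINT t|time_measure T. \<theta>' t * h t)"
        if "integrable (time_measure T) h" for h
        unfolding a_def cell_avg_adjoint[OF that \<theta>i]
        by (intro Bochner_Integration.integral_cong) (auto simp: \<theta>'_def a_def)
      have \<theta>'m: "\<theta>' \<in> borel_measurable (time_measure T)"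
        using borel_measurable_integrable[OF ai[OF \<theta>i]]
        by (rule measurable_cong[THEN iffD1, rotated]) (simp add: \<theta>'_def)
      have \<theta>'1: "\<bar>\<theta>' t\<bar> \<le> 1" for t
        using abs_cell_avg_le[OF T n0 \<theta>i \<theta>1, of t] by (auto simp: \<theta>'_def a_def)
      have diff: "(LINT t|time_measure T. \<theta> t * (h t - a h t)) = (LINT t|time_measure T. \<theta> t * h t) - (LINT t|time_measure T. \<theta>' t * h t)"
        if h: "integrable (time_measure T) h" for h
        unfolding eq[OF h, symmetric] right_diff_distrib
        by (intro Bochner_Integration.integral_diff th_int(1)[OF \<theta>m \<theta>1] h ai)
      have lim: "(\<lambda>j. LINT t|time_measure T. \<theta> t * (f j t - a (f j) t)) \<longlonglongrightarrow> (LINT t|time_measure T. \<theta> t * (F t - a F t))"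
        unfolding diff[OF i] diff[OF F] by (intro tendsto_diff weak \<theta>m \<theta>1 \<theta>'m \<theta>'1)
      have "(LINT t|time_measure T. \<theta> t * (F t - a F t)) \<le> T / real n * C"
      proof (rule LIMSEQ_le_const2[OF lim], intro exI allI impI)
        fix j
        have "(LINT t|time_measure T. \<theta> t * (f j t - a (f j) t)) \<le> (LINT t|time_measure T. \<bar>f j t - a (f j) t\<bar>)"
        proof (rule integral_mono)
          show "\<theta> t * (f j t - a (f j) t) \<le> \<bar>f j t - a (f j) t\<bar>" for t
            using \<theta>1[of t] by (metis abs_ge_self abs_ge_zero abs_mult mult_left_le_one_le order_trans)
          show "integrable (time_measure T) (\<lambda>t. \<theta> t * (f j t - a (f j) t))"
            by (intro th_int(1)[OF \<theta>m \<theta>1] Bochner_Integration.integrable_diff i ai)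
        qed (use i ai in auto)
        then show "(LINT t|time_measure T. \<theta> t * (f j t - a (f j) t)) \<le> T / real n * C"
          using dev[of j] by linarith
      qed
      moreover have "(\<lambda>t. \<theta> t * (F t - a F t)) = (\<lambda>t. \<bar>F t - a F t\<bar>)"
        by (simp add: \<theta>_def fun_eq_iff sgn_if)
      ultimately show ?thesis by simp
    qed
    have avg_lim: "(\<lambda>j. LINT t|time_measure T. \<bar>a (f j) t - a F t\<bar>) \<longlonglongrightarrow> (LINT t|time_measure T. 0)"
    proof (rule integral_dominated_convergence[where w = "\<lambda>t. real n / T * (T * B) + \<bar>a F t\<bar>"])
      show "AE t in time_measure T. (\<lambda>j. \<bar>a (f j) t - a F t\<bar>) \<longlonglongrightarrow> 0"
      proof (rule AE_I2)
        fix t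
        have "(\<lambda>j. a (f j) t) \<longlonglongrightarrow> a F t"
          unfolding a_def cell_avg_def by (intro tendsto_mult tendsto_const weak cell_ind_measurable abs_cell_ind_le)
        then show "(\<lambda>j. \<bar>a (f j) t - a F t\<bar>) \<longlonglongrightarrow> 0"
          using tendsto_rabs_zero LIM_zero by blast
      qed
      show "AE t in time_measure T. norm \<bar>a (f j) t - a F t\<bar> \<le> real n / T * (T * B) + \<bar>a F t\<bar>" for j
      proof (rule AE_I2)
        fix t
        have "\<bar>LINT s|time_measure T. cell_ind n T t s * f j s\<bar> \<le> (LINT s|time_measure T. \<bar>cell_ind n T t s * f j s\<bar>)"
          by (rule integral_abs_bound)
        also have "\<dots> \<le> (LINT s|time_measure T. \<bar>f j s\<bar>)"
          using i[of j] integrable_cell_ind_mult[OF i[of j], of n t] by (intro integral_mono) (auto simp: cell_ind_def)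
        also have "\<dots> \<le> T * B" by (rule fB)
        finally have "\<bar>a (f j) t\<bar> \<le> real n / T * (T * B)"
          unfolding a_def cell_avg_def abs_mult using T by (intro mult_mono) auto
        then show "norm \<bar>a (f j) t - a F t\<bar> \<le> real n / T * (T * B) + \<bar>a F t\<bar>"
          unfolding real_norm_def by linarith
      qed
      show "(\<lambda>t. \<bar>a (f j) t - a F t\<bar>) \<in> borel_measurable (time_measure T)" for j
        using ai[OF i[of j]] ai[OF F] by auto
    qed (use ai[OF F] in auto)
    then obtain N where N: "\<And>j. j \<ge> N \<Longrightarrow> (LINT t|time_measure T. \<bar>a (f j) t - a F t\<bar>) < e / 3"
      using LIMSEQ_D[OF avg_lim, of "e / 3"] e by auto
    show "\<exists>no. \<forall>j\<ge>no. norm ((LINT t|time_measure T. \<bar>f j t - F t\<bar>) - 0) < e"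
    proof (intro exI allI impI)
      fix j assume j: "N \<le> j"
      have add3: "x + (y + z) < e" if "x \<le> K" "z \<le> K" "y < e / 3" "K < e / 3" for x y z K
        using that by linarith
      note ii = i[of j] F ai[OF i[of j]] ai[OF F]
      have "(LINT t|time_measure T. \<bar>f j t - F t\<bar>)
          \<le> (LINT t|time_measure T. \<bar>f j t - a (f j) t\<bar> + (\<bar>a (f j) t - a F t\<bar> + \<bar>F t - a F t\<bar>))"
        using ii by (intro integral_mono) auto
      also have "\<dots> = (LINT t|time_measure T. \<bar>f j t - a (f j) t\<bar>) + ((LINT t|time_measure T. \<bar>a (f j) t - a F t\<bar>)
          + (LINT t|time_measure T. \<bar>F t - a F t\<bar>))"
        using ii by simp
      also have "\<dots> < e" by (rule add3[OF dev devF N[OF j] Cn])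
      finally show "norm ((LINT t|time_measure T. \<bar>f j t - F t\<bar>) - 0) < e" by simp
    qed
  qed
qed

subsection \<open>Uniform boundedness in \<open>L\<^sup>2\<close>\<close>

definition square_integrable :: "'a measure \<Rightarrow> ('a \<Rightarrow> 'b::euclidean_space) \<Rightarrow> bool"
  where "square_integrable M f \<longleftrightarrow> f \<in> borel_measurable M \<and> integrable M (\<lambda>z. (norm (f z))\<^sup>2)"

lemma abs_inner_le_squares:
  fixes u v :: "'b::real_inner"
  shows "\<bar>u \<bullet> v\<bar> \<le> ((norm u)\<^sup>2 + (norm v)\<^sup>2) / 2"
proof -
  have "\<bar>u \<bullet> v\<bar> \<le> norm u * norm v" by (rule Cauchy_Schwarz_ineq2)
  also have "2 * (norm u * norm v) \<le> (norm u)\<^sup>2 + (norm v)\<^sup>2"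
    using sum_squares_bound[of "norm u" "norm v"] by (simp add: mult.assoc)
  finally show ?thesis by simp
qed

lemma square_integrable_inner:
  assumes "square_integrable M f" "square_integrable M g"
  shows "integrable M (\<lambda>z. f z \<bullet> g z)"
proof (rule Bochner_Integration.integrable_bound)
  show "integrable M (\<lambda>z. ((norm (f z))\<^sup>2 + (norm (g z))\<^sup>2) / 2)"
    using assms by (simp add: square_integrable_def)
  show "AE z in M. norm (f z \<bullet> g z) \<le> norm (((norm (f z))\<^sup>2 + (norm (g z))\<^sup>2) / 2)"
    using abs_inner_le_squares[of "f _" "g _"] by (intro AE_I2) auto
qed (use assms in \<open>auto simp: square_integrable_def\<close>)

lemma square_integrable_add:
  assumes "square_integrable M f" "square_integrable M g"
  shows "square_integrable M (\<lambda>z. f z + g z)"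
  unfolding square_integrable_def
proof
  show "(\<lambda>z. f z + g z) \<in> borel_measurable M" using assms by (auto simp: square_integrable_def)
  then have m: "(\<lambda>z. (norm (f z + g z))\<^sup>2) \<in> borel_measurable M" by simp
  show "integrable M (\<lambda>z. (norm (f z + g z))\<^sup>2)"
  proof (rule Bochner_Integration.integrable_bound[OF _ m])
    show "integrable M (\<lambda>z. 2 * ((norm (f z))\<^sup>2 + (norm (g z))\<^sup>2))"
      using assms by (simp add: square_integrable_def)
    have "(norm (u + v))\<^sup>2 \<le> 2 * ((norm u)\<^sup>2 + (norm v)\<^sup>2)" for u v :: 'b
      using abs_inner_le_squares[of u v] by (simp add: power2_norm_eq_inner inner_simps inner_commute)
    then show "AE z in M. norm ((norm (f z + g z))\<^sup>2) \<le> norm (2 * ((norm (f z))\<^sup>2 + (norm (g z))\<^sup>2))"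
      by (intro AE_I2) auto
  qed
qed

lemma square_integrable_scaleR:
  "square_integrable M f \<Longrightarrow> square_integrable M (\<lambda>z. c *\<^sub>R f z)"
  by (auto simp: square_integrable_def power_mult_distrib)

text \<open>The gliding hump proof of the uniform boundedness principle; the sequence of humps is summable
  pointwise, so no completeness of \<open>L\<^sup>2\<close> is needed.\<close>

lemma square_integrable_uniformly_bounded:
  fixes fs :: "nat \<Rightarrow> 'a \<Rightarrow> 'b::euclidean_space"
  assumes fs: "\<And>j. square_integrable M (fs j)"
    and bdd: "\<And>g. square_integrable M g \<Longrightarrow> Bseq (\<lambda>j. LINT z|M. fs j z \<bullet> g z)"
  shows "\<exists>C. \<forall>j. (LINT z|M. (norm (fs j z))\<^sup>2) \<le> C"
proof (rule ccontr)
  assume contra: "\<not> ?thesis"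
  \<comment> \<open>Chosen against the lower bound (2/3) (1/4)^n for the pairings below: the product
    is 4/3 (n + 1), which is unbounded.\<close>
  define L where "L n = 2 * (real n + 1) * 4 ^ n" for n :: nat
  have L: "0 < L n" for n by (simp add: L_def)
  have "\<exists>j. (LINT z|M. (norm (fs j z))\<^sup>2) > (L n)\<^sup>2" for n
    using contra by (meson not_less)
  then obtain j where j: "\<And>n. (LINT z|M. (norm (fs (j n) z))\<^sup>2) > (L n)\<^sup>2" by metis
  define N where "N n = sqrt (LINT z|M. (norm (fs (j n) z))\<^sup>2)" for n
  have N: "L n < N n" for n
    unfolding N_def using j[of n] L[of n] by (intro real_less_rsqrt)
  have N0: "0 < N n" for n using N[of n] L[of n] by linarith
  define e where "e n z = (1 / N n) *\<^sub>R fs (j n) z" for n z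
  have e: "square_integrable M (e n)" for n
    unfolding e_def[abs_def] by (rule square_integrable_scaleR[OF fs])
  have e1: "(LINT z|M. (norm (e n z))\<^sup>2) = 1" for n
  proof -
    have "(LINT z|M. (norm (e n z))\<^sup>2) = (LINT z|M. (norm (fs (j n) z))\<^sup>2) / (N n)\<^sup>2"
      by (simp add: e_def power_divide)
    also have "(N n)\<^sup>2 = (LINT z|M. (norm (fs (j n) z))\<^sup>2)"
      by (simp add: N_def)
    finally show ?thesis using j[of n] L[of n] by (smt (verit) divide_self_if zero_le_power2)
  qed
  have em [measurable]: "e n \<in> borel_measurable M" for n
    using e by (simp add: square_integrable_def)
  have ee: "\<bar>LINT z|M. e n z \<bullet> e m z\<bar> \<le> 1" for n m
  proof -
    have "\<bar>LINT z|M. e n z \<bullet> e m z\<bar> \<le> (LINT z|M. \<bar>e n z \<bullet> e m z\<bar>)" by (rule integral_abs_bound)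
    also have "\<dots> \<le> (LINT z|M. ((norm (e n z))\<^sup>2 + (norm (e m z))\<^sup>2) / 2)"
      using e square_integrable_inner[OF e e]
      by (intro integral_mono abs_inner_le_squares) (auto simp: square_integrable_def)
    also have "\<dots> = 1" using e e1 by (simp add: square_integrable_def)
    finally show ?thesis .
  qed
  \<comment> \<open>With this sign the new hump reinforces the pairing of \<open>e n\<close> with
    the sum so far, so that its absolute value is at least (1/4)^n.\<close>
  define sg where "sg n y = (if (LINT z|M. e n z \<bullet> y z) \<ge> 0 then 1 else -1 :: real)" for n and y :: "'a \<Rightarrow> 'b"
  define x where "x = rec_nat (\<lambda>_. 0) (\<lambda>n y z. y z + (sg n y * (1/4) ^ n) *\<^sub>R e n z)"
  have x0: "x 0 = (\<lambda>_. 0)" and xS: "x (Suc n) = (\<lambda>z. x n z + (sg n (x n) * (1/4) ^ n) *\<^sub>R e n z)" for n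
    by (simp_all add: x_def)
  have sg: "\<bar>sg n y\<bar> = 1" for n y by (simp add: sg_def)
  have x: "square_integrable M (x n)" for n
  proof (induction n)
    case 0
    then show ?case by (simp add: x0 square_integrable_def)
  next
    case (Suc n)
    then show ?case unfolding xS by (intro square_integrable_add square_integrable_scaleR e)
  qed
  have xm [measurable]: "x n \<in> borel_measurable M" for n
    using x by (simp add: square_integrable_def)
  have inner_xS: "(LINT z|M. e m z \<bullet> x (Suc n) z)
      = (LINT z|M. e m z \<bullet> x n z) + sg n (x n) * (1/4) ^ n * (LINT z|M. e m z \<bullet> e n z)" for m n
    unfolding xS using square_integrable_inner[OF e x] square_integrable_inner[OF e e]
    by (simp add: inner_add_right)
  have start: "(1/4) ^ n \<le> \<bar>LINT z|M. e n z \<bullet> x (Suc n) z\<bar>" for n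
  proof -
    have "(LINT z|M. e n z \<bullet> e n z) = 1" using e1[of n] by (simp add: power2_norm_eq_inner)
    then have "(LINT z|M. e n z \<bullet> x (Suc n) z) = (LINT z|M. e n z \<bullet> x n z) + sg n (x n) * (1/4) ^ n"
      by (simp add: inner_xS)
    then show ?thesis by (auto simp: sg_def)
  qed
  \<comment> \<open>All later humps together change the pairing by at most the geometric tail
    (1/4)^n / 3, so two thirds of (1/4)^n survive.\<close>
  have later: "\<bar>(LINT z|M. e n z \<bullet> x (Suc n + d) z) - (LINT z|M. e n z \<bullet> x (Suc n) z)\<bar>
      \<le> (1/4) ^ n * (1 - (1/4) ^ d) / 3" for n d
  proof (induction d)
    case (Suc d)
    have "\<bar>sg (Suc n + d) (x (Suc n + d)) * (1/4) ^ (Suc n + d) * (LINT z|M. e n z \<bullet> e (Suc n + d) z)\<bar>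
        \<le> (1/4) ^ (Suc n + d) * 1"
      unfolding abs_mult sg using ee[of n "Suc n + d"] by (intro mult_mono) auto
    moreover have "(1/4) ^ (Suc n + d) * 1 = (1/4) ^ n * (1/4) ^ d * (1/4 :: real)"
      by (simp add: power_add)
    moreover have "(1/4) ^ n * (1 - (1/4) ^ Suc d) / 3
        = (1/4) ^ n * (1 - (1/4) ^ d) / 3 + (1/4) ^ n * (1/4) ^ d * (1/4 :: real)"
      by (simp add: field_simps)
    moreover have "(LINT z|M. e n z \<bullet> x (Suc n + Suc d) z) = (LINT z|M. e n z \<bullet> x (Suc n + d) z)
        + sg (Suc n + d) (x (Suc n + d)) * (1/4) ^ (Suc n + d) * (LINT z|M. e n z \<bullet> e (Suc n + d) z)"
      using inner_xS[of n "Suc n + d"] by simp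
    ultimately show ?case using Suc by linarith
  qed simp
  have low: "(2/3) * (1/4) ^ n \<le> \<bar>LINT z|M. e n z \<bullet> x k z\<bar>" if k: "Suc n \<le> k" for n k
  proof -
    have "(1/4) ^ n * (1 - (1/4) ^ (k - Suc n)) / 3 \<le> (1/4) ^ n * 1 / (3::real)"
      by (intro divide_right_mono mult_left_mono) auto
    moreover have "Suc n + (k - Suc n) = k" using k by simp
    ultimately show ?thesis using later[of n "k - Suc n"] start[of n] by (simp only: mult_1_right)
  qed
  \<comment> \<open>An integrable function, with integral 4/3. Splitting (1/4)^m into two factors
    (1/2)^m, Cauchy-Schwarz bounds the squared norms of all partial sums by 4/3 \<open>G\<close>
    pointwise.\<close>
  define G where "G z = (\<Sum>m. (1/4) ^ m * (norm (e m z))\<^sup>2)" for z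
  have geo: "summable (\<lambda>m. (1/4::real) ^ m)" "(\<Sum>m. (1/4::real) ^ m) = 4/3"
    by (auto simp: summable_geometric suminf_geometric)
  have nn: "(\<integral>\<^sup>+z. (\<Sum>m. ennreal ((1/4) ^ m * (norm (e m z))\<^sup>2)) \<partial>M) = ennreal (4/3)"
  proof -
    have "(\<integral>\<^sup>+z. (\<Sum>m. ennreal ((1/4) ^ m * (norm (e m z))\<^sup>2)) \<partial>M)
        = (\<Sum>m. \<integral>\<^sup>+z. ennreal ((1/4) ^ m * (norm (e m z))\<^sup>2) \<partial>M)"
      by (rule nn_integral_suminf) measurable
    also have "\<dots> = (\<Sum>m. ennreal ((1/4) ^ m))"
    proof (rule arg_cong[where f = suminf], rule ext)
      fix m
      have "(\<integral>\<^sup>+z. ennreal ((1/4) ^ m * (norm (e m z))\<^sup>2) \<partial>M) = ennreal (LINT z|M. (1/4) ^ m * (norm (e m z))\<^sup>2)"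
        using e[of m] by (intro nn_integral_eq_integral) (auto simp: square_integrable_def)
      then show "(\<integral>\<^sup>+z. ennreal ((1/4) ^ m * (norm (e m z))\<^sup>2) \<partial>M) = ennreal ((1/4) ^ m)"
        by (simp add: e1)
    qed
    also have "\<dots> = ennreal (4/3)"
    proof -
      have "(\<Sum>m. ennreal ((1/4) ^ m)) = ennreal (\<Sum>m. (1/4) ^ m)"
        by (rule suminf_ennreal2[OF _ geo(1)]) simp
      then show ?thesis by (simp only: geo(2))
    qed
    finally show ?thesis .
  qed
  have "AE z in M. (\<Sum>m. ennreal ((1/4) ^ m * (norm (e m z))\<^sup>2)) \<noteq> \<infinity>"
    by (rule nn_integral_PInf_AE) (auto simp: nn)
  then have sumG: "AE z in M. summable (\<lambda>m. (1/4) ^ m * (norm (e m z))\<^sup>2)"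
    by eventually_elim (auto intro: summable_suminf_not_top)
  have Gm [measurable]: "G \<in> borel_measurable M"
    unfolding G_def[abs_def] by measurable
  have Gi: "integrable M G"
  proof (rule integrableI_nonneg)
    have "AE z in M. ennreal (G z) = (\<Sum>m. ennreal ((1/4) ^ m * (norm (e m z))\<^sup>2))"
      using sumG by eventually_elim (simp add: G_def suminf_ennreal2)
    then have "(\<integral>\<^sup>+z. ennreal (G z) \<partial>M) = ennreal (4/3)"
      using nn by (simp cong: nn_integral_cong_AE)
    then show "(\<integral>\<^sup>+z. ennreal (G z) \<partial>M) < \<infinity>" by simp
    show "AE z in M. 0 \<le> G z"
      using sumG by eventually_elim (simp add: G_def suminf_nonneg)
  qed simp
  have quarter: "((1/2::real) ^ m)\<^sup>2 = (1/4) ^ m" for m :: nat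
    by (simp add: power2_eq_square flip: power_mult_distrib)
  have xG: "(norm (x k z))\<^sup>2 \<le> 4/3 * G z" if s: "summable (\<lambda>m. (1/4) ^ m * (norm (e m z))\<^sup>2)" for k z
  proof -
    have "norm (x k z) \<le> (\<Sum>m<k. (1/2) ^ m * ((1/2) ^ m * norm (e m z)))"
    proof (induction k)
      case (Suc k)
      have "norm ((sg k (x k) * (1/4) ^ k) *\<^sub>R e k z) = (1/2) ^ k * ((1/2) ^ k * norm (e k z))"
        unfolding norm_scaleR real_norm_def abs_mult sg
        by (simp add: quarter power2_eq_square[symmetric] flip: mult.assoc)
      then show ?case
        using Suc norm_triangle_ineq[of "x k z" "(sg k (x k) * (1/4) ^ k) *\<^sub>R e k z"] unfolding xS
        by (simp only: sum.lessThan_Suc)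
    qed (simp add: x0)
    then have "(norm (x k z))\<^sup>2 \<le> (\<Sum>m<k. (1/2) ^ m * ((1/2) ^ m * norm (e m z)))\<^sup>2"
      by (intro power_mono) auto
    also have "\<dots> \<le> (\<Sum>m<k. ((1/2) ^ m)\<^sup>2) * (\<Sum>m<k. ((1/2) ^ m * norm (e m z))\<^sup>2)"
      by (rule Cauchy_Schwarz_ineq_sum)
    also have "\<dots> = (\<Sum>m<k. (1/4) ^ m) * (\<Sum>m<k. (1/4) ^ m * (norm (e m z))\<^sup>2)"
      by (simp only: power_mult_distrib quarter)
    also have "\<dots> \<le> 4/3 * G z"
      using sum_le_suminf[OF geo(1), of "{..<k}"] sum_le_suminf[OF s, of "{..<k}"] geo(2)
      unfolding G_def by (intro mult_mono) (auto intro: sum_nonneg)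
    finally show ?thesis .
  qed
  define X where "X z = lim (\<lambda>k. x k z)" for z
  have Xlim: "AE z in M. (\<lambda>k. x k z) \<longlonglongrightarrow> X z"
    using sumG
  proof eventually_elim
    fix z assume s: "summable (\<lambda>m. (1/4) ^ m * (norm (e m z))\<^sup>2)"
    have x_sum: "x k z = (\<Sum>m<k. (sg m (x m) * (1/4) ^ m) *\<^sub>R e m z)" for k
      by (induction k) (simp_all add: x0 xS)
    have "summable (\<lambda>m. (sg m (x m) * (1/4) ^ m) *\<^sub>R e m z)"
    proof (rule summable_comparison_test'[OF summable_add[OF geo(1) s], of 0])
      fix m
      have "norm (e m z) \<le> 1 + (norm (e m z))\<^sup>2"
        using sum_squares_bound[of "norm (e m z)" 1] norm_ge_zero[of "e m z"]
        unfolding mult_1_right one_power2 by linarith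
      then have "(1/4) ^ m * norm (e m z) \<le> (1/4) ^ m * (1 + (norm (e m z))\<^sup>2)"
        by (intro mult_left_mono) auto
      then show "norm ((sg m (x m) * (1/4) ^ m) *\<^sub>R e m z) \<le> (1/4) ^ m + (1/4) ^ m * (norm (e m z))\<^sup>2"
        by (simp add: abs_mult sg distrib_left)
    qed
    then have "convergent (\<lambda>k. x k z)"
      unfolding x_sum by (simp add: summable_iff_convergent)
    then show "(\<lambda>k. x k z) \<longlonglongrightarrow> X z"
      unfolding X_def by (simp add: convergent_LIMSEQ_iff)
  qed
  have Xm [measurable]: "X \<in> borel_measurable M"
    unfolding X_def[abs_def] by measurable
  have XG: "AE z in M. (norm (X z))\<^sup>2 \<le> 4/3 * G z"
    using Xlim sumG
  proof eventually_elim
    fix z assume "(\<lambda>k. x k z) \<longlonglongrightarrow> X z" "summable (\<lambda>m. (1/4) ^ m * (norm (e m z))\<^sup>2)"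
    then show "(norm (X z))\<^sup>2 \<le> 4/3 * G z"
      using xG by (intro LIMSEQ_le_const2[OF tendsto_power[OF tendsto_norm]]) auto
  qed
  have X: "square_integrable M X"
    unfolding square_integrable_def
  proof
    have "integrable M (\<lambda>z. 4/3 * G z)" using Gi by simp
    then show "integrable M (\<lambda>z. (norm (X z))\<^sup>2)"
      by (rule Bochner_Integration.integrable_bound) (use XG in \<open>auto elim!: eventually_mono\<close>)
  qed simp
  have eX: "(\<lambda>k. LINT z|M. e n z \<bullet> x k z) \<longlonglongrightarrow> (LINT z|M. e n z \<bullet> X z)" for n
  proof (rule integral_dominated_convergence[where w = "\<lambda>z. ((norm (e n z))\<^sup>2 + 4/3 * G z) / 2"])
    show "integrable M (\<lambda>z. ((norm (e n z))\<^sup>2 + 4/3 * G z) / 2)"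
      using e[of n] Gi by (simp add: square_integrable_def)
    show "AE z in M. (\<lambda>k. e n z \<bullet> x k z) \<longlonglongrightarrow> e n z \<bullet> X z"
      using Xlim by eventually_elim (intro tendsto_inner tendsto_const)
    show "AE z in M. norm (e n z \<bullet> x k z) \<le> ((norm (e n z))\<^sup>2 + 4/3 * G z) / 2" for k
      using sumG
    proof eventually_elim
      fix z assume "summable (\<lambda>m. (1/4) ^ m * (norm (e m z))\<^sup>2)"
      from xG[OF this, of k] abs_inner_le_squares[of "e n z" "x k z"]
      show "norm (e n z \<bullet> x k z) \<le> ((norm (e n z))\<^sup>2 + 4/3 * G z) / 2" by simp
    qed
  qed measurable
  have lowX: "(2/3) * (1/4) ^ n \<le> \<bar>LINT z|M. e n z \<bullet> X z\<bar>" for n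
    by (rule LIMSEQ_le_const[OF tendsto_rabs[OF eX]]) (use low in blast)
  obtain K where K: "\<And>j. \<bar>LINT z|M. fs j z \<bullet> X z\<bar> \<le> K"
    using bdd[OF X] by (auto simp: Bseq_def)
  obtain n :: nat where n: "K < real n" using reals_Archimedean2 by blast
  have "(LINT z|M. fs (j n) z \<bullet> X z) = N n * (LINT z|M. e n z \<bullet> X z)"
    using N0[of n] by (simp add: e_def)
  then have "\<bar>LINT z|M. fs (j n) z \<bullet> X z\<bar> = N n * \<bar>LINT z|M. e n z \<bullet> X z\<bar>"
    using N0[of n] by (simp add: abs_mult)
  moreover have "N n * ((2/3) * (1/4) ^ n) \<le> N n * \<bar>LINT z|M. e n z \<bullet> X z\<bar>"
    using lowX[of n] N0[of n] by (intro mult_left_mono) auto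
  ultimately have "N n * ((2/3) * (1/4) ^ n) \<le> K"
    using K[of "j n"] by linarith
  moreover have "L n * ((2/3) * (1/4) ^ n) \<le> N n * ((2/3) * (1/4) ^ n)"
    using N[of n] by (intro mult_right_mono) auto
  moreover have "L n * ((2/3) * (1/4) ^ n) = 4/3 * (real n + 1)"
    by (simp add: L_def power_divide)
  ultimately have "4/3 * (real n + 1) \<le> K" by (metis order_trans)
  then show False using n by simp
qed

subsection \<open>Functions on space-time\<close>

abbreviation st_measure :: "real \<Rightarrow> ((real^3) \<times> real) measure"
  where "st_measure T \<equiv> lebesgue_on (space_time T)"

lemma space_time_borel: "space_time T \<in> sets borel"
  by (intro borel_Times) auto

lemma finite_measure_st: "finite_measure (st_measure T)"
proof (rule finite_measure_lebesgue_on, rule bounded_set_imp_lmeasurable)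
  show "bounded (space_time T)" by (intro bounded_Times) auto
  show "space_time T \<in> sets lebesgue" using space_time_borel by simp
qed

lemma st_Fubini:
  fixes f :: "(real^3) \<times> real \<Rightarrow> real"
  assumes "integrable (st_measure T) f"
  shows "AE t in time_measure T. integrable (lebesgue_on torus) (\<lambda>x. f (x, t))"
    and "integrable (time_measure T) (\<lambda>t. LINT x|lebesgue_on torus. f (x, t))"
    and "(LINT t|time_measure T. LINT x|lebesgue_on torus. f (x, t)) = (LINT z|st_measure T. f z)"
  using lebesgue_on_Fubini[OF _ _ assms] by auto

text \<open>Composition with \<open>snd\<close> is immediate for Borel functions only. So \<theta>
  is replaced by a Borel function off a null set \<open>N\<close>, and
  \<open>UNIV \<times> N\<close> is null in space-time.\<close>

lemma st_measurable_snd: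
  fixes \<theta> :: "real \<Rightarrow> real"
  assumes \<theta>: "\<theta> \<in> borel_measurable (time_measure T)"
  shows "(\<lambda>z. \<theta> (snd z)) \<in> borel_measurable (st_measure T)"
proof -
  define h where "h t = (if t \<in> {0<..<T} then \<theta> t else 0)" for t
  have "h \<in> borel_measurable lebesgue"
    unfolding h_def[abs_def] by (rule borel_measurable_if_I[OF \<theta>]) simp
  then obtain g where g: "g \<in> borel_measurable lborel" and hg: "AE t in lborel. h t = g t"
    using completion_ex_borel_measurable_real[of h lborel] by auto
  obtain N where N: "N \<in> null_sets lborel" "{t. h t \<noteq> g t} \<subseteq> N"
    using hg by (auto simp: eventually_ae_filter)
  have "UNIV \<times> N \<in> null_sets ((lborel :: (real^3) measure) \<Otimes>\<^sub>M lborel)"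
    by (rule sigma_finite_measure.times_in_null_sets2[OF sigma_finite_lborel]) (use N(1) in auto)
  then have "UNIV \<times> N \<in> null_sets (lborel :: ((real^3) \<times> real) measure)"
    by (simp add: lborel_prod)
  then have "AE z in (lborel :: ((real^3) \<times> real) measure). z \<notin> UNIV \<times> N"
    by (rule AE_not_in)
  then have ae: "AE z in (lebesgue :: ((real^3) \<times> real) measure). g (snd z) = h (snd z)"
    unfolding AE_completion_iff by eventually_elim (use N(2) in auto)
  have "(\<lambda>z::(real^3) \<times> real. g (snd z)) \<in> borel_measurable lborel"
    using measurable_compose[of snd lborel borel g borel] g
    by (simp add: borel_measurable_continuous_onI continuous_on_snd)
  then have gm: "(\<lambda>z::(real^3) \<times> real. g (snd z)) \<in> borel_measurable lebesgue"
    by (rule measurable_completion)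
  have "(\<lambda>z::(real^3) \<times> real. h (snd z)) \<in> borel_measurable lebesgue"
    by (rule borel_measurable_AE[OF gm ae])
  then have "(\<lambda>z::(real^3) \<times> real. h (snd z)) \<in> borel_measurable (st_measure T)"
    by (rule measurable_restrict_space1)
  then show ?thesis
    by (rule measurable_cong[THEN iffD1, rotated]) (auto simp: h_def)
qed

lemma st_measurable_cosk: "(\<lambda>z. cosk k (fst z)) \<in> borel_measurable (st_measure T)"
  and st_measurable_sink: "(\<lambda>z. sink k (fst z)) \<in> borel_measurable (st_measure T)"
proof -
  have "continuous_on UNIV (\<lambda>z::(real^3) \<times> real. cosk k (fst z))" "continuous_on UNIV (\<lambda>z::(real^3) \<times> real. sink k (fst z))"
    unfolding cosk_def sink_def by (intro continuous_intros)+
  then have c: "(\<lambda>z::(real^3) \<times> real. cosk k (fst z)) \<in> borel_measurable lborel"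
    and s: "(\<lambda>z::(real^3) \<times> real. sink k (fst z)) \<in> borel_measurable lborel"
    by (simp_all add: borel_measurable_continuous_onI)
  show "(\<lambda>z. cosk k (fst z)) \<in> borel_measurable (st_measure T)"
    by (rule measurable_restrict_space1[OF measurable_completion[OF c]])
  show "(\<lambda>z. sink k (fst z)) \<in> borel_measurable (st_measure T)"
    by (rule measurable_restrict_space1[OF measurable_completion[OF s]])
qed

lemma st_fcos:
  assumes f: "integrable (st_measure T) f"
  shows "integrable (time_measure T) (\<lambda>t. fcos k (\<lambda>x. f (x, t)))"
    and "integrable (time_measure T) (\<lambda>t. fsin k (\<lambda>x. f (x, t)))"
proof -
  have "integrable (st_measure T) (\<lambda>z. f z * cosk k (fst z))" "integrable (st_measure T) (\<lambda>z. f z * sink k (fst z))"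
    using integrable_mult_bounded[OF f st_measurable_cosk abs_cosk_le] integrable_mult_bounded[OF f st_measurable_sink abs_sink_le] .
  from st_Fubini(2)[OF this(1)] st_Fubini(2)[OF this(2)]
  show "integrable (time_measure T) (\<lambda>t. fcos k (\<lambda>x. f (x, t)))"
    "integrable (time_measure T) (\<lambda>t. fsin k (\<lambda>x. f (x, t)))"
    by (simp_all add: fcos_def fsin_def)
qed

text \<open>Fubini turns a weighted time integral of a mode into the pairing of \<open>f\<close>
  with a separated function, the form in which the weak formulation and weak convergence are
  given.\<close>

lemma st_fcos_mult:
  assumes f: "integrable (st_measure T) f" and \<theta>: "\<theta> \<in> borel_measurable (time_measure T)" "\<And>t. \<bar>\<theta> t\<bar> \<le> B"
  shows "(LINT t|time_measure T. \<theta> t * fcos k (\<lambda>x. f (x, t))) = (LINT z|st_measure T. f z * (\<theta> (snd z) * cosk k (fst z)))"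
    and "(LINT t|time_measure T. \<theta> t * fsin k (\<lambda>x. f (x, t))) = (LINT z|st_measure T. f z * (\<theta> (snd z) * sink k (fst z)))"
    and "integrable (st_measure T) (\<lambda>z. f z * (\<theta> (snd z) * cosk k (fst z)))"
    and "integrable (st_measure T) (\<lambda>z. f z * (\<theta> (snd z) * sink k (fst z)))"
proof -
  have B0: "0 \<le> B" using \<theta>(2)[of 0] by linarith
  have b: "\<bar>\<theta> (snd z) * cosk k (fst z)\<bar> \<le> B * 1" "\<bar>\<theta> (snd z) * sink k (fst z)\<bar> \<le> B * 1" for z
    unfolding abs_mult using B0 by (intro mult_mono \<theta>(2) abs_cosk_le abs_sink_le; simp)+
  show i: "integrable (st_measure T) (\<lambda>z. f z * (\<theta> (snd z) * cosk k (fst z)))"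
    "integrable (st_measure T) (\<lambda>z. f z * (\<theta> (snd z) * sink k (fst z)))"
    using integrable_mult_bounded[OF f borel_measurable_times[OF st_measurable_snd[OF \<theta>(1)] st_measurable_cosk] b(1)]
      integrable_mult_bounded[OF f borel_measurable_times[OF st_measurable_snd[OF \<theta>(1)] st_measurable_sink] b(2)] .
  have "(LINT x|lebesgue_on torus. f (x, t) * (\<theta> t * cosk k x)) = \<theta> t * fcos k (\<lambda>x. f (x, t))"
    "(LINT x|lebesgue_on torus. f (x, t) * (\<theta> t * sink k x)) = \<theta> t * fsin k (\<lambda>x. f (x, t))" for t
    unfolding fcos_def fsin_def by (subst integral_mult_right_zero[symmetric], simp add: mult_ac)+
  with st_Fubini(3)[OF i(1)] st_Fubini(3)[OF i(2)]
  show "(LINT t|time_measure T. \<theta> t * fcos k (\<lambda>x. f (x, t))) = (LINT z|st_measure T. f z * (\<theta> (snd z) * cosk k (fst z)))"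
    "(LINT t|time_measure T. \<theta> t * fsin k (\<lambda>x. f (x, t))) = (LINT z|st_measure T. f z * (\<theta> (snd z) * sink k (fst z)))"
    by simp_all
qed

lemma smooth_real_compact_bounded:
  assumes "time_test T \<eta>"
  obtains B where "\<And>t. \<bar>\<eta> t\<bar> \<le> B"
proof -
  obtain s r where sr: "smooth_real \<eta>" "\<And>t. \<eta> t \<noteq> 0 \<Longrightarrow> s \<le> t \<and> t \<le> r"
    using assms unfolding time_test_def by blast
  have "compact (\<eta> ` {s..r})"
    by (intro compact_continuous_image smooth_real_imp_continuous sr) simp
  then obtain B where B: "\<And>t. t \<in> {s..r} \<Longrightarrow> \<bar>\<eta> t\<bar> \<le> B"
    using compact_imp_bounded bounded_iff by (metis imageI real_norm_def)
  have "\<bar>\<eta> t\<bar> \<le> max B 0" for t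
  proof (cases "\<eta> t = 0")
    case False
    then show ?thesis using sr(2)[OF False] B[of t] by simp
  qed simp
  then show ?thesis by (rule that)
qed

lemma time_test_deriv:
  assumes "time_test T \<eta>" "\<And>t. (\<eta> has_real_derivative \<eta>' t) (at t)"
  shows "time_test T \<eta>'"
proof -
  obtain s r where sr: "smooth_real \<eta>" "0 < s" "r < T" "\<And>t. \<eta> t \<noteq> 0 \<Longrightarrow> s \<le> t \<and> t \<le> r"
    using assms(1) unfolding time_test_def by blast
  obtain g where g: "smooth_real g" "\<And>t. (\<eta> has_real_derivative g t) (at t)"
    using smooth_real_deriv[OF sr(1)] by blast
  have "\<eta>' = g" using DERIV_unique[OF assms(2) g(2)] by auto
  have "s \<le> t \<and> t \<le> r" if "\<eta>' t \<noteq> 0" for t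
  proof (rule ccontr)
    assume nt: "\<not> (s \<le> t \<and> t \<le> r)"
    then have "t \<in> - {s..r}" by auto
    have "((\<lambda>_. 0) has_real_derivative 0) (at t)" by simp
    then have "(\<eta> has_real_derivative 0) (at t)"
      by (rule has_field_derivative_transform_within_open[of _ _ _ "- {s..r}"]) (use sr(4) nt in fastforce)+
    then have "\<eta>' t = 0" using DERIV_unique[OF assms(2)] by blast
    then show False using that by simp
  qed
  then show ?thesis unfolding time_test_def using g(1) \<open>\<eta>' = g\<close> sr(2,3) by blast
qed

lemma Lp3_component:
  fixes v :: "'a::euclidean_space \<Rightarrow> real^'n"
  assumes "Lp 3 A v"
  shows "(\<lambda>z. v z $ i) \<in> borel_measurable (lebesgue_on A)"
    and "integrable (lebesgue_on A) (\<lambda>z. \<bar>v z $ i\<bar> ^ 3)"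
proof -
  have vm: "v \<in> borel_measurable (lebesgue_on A)" using assms by (simp add: Lp_def)
  have "(\<lambda>x::real^'n. x $ i) \<in> borel_measurable borel"
    by (intro borel_measurable_continuous_onI continuous_intros)
  from measurable_compose[OF vm this]
  show m: "(\<lambda>z. v z $ i) \<in> borel_measurable (lebesgue_on A)" .
  have 3: "integrable (lebesgue_on A) (\<lambda>z. norm (v z) ^ 3)"
    using assms by (simp add: Lp_def powr_numeral)
  show "integrable (lebesgue_on A) (\<lambda>z. \<bar>v z $ i\<bar> ^ 3)"
    by (rule Bochner_Integration.integrable_bound[OF 3]) (use m in \<open>auto intro!: power_mono component_le_norm_cart\<close>)
qed

lemma Lp3_integrable:
  fixes v :: "'a::euclidean_space \<Rightarrow> 'b::euclidean_space"
  assumes "Lp 3 A v" "finite_measure (lebesgue_on A)"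
  shows "integrable (lebesgue_on A) v"
proof (rule integrable_of_powr[OF assms(2)])
  show "integrable (lebesgue_on A) (\<lambda>x. norm (v x) powr 3)" using assms(1) unfolding Lp_def by blast
qed (use assms in \<open>auto simp: Lp_def\<close>)

lemma cube_integrable:
  fixes f :: "'a \<Rightarrow> real"
  assumes M: "finite_measure M" and f: "f \<in> borel_measurable M" and f3: "integrable M (\<lambda>x. \<bar>f x\<bar> ^ 3)"
  shows "integrable M f" and "integrable M (\<lambda>x. (f x)\<^sup>2)"
    and "integrable M (\<lambda>x. \<bar>f x\<bar> powr (3/2))"
proof -
  have i: "integrable M (\<lambda>x. 1 + \<bar>f x\<bar> ^ 3)"
    using f3 finite_measure.integrable_const[OF M, of "1::real"] by simp
  have le: "y \<le> 1 + y ^ 3" "y\<^sup>2 \<le> 1 + y ^ 3" "y powr (3/2) \<le> 1 + y ^ 3" if "0 \<le> y" for y :: real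
  proof -
    have "y \<le> 1 + y ^ 3 \<and> y\<^sup>2 \<le> 1 + y ^ 3 \<and> y powr (3/2) \<le> 1 + y ^ 3"
    proof (cases "y \<le> 1")
      case True
      have "y ^ 2 \<le> 1" using that True by (simp add: power_le_one)
      moreover have "y powr (3/2) \<le> 1" using that True by (simp add: powr_le1)
      moreover have "0 \<le> y ^ 3" using that by simp
      ultimately show ?thesis using True by linarith
    next
      case False
      have "y ^ 1 \<le> y ^ 3" "y ^ 2 \<le> y ^ 3" using False by (intro power_increasing; simp)+
      moreover have "y powr (3/2) \<le> y powr 3" using False by (intro powr_mono) auto
      ultimately show ?thesis using that by (simp add: powr_numeral)
    qed
    then show "y \<le> 1 + y ^ 3" "y\<^sup>2 \<le> 1 + y ^ 3" "y powr (3/2) \<le> 1 + y ^ 3" by auto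
  qed
  show "integrable M f"
    by (rule Bochner_Integration.integrable_bound[OF i f]) (use le in \<open>auto simp: abs_of_nonneg\<close>)
  show "integrable M (\<lambda>x. (f x)\<^sup>2)"
    by (rule Bochner_Integration.integrable_bound[OF i]) (use f le(2)[of "\<bar>f _\<bar>"] in \<open>auto simp: abs_of_nonneg\<close>)
  show "integrable M (\<lambda>x. \<bar>f x\<bar> powr (3/2))"
    by (rule Bochner_Integration.integrable_bound[OF i]) (use f le in \<open>auto simp: abs_of_nonneg\<close>)
qed

lemma square_integrable_mult:
  fixes f g :: "'a \<Rightarrow> real"
  assumes "f \<in> borel_measurable M" "integrable M (\<lambda>x. (f x)\<^sup>2)" "g \<in> borel_measurable M" "integrable M (\<lambda>x. (g x)\<^sup>2)"
  shows "integrable M (\<lambda>x. f x * g x)"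
  using square_integrable_inner[of M f g] assms by (simp add: square_integrable_def)

subsection \<open>Helicity in Fourier variables\<close>

definition cos_vec :: "(3 \<Rightarrow> int) \<Rightarrow> (real^3 \<Rightarrow> real^3) \<Rightarrow> real^3"
  where "cos_vec k w = (\<chi> i. fcos k (\<lambda>x. w x $ i))"

definition sin_vec :: "(3 \<Rightarrow> int) \<Rightarrow> (real^3 \<Rightarrow> real^3) \<Rightarrow> real^3"
  where "sin_vec k w = (\<chi> i. fsin k (\<lambda>x. w x $ i))"

text \<open>In complex notation \<open>\<hat>b(k) = a - i s\<close> for \<open>a = cos_vec k b\<close> and \<open>s = sin_vec k b\<close>, the potential of
  a divergence-free \<open>b\<close> is \<open>i k \<times> \<hat>b(k) / (2 \<pi> \<bar>k\<bar>\<^sup>2)\<close>, and the real part of its product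
  with the conjugate of \<open>\<hat>b(k)\<close> is the following expression.  It vanishes for \<open>k = 0\<close> since \<open>x / 0 = 0\<close>.\<close>

definition helicity_mode :: "(3 \<Rightarrow> int) \<Rightarrow> real^3 \<Rightarrow> real^3 \<Rightarrow> real"
  where "helicity_mode k a s = freq k \<bullet> cross3 s a / (pi * (freq k \<bullet> freq k))"

definition approx_helicity :: "nat \<Rightarrow> (real^3 \<Rightarrow> real^3) \<Rightarrow> real"
  where "approx_helicity N w = (\<Sum>k\<in>freq_box N. freq_weight N k * helicity_mode k (cos_vec k w) (sin_vec k w))"

lemma norm_cross3_le: "norm (cross3 x y) \<le> norm x * norm y"
proof -
  have "(norm (cross3 x y))\<^sup>2 \<le> (norm x * norm y)\<^sup>2"
    using norm_cross_dot[of x y] zero_le_power2[of "x \<bullet> y"] by linarith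
  then show ?thesis by (rule power2_le_imp_le) simp
qed

text \<open>The gain of one order that makes helicity weakly continuous. At k = 0 both sides vanish
  because x / 0 = 0; the factor \<open>pi\<close> in the denominator is estimated by 1.\<close>

lemma abs_helicity_mode_le: "\<bar>helicity_mode k a s\<bar> \<le> ((norm a)\<^sup>2 + (norm s)\<^sup>2) / norm (freq k)"
proof (cases "freq k = 0")
  case False
  then have k: "0 < norm (freq k)" by simp
  have "\<bar>freq k \<bullet> cross3 s a\<bar> \<le> norm (freq k) * norm (cross3 s a)"
    by (rule Cauchy_Schwarz_ineq2)
  also have "\<dots> \<le> norm (freq k) * (norm s * norm a)"
    by (intro mult_left_mono norm_cross3_le) simp
  also have "\<dots> \<le> norm (freq k) * ((norm a)\<^sup>2 + (norm s)\<^sup>2)"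
  proof (intro mult_left_mono)
    have "2 * (norm s * norm a) \<le> (norm s)\<^sup>2 + (norm a)\<^sup>2"
      using sum_squares_bound[of "norm s" "norm a"] by (simp add: mult.assoc)
    moreover have "0 \<le> norm s * norm a" by simp
    ultimately show "norm s * norm a \<le> (norm a)\<^sup>2 + (norm s)\<^sup>2" by linarith
  qed simp
  finally have 1: "\<bar>freq k \<bullet> cross3 s a\<bar> \<le> norm (freq k) * ((norm a)\<^sup>2 + (norm s)\<^sup>2)" .
  have "\<bar>helicity_mode k a s\<bar> = \<bar>freq k \<bullet> cross3 s a\<bar> / (pi * (norm (freq k))\<^sup>2)"
    by (simp add: helicity_mode_def power2_norm_eq_inner abs_mult)
  also have "\<dots> \<le> \<bar>freq k \<bullet> cross3 s a\<bar> / (1 * (norm (freq k))\<^sup>2)"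
    using k pi_gt3 by (intro divide_left_mono mult_right_mono) auto
  also have "\<dots> \<le> norm (freq k) * ((norm a)\<^sup>2 + (norm s)\<^sup>2) / (1 * (norm (freq k))\<^sup>2)"
    using 1 by (intro divide_right_mono) auto
  also have "\<dots> = ((norm a)\<^sup>2 + (norm s)\<^sup>2) / norm (freq k)"
    using k by (simp add: power2_eq_square)
  finally show ?thesis .
qed (simp add: helicity_mode_def)

lemma norm_freq_ge_1: "k \<noteq> (\<lambda>_. 0) \<Longrightarrow> 1 \<le> norm (freq k)"
proof -
  assume "k \<noteq> (\<lambda>_. 0)"
  then obtain i where "k i \<noteq> 0" by auto
  then have "1 \<le> \<bar>real_of_int (k i)\<bar>" by linarith
  also have "\<dots> \<le> norm (freq k)" using component_le_norm_cart[of "freq k" i] by simp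
  finally show ?thesis .
qed

text \<open>The weights converge for each frequency, but not uniformly; division by |k| repairs
  this. The finitely many low frequencies are covered by pointwise convergence, the high ones by 1 /
  |k|, since the weights lie in [0, 1].\<close>

lemma freq_weight_uniform:
  assumes e: "0 < e"
  shows "\<exists>N0. \<forall>N\<ge>N0. \<forall>M\<ge>N0. \<forall>k. \<bar>freq_weight N k - freq_weight M k\<bar> / norm (freq k) \<le> e"
proof -
  \<comment> \<open>Outside \<open>freq_box R\<close> some component of k exceeds 1 / e in absolute
    value, hence so does |k|.\<close>
  define R where "R = nat \<lceil>1 / e\<rceil>"
  have "\<forall>k\<in>freq_box R. \<forall>\<^sub>F N in sequentially. \<bar>freq_weight N k - 1\<bar> < e / 2"
  proof
    fix k
    have "\<forall>\<^sub>F N in sequentially. dist (freq_weight N k) 1 < e / 2"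
      using tendstoD[OF freq_weight_tendsto_1[of k], of "e / 2"] e by simp
    then show "\<forall>\<^sub>F N in sequentially. \<bar>freq_weight N k - 1\<bar> < e / 2" by (simp add: dist_real_def)
  qed
  then have "\<forall>\<^sub>F N in sequentially. \<forall>k\<in>freq_box R. \<bar>freq_weight N k - 1\<bar> < e / 2"
    by (simp add: eventually_ball_finite)
  then obtain N0 where N0: "\<And>N k. N \<ge> N0 \<Longrightarrow> k \<in> freq_box R \<Longrightarrow> \<bar>freq_weight N k - 1\<bar> < e / 2"
    unfolding eventually_sequentially by blast
  show ?thesis
  proof (intro exI allI impI)
    fix N M k assume NM: "N0 \<le> N" "N0 \<le> M"
    show "\<bar>freq_weight N k - freq_weight M k\<bar> / norm (freq k) \<le> e"
    proof (cases "k = (\<lambda>_. 0)")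
      case True
      then show ?thesis using e freq_eq_0_iff[of k] by simp
    next
      case False
      then have k1: "1 \<le> norm (freq k)" by (rule norm_freq_ge_1)
      show ?thesis
      proof (cases "k \<in> freq_box R")
        case True
        have "\<bar>freq_weight N k - freq_weight M k\<bar> < e"
          using N0[OF NM(1) True] N0[OF NM(2) True] by linarith
        moreover have "\<bar>freq_weight N k - freq_weight M k\<bar> / norm (freq k) \<le> \<bar>freq_weight N k - freq_weight M k\<bar> / 1"
          using k1 by (intro divide_left_mono) auto
        ultimately show ?thesis by simp
      next
        case False
        then obtain i where i: "int R < \<bar>k i\<bar>" by (auto simp: mem_freq_box not_le)
        have "1 / e \<le> real R" unfolding R_def by linarith
        also have "\<dots> \<le> \<bar>real_of_int (k i)\<bar>" using i by linarith
        also have "\<dots> \<le> norm (freq k)" using component_le_norm_cart[of "freq k" i] by simp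
        finally have ke: "1 / e \<le> norm (freq k)" .
        have "\<bar>freq_weight N k - freq_weight M k\<bar> \<le> 1"
          using freq_weight_nonneg[of N k] freq_weight_le_1[of N k] freq_weight_nonneg[of M k] freq_weight_le_1[of M k]
          by linarith
        then have "\<bar>freq_weight N k - freq_weight M k\<bar> / norm (freq k) \<le> 1 / (1 / e)"
          using ke e by (intro frac_le) auto
        then show ?thesis by simp
      qed
    qed
  qed
qed

lemma freq_box_mono: "N \<le> M \<Longrightarrow> freq_box N \<subseteq> freq_box M"
  by (fastforce simp: mem_freq_box intro: order_trans)

lemma approx_helicity_eq_larger:
  assumes "N \<le> M"
  shows "approx_helicity N w = (\<Sum>k\<in>freq_box M. freq_weight N k * helicity_mode k (cos_vec k w) (sin_vec k w))"
  unfolding approx_helicity_def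
  by (rule sum.mono_neutral_left) (use freq_box_mono[OF assms] in \<open>auto simp: freq_weight_eq_0\<close>)

lemma norm_square_vec3: "(norm (w :: real^3))\<^sup>2 = (\<Sum>i\<in>UNIV. (w $ i)\<^sup>2)"
  unfolding power2_norm_eq_inner by (simp add: inner_vec_def power2_eq_square)

text \<open>\<open>e\<close> absorbs the factor 1 / |k| together with the difference of the weights;
  Bessel's inequality bounds the remaining sum of squares independently of \<open>N\<close> and
  \<open>M\<close>.\<close>

lemma abs_approx_helicity_diff_le:
  assumes w: "\<And>i. integrable (lebesgue_on torus) (\<lambda>x. w x $ i)" "\<And>i. integrable (lebesgue_on torus) (\<lambda>x. (w x $ i)\<^sup>2)"
    and NM: "N \<le> M" and e: "\<And>k. \<bar>freq_weight N k - freq_weight M k\<bar> / norm (freq k) \<le> e"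
  shows "\<bar>approx_helicity N w - approx_helicity M w\<bar> \<le> e * (\<Sum>i\<in>UNIV. LINT x|lebesgue_on torus. (w x $ i)\<^sup>2)"
proof -
  have e0: "0 \<le> e" using e[of "\<lambda>_. 0"] freq_eq_0_iff[of "\<lambda>_. 0"] by simp
  let ?h = "\<lambda>k. helicity_mode k (cos_vec k w) (sin_vec k w)"
  have "\<bar>approx_helicity N w - approx_helicity M w\<bar> = \<bar>\<Sum>k\<in>freq_box M. (freq_weight N k - freq_weight M k) * ?h k\<bar>"
    unfolding approx_helicity_eq_larger[OF NM] approx_helicity_def[of M]
    by (simp add: sum_subtractf left_diff_distrib)
  also have "\<dots> \<le> (\<Sum>k\<in>freq_box M. \<bar>(freq_weight N k - freq_weight M k) * ?h k\<bar>)"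
    by (rule sum_abs)
  also have "\<dots> \<le> (\<Sum>k\<in>freq_box M. e * ((norm (cos_vec k w))\<^sup>2 + (norm (sin_vec k w))\<^sup>2))"
  proof (rule sum_mono)
    fix k
    have "\<bar>(freq_weight N k - freq_weight M k) * ?h k\<bar>
        \<le> \<bar>freq_weight N k - freq_weight M k\<bar> * (((norm (cos_vec k w))\<^sup>2 + (norm (sin_vec k w))\<^sup>2) / norm (freq k))"
      unfolding abs_mult by (intro mult_left_mono abs_helicity_mode_le) simp
    also have "\<dots> = \<bar>freq_weight N k - freq_weight M k\<bar> / norm (freq k) * ((norm (cos_vec k w))\<^sup>2 + (norm (sin_vec k w))\<^sup>2)"
      by simp
    also have "\<dots> \<le> e * ((norm (cos_vec k w))\<^sup>2 + (norm (sin_vec k w))\<^sup>2)"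
      by (intro mult_right_mono e) simp
    finally show "\<bar>(freq_weight N k - freq_weight M k) * ?h k\<bar> \<le> e * ((norm (cos_vec k w))\<^sup>2 + (norm (sin_vec k w))\<^sup>2)" .
  qed
  also have "\<dots> = e * (\<Sum>k\<in>freq_box M. \<Sum>i\<in>UNIV. (fcos k (\<lambda>x. w x $ i))\<^sup>2 + (fsin k (\<lambda>x. w x $ i))\<^sup>2)"
    by (simp add: norm_square_vec3 cos_vec_def sin_vec_def sum.distrib flip: sum_distrib_left)
  also have "\<dots> = e * (\<Sum>i\<in>UNIV. \<Sum>k\<in>freq_box M. (fcos k (\<lambda>x. w x $ i))\<^sup>2 + (fsin k (\<lambda>x. w x $ i))\<^sup>2)"
    by (subst sum.swap) simp
  also have "\<dots> \<le> e * (\<Sum>i\<in>UNIV. LINT x|lebesgue_on torus. (w x $ i)\<^sup>2)"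
    by (intro mult_left_mono sum_mono bessel_inequality w e0)
  finally show ?thesis .
qed

text \<open>Up to the factor 2 pi, \<open>cross3 k ec\<close> and \<open>- cross3 k es\<close> are
  the time derivatives of the sine and cosine coefficients of b, where \<open>ec\<close> and
  \<open>es\<close> are the coefficients of b x u. Orthogonality to \<open>k\<close> leaves a
  multiple of |k|^2 only, which cancels the denominator of \<open>helicity_mode\<close>.\<close>

lemma helicity_mode_derivative:
  fixes k a s ec es :: "real^3"
  assumes "k \<bullet> a = 0" "k \<bullet> s = 0"
  shows "k \<bullet> cross3 (cross3 k ec) a - k \<bullet> cross3 s (cross3 k es) = - (k \<bullet> k) * (a \<bullet> ec + s \<bullet> es)"
proof -
  have "cross3 (cross3 k ec) a = (k \<bullet> a) *\<^sub>R ec - (ec \<bullet> a) *\<^sub>R k"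
    by (simp add: vec_eq_iff forall_3 cross3_def inner_vec_def sum_3 algebra_simps)
  moreover have "cross3 s (cross3 k es) = (s \<bullet> es) *\<^sub>R k - (k \<bullet> s) *\<^sub>R es"
    by (simp add: vec_eq_iff forall_3 cross3_def inner_vec_def sum_3 algebra_simps)
  ultimately have "k \<bullet> cross3 (cross3 k ec) a = - (ec \<bullet> a) * (k \<bullet> k)" "k \<bullet> cross3 s (cross3 k es) = (s \<bullet> es) * (k \<bullet> k)"
    using assms by (simp_all add: inner_diff_right)
  then show ?thesis
    by (simp add: inner_commute algebra_simps)
qed

lemma sum_smooth_pairing:
  "(\<Sum>i\<in>UNIV. smooth_pairing N (\<lambda>x. v x $ i) (\<lambda>x. w x $ i))
    = (\<Sum>k\<in>freq_box N. freq_weight N k * (cos_vec k v \<bullet> cos_vec k w + sin_vec k v \<bullet> sin_vec k w))"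
proof -
  have "(\<Sum>i\<in>UNIV. smooth_pairing N (\<lambda>x. v x $ i) (\<lambda>x. w x $ i))
      = (\<Sum>k\<in>freq_box N. \<Sum>i\<in>UNIV. freq_weight N k * (fcos k (\<lambda>x. v x $ i) * fcos k (\<lambda>x. w x $ i) + fsin k (\<lambda>x. v x $ i) * fsin k (\<lambda>x. w x $ i)))"
    unfolding smooth_pairing_def by (rule sum.swap)
  then show ?thesis
    by (simp add: cos_vec_def sin_vec_def inner_vec_def sum.distrib sum_distrib_left[symmetric])
qed

text \<open>The potential enters through its own Fourier coefficients: \<open>a = 2 \<pi> k \<times> S\<close> and
  \<open>s = - 2 \<pi> k \<times> A\<close> is the curl equation.\<close>

lemma helicity_mode_potential:
  assumes "freq k \<bullet> A = 0" "freq k \<bullet> S = 0" "k \<noteq> (\<lambda>_. 0)"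
    and "a = (2 * pi) *\<^sub>R cross3 (freq k) S" "s = - (2 * pi) *\<^sub>R cross3 (freq k) A"
  shows "helicity_mode k a s = a \<bullet> A + s \<bullet> S"
proof -
  have "freq k \<bullet> freq k \<noteq> 0" using assms(3) freq_eq_0_iff[of k] by simp
  moreover have "freq k \<bullet> cross3 s a = pi * (freq k \<bullet> freq k) * (a \<bullet> A + s \<bullet> S)"
  proof -
    \<comment> \<open>Two vectors orthogonal to k have a cross product parallel to k.\<close>
    have "cross3 (cross3 (freq k) A) (cross3 (freq k) S) = (freq k \<bullet> cross3 A S) *\<^sub>R freq k"
      by (simp add: vec_eq_iff forall_3 cross3_def inner_vec_def sum_3 algebra_simps)
    then have "freq k \<bullet> cross3 s a = - (4 * pi\<^sup>2) * (freq k \<bullet> freq k) * (freq k \<bullet> cross3 A S)"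
      unfolding assms(4,5) by (simp add: cross_mult_left cross_mult_right cross_minus_left power2_eq_square)
    moreover have "a \<bullet> A + s \<bullet> S = - (4 * pi) * (freq k \<bullet> cross3 A S)"
      unfolding assms(4,5) by (simp add: cross3_def inner_vec_def sum_3 algebra_simps)
    ultimately show ?thesis by (simp add: power2_eq_square)
  qed
  ultimately show ?thesis by (simp add: helicity_mode_def)
qed

subsection \<open>The induction equation\<close>

abbreviation slice :: "((real^3) \<times> real \<Rightarrow> 'b) \<Rightarrow> real \<Rightarrow> real^3 \<Rightarrow> 'b"
  where "slice v t \<equiv> \<lambda>x. v (x, t)"

lemma st_slice_cube:
  fixes f :: "(real^3) \<times> real \<Rightarrow> real"
  assumes f: "f \<in> borel_measurable (st_measure T)" and f3: "integrable (st_measure T) (\<lambda>z. \<bar>f z\<bar> ^ 3)"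
  shows "AE t in time_measure T. slice f t \<in> borel_measurable (lebesgue_on torus) \<and>
    integrable (lebesgue_on torus) (\<lambda>x. \<bar>f (x, t)\<bar> ^ 3)"
  using st_Fubini(1)[OF cube_integrable(1)[OF finite_measure_st f f3]] st_Fubini(1)[OF f3]
  by eventually_elim auto

lemma Lp3_slice:
  assumes "Lp 3 (space_time T) (v :: (real^3) \<times> real \<Rightarrow> real^3)"
  shows "AE t in time_measure T. \<forall>i. slice (\<lambda>z. v z $ i) t \<in> borel_measurable (lebesgue_on torus) \<and>
    integrable (lebesgue_on torus) (\<lambda>x. \<bar>v (x, t) $ i\<bar> ^ 3)"
proof -
  have "AE t in time_measure T. slice (\<lambda>z. v z $ i) t \<in> borel_measurable (lebesgue_on torus) \<and>
    integrable (lebesgue_on torus) (\<lambda>x. \<bar>v (x, t) $ i\<bar> ^ 3)" for i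
    by (rule st_slice_cube[OF Lp3_component[OF assms]])
  then show ?thesis by (simp add: eventually_all_finite)
qed

lemma Lp3_component_integrable:
  fixes v :: "(real^3) \<times> real \<Rightarrow> real^3"
  assumes "Lp 3 (space_time T) v"
  shows "integrable (st_measure T) (\<lambda>z. v z $ i)" and "integrable (st_measure T) (\<lambda>z. (v z $ i)\<^sup>2)"
    and "integrable (st_measure T) (\<lambda>z. \<bar>v z $ i\<bar> powr (3/2))"
  by (rule cube_integrable[OF finite_measure_st Lp3_component[OF assms]])+

lemma Lp3_mult_integrable:
  fixes v w :: "(real^3) \<times> real \<Rightarrow> real^3"
  assumes "Lp 3 (space_time T) v" "Lp 3 (space_time T) w"
  shows "integrable (st_measure T) (\<lambda>z. v z $ i * w z $ j)"
  by (rule square_integrable_mult[OF Lp3_component(1)[OF assms(1)] Lp3_component_integrable(2)[OF assms(1)]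
        Lp3_component(1)[OF assms(2)] Lp3_component_integrable(2)[OF assms(2)]])

text \<open>Testing with \<eta>(t) times a trigonometric mode and applying Fubini gives the weak
  form of an ordinary differential equation for one coefficient; the spatial derivative falls on the
  mode and produces 2 pi k. The lemma of du Bois-Reymond turns it into an identity between functions
  of time.\<close>

lemma induction_equation_weak_deriv:
  assumes T: "0 < T" and b: "Lp 3 (space_time T) b" and u: "Lp 3 (space_time T) u" and mhd: "ideal_MHD T b u q"
  defines "P \<equiv> \<lambda>i m z. b z $ i * u z $ m - u z $ i * b z $ m"
  shows "has_weak_deriv T (\<lambda>t. fcos k (slice (\<lambda>z. b z $ i) t))
      (\<lambda>t. - (2 * pi) * (\<Sum>m\<in>UNIV. of_int (k m) * fsin k (slice (P i m) t)))"
    and "has_weak_deriv T (\<lambda>t. fsin k (slice (\<lambda>z. b z $ i) t))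
      (\<lambda>t. 2 * pi * (\<Sum>m\<in>UNIV. of_int (k m) * fcos k (slice (P i m) t)))"
proof -
  have Pi: "integrable (st_measure T) (P i m)" for m
    unfolding P_def by (intro Bochner_Integration.integrable_diff Lp3_mult_integrable b u)
  note bi = Lp3_component_integrable(1)[OF b, of i]
  have ind: "- (LINT z|st_measure T. b z $ i * dir_deriv (0, 1) \<phi> z)
      - (\<Sum>m\<in>UNIV. LINT z|st_measure T. P i m z * dir_deriv (axis m 1, 0) \<phi> z) = 0"
    if "space_time_test T \<phi>" for \<phi>
  proof -
    have "dist_dt T (\<lambda>z. b z $ i) \<phi> + dist_div_matrix T (\<lambda>z. outer (b z) (u z) - outer (u z) (b z)) i \<phi> = 0"
      using mhd that unfolding ideal_MHD_def by blast
    then show ?thesis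
      by (simp add: dist_deriv_def dist_div_matrix_def outer_def P_def sum_negf)
  qed
  have G1: "integrable (time_measure T) (\<lambda>t. - (2 * pi) * (\<Sum>m\<in>UNIV. of_int (k m) * fsin k (slice (P i m) t)))"
    and G2: "integrable (time_measure T) (\<lambda>t. 2 * pi * (\<Sum>m\<in>UNIV. of_int (k m) * fcos k (slice (P i m) t)))"
    by (intro integrable_mult_right impI Bochner_Integration.integrable_sum st_fcos Pi)+
  have w: "(LINT t|time_measure T. \<eta>' t * fcos k (slice (\<lambda>z. b z $ i) t))
        = - (LINT t|time_measure T. \<eta> t * (- (2 * pi) * (\<Sum>m\<in>UNIV. of_int (k m) * fsin k (slice (P i m) t))))"
      "(LINT t|time_measure T. \<eta>' t * fsin k (slice (\<lambda>z. b z $ i) t))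
        = - (LINT t|time_measure T. \<eta> t * (2 * pi * (\<Sum>m\<in>UNIV. of_int (k m) * fcos k (slice (P i m) t))))"
    if \<eta>: "time_test T \<eta>" and d: "\<And>t. (\<eta> has_real_derivative \<eta>' t) (at t)" for \<eta> \<eta>'
  proof -
    have \<eta>': "time_test T \<eta>'" by (rule time_test_deriv[OF \<eta> d])
    obtain B where B: "\<And>t. \<bar>\<eta> t\<bar> \<le> B" using smooth_real_compact_bounded[OF \<eta>] by blast
    obtain B' where B': "\<And>t. \<bar>\<eta>' t\<bar> \<le> B'" using smooth_real_compact_bounded[OF \<eta>'] by blast
    have m: "\<eta> \<in> borel_measurable (time_measure T)" "\<eta>' \<in> borel_measurable (time_measure T)"
      using \<eta> \<eta>' by (auto simp: time_test_def intro: smooth_real_measurable)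
    note eb = st_fcos_mult(1,2)[OF bi m(2) B', where k = k]
    note eP = st_fcos_mult(1,2)[OF Pi m(1) B, where k = k]
    have iP: "integrable (time_measure T) (\<lambda>t. \<eta> t * fcos k (slice (P i m) t))"
      "integrable (time_measure T) (\<lambda>t. \<eta> t * fsin k (slice (P i m) t))" for m
      by (intro time_test_integrable_mult[OF \<eta>] st_fcos Pi)+
    have "- (LINT z|st_measure T. b z $ i * sep_test k \<eta>' 1 0 z)
        - (\<Sum>m\<in>UNIV. LINT z|st_measure T. P i m z * sep_test k \<eta> (2 * pi * of_int (k m) * 0) (- (2 * pi * of_int (k m) * 1)) z) = 0"
      using ind[OF space_time_test_sep_test[OF \<eta>, of k 1 0]] unfolding dir_deriv_sep_test[OF d] .
    moreover have "(LINT z|st_measure T. b z $ i * sep_test k \<eta>' 1 0 z) = (LINT t|time_measure T. \<eta>' t * fcos k (slice (\<lambda>z. b z $ i) t))"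
      unfolding eb by (simp add: sep_test_def)
    moreover have "(LINT z|st_measure T. P i m z * sep_test k \<eta> (2 * pi * of_int (k m) * 0) (- (2 * pi * of_int (k m) * 1)) z)
        = - (2 * pi * of_int (k m)) * (LINT t|time_measure T. \<eta> t * fsin k (slice (P i m) t))" for m
      unfolding eP by (subst integral_mult_right_zero[symmetric]) (simp add: sep_test_def mult_ac)
    ultimately have 1: "(LINT t|time_measure T. \<eta>' t * fcos k (slice (\<lambda>z. b z $ i) t))
        = (\<Sum>m\<in>UNIV. (2 * pi * of_int (k m)) * (LINT t|time_measure T. \<eta> t * fsin k (slice (P i m) t)))"
      by (simp add: sum_negf)
    have "(LINT t|time_measure T. \<eta> t * (- (2 * pi) * (\<Sum>m\<in>UNIV. of_int (k m) * fsin k (slice (P i m) t))))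
        = (LINT t|time_measure T. (\<Sum>m\<in>UNIV. - (2 * pi * of_int (k m)) * (\<eta> t * fsin k (slice (P i m) t))))"
      by (simp add: sum_distrib_left sum_negf mult_ac)
    also have "\<dots> = (\<Sum>m\<in>UNIV. - (2 * pi * of_int (k m)) * (LINT t|time_measure T. \<eta> t * fsin k (slice (P i m) t)))"
      using iP(2) by (subst Bochner_Integration.integral_sum) auto
    finally show "(LINT t|time_measure T. \<eta>' t * fcos k (slice (\<lambda>z. b z $ i) t))
        = - (LINT t|time_measure T. \<eta> t * (- (2 * pi) * (\<Sum>m\<in>UNIV. of_int (k m) * fsin k (slice (P i m) t))))"
      using 1 by (simp add: sum_negf)
    have "- (LINT z|st_measure T. b z $ i * sep_test k \<eta>' 0 1 z)
        - (\<Sum>m\<in>UNIV. LINT z|st_measure T. P i m z * sep_test k \<eta> (2 * pi * of_int (k m) * 1) (- (2 * pi * of_int (k m) * 0)) z) = 0"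
      using ind[OF space_time_test_sep_test[OF \<eta>, of k 0 1]] unfolding dir_deriv_sep_test[OF d] .
    moreover have "(LINT z|st_measure T. b z $ i * sep_test k \<eta>' 0 1 z) = (LINT t|time_measure T. \<eta>' t * fsin k (slice (\<lambda>z. b z $ i) t))"
      unfolding eb by (simp add: sep_test_def)
    moreover have "(LINT z|st_measure T. P i m z * sep_test k \<eta> (2 * pi * of_int (k m) * 1) (- (2 * pi * of_int (k m) * 0)) z)
        = 2 * pi * of_int (k m) * (LINT t|time_measure T. \<eta> t * fcos k (slice (P i m) t))" for m
      unfolding eP by (subst integral_mult_right_zero[symmetric]) (simp add: sep_test_def mult_ac)
    ultimately have 2: "(LINT t|time_measure T. \<eta>' t * fsin k (slice (\<lambda>z. b z $ i) t))
        = - (\<Sum>m\<in>UNIV. (2 * pi * of_int (k m)) * (LINT t|time_measure T. \<eta> t * fcos k (slice (P i m) t)))"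
      by (simp add: sum_negf)
    have "(LINT t|time_measure T. \<eta> t * (2 * pi * (\<Sum>m\<in>UNIV. of_int (k m) * fcos k (slice (P i m) t))))
        = (LINT t|time_measure T. (\<Sum>m\<in>UNIV. (2 * pi * of_int (k m)) * (\<eta> t * fcos k (slice (P i m) t))))"
      by (simp add: sum_distrib_left mult_ac)
    also have "\<dots> = (\<Sum>m\<in>UNIV. (2 * pi * of_int (k m)) * (LINT t|time_measure T. \<eta> t * fcos k (slice (P i m) t)))"
      using iP(1) by (subst Bochner_Integration.integral_sum) auto
    finally show "(LINT t|time_measure T. \<eta>' t * fsin k (slice (\<lambda>z. b z $ i) t))
        = - (LINT t|time_measure T. \<eta> t * (2 * pi * (\<Sum>m\<in>UNIV. of_int (k m) * fcos k (slice (P i m) t))))"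
      using 2 by simp
  qed
  show "has_weak_deriv T (\<lambda>t. fcos k (slice (\<lambda>z. b z $ i) t))
      (\<lambda>t. - (2 * pi) * (\<Sum>m\<in>UNIV. of_int (k m) * fsin k (slice (P i m) t)))"
    unfolding has_weak_deriv_def using st_fcos(1)[OF bi] G1 du_Bois_Reymond[OF T st_fcos(1)[OF bi] G1 w(1)] by blast
  show "has_weak_deriv T (\<lambda>t. fsin k (slice (\<lambda>z. b z $ i) t))
      (\<lambda>t. 2 * pi * (\<Sum>m\<in>UNIV. of_int (k m) * fcos k (slice (P i m) t)))"
    unfolding has_weak_deriv_def using st_fcos(2)[OF bi] G2 du_Bois_Reymond[OF T st_fcos(2)[OF bi] G2 w(2)] by blast
qed

lemma divergence_free_modes:
  assumes b: "Lp 3 (space_time T) b" and mhd: "ideal_MHD T b u q"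
  shows "AE t in time_measure T. freq k \<bullet> cos_vec k (slice b t) = 0"
    and "AE t in time_measure T. freq k \<bullet> sin_vec k (slice b t) = 0"
proof -
  note bi = Lp3_component_integrable(1)[OF b]
  have div: "(\<Sum>m\<in>UNIV. LINT z|st_measure T. b z $ m * dir_deriv (axis m 1, 0) \<phi> z) = 0"
    if "space_time_test T \<phi>" for \<phi>
    using mhd that unfolding ideal_MHD_def dist_div_def dist_deriv_def by (simp add: sum_negf)
  have w: "(LINT t|time_measure T. \<eta> t * (\<Sum>m\<in>UNIV. 2 * pi * of_int (k m) * fcos k (slice (\<lambda>z. b z $ m) t))) = 0"
    "(LINT t|time_measure T. \<eta> t * (\<Sum>m\<in>UNIV. 2 * pi * of_int (k m) * fsin k (slice (\<lambda>z. b z $ m) t))) = 0"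
    if \<eta>: "time_test T \<eta>" for \<eta>
  proof -
    obtain \<eta>' where d: "\<And>t. (\<eta> has_real_derivative \<eta>' t) (at t)"
      using \<eta> smooth_real_deriv unfolding time_test_def by metis
    obtain B where B: "\<And>t. \<bar>\<eta> t\<bar> \<le> B" using smooth_real_compact_bounded[OF \<eta>] by blast
    have m: "\<eta> \<in> borel_measurable (time_measure T)"
      using \<eta> by (auto simp: time_test_def intro: smooth_real_measurable)
    note eb = st_fcos_mult(1,2)[OF bi m B, where k = k]
    have ib: "integrable (time_measure T) (\<lambda>t. \<eta> t * fcos k (slice (\<lambda>z. b z $ m) t))"
      "integrable (time_measure T) (\<lambda>t. \<eta> t * fsin k (slice (\<lambda>z. b z $ m) t))" for m
      by (intro time_test_integrable_mult[OF \<eta>] st_fcos bi)+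
    have "(LINT t|time_measure T. \<eta> t * (\<Sum>m\<in>UNIV. 2 * pi * of_int (k m) * fcos k (slice (\<lambda>z. b z $ m) t)))
        = (LINT t|time_measure T. (\<Sum>m\<in>UNIV. (2 * pi * of_int (k m)) * (\<eta> t * fcos k (slice (\<lambda>z. b z $ m) t))))"
      by (simp add: sum_distrib_left mult_ac)
    also have "\<dots> = (\<Sum>m\<in>UNIV. (2 * pi * of_int (k m)) * (LINT t|time_measure T. \<eta> t * fcos k (slice (\<lambda>z. b z $ m) t)))"
      using ib(1) by (subst Bochner_Integration.integral_sum) auto
    \<comment> \<open>Differentiation exchanges the modes: the sine test function yields the cosine
      coefficients. For the sine coefficients below it is the cosine, taken with the factor
      -1.\<close>
    also have "\<dots> = (\<Sum>m\<in>UNIV. LINT z|st_measure T. b z $ m * dir_deriv (axis m 1, 0) (sep_test k \<eta> 0 1) z)"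
      unfolding eb dir_deriv_sep_test[OF d]
      by (intro sum.cong refl, subst integral_mult_right_zero[symmetric]) (simp add: sep_test_def mult_ac)
    also have "\<dots> = 0" by (rule div[OF space_time_test_sep_test[OF \<eta>]])
    finally show "(LINT t|time_measure T. \<eta> t * (\<Sum>m\<in>UNIV. 2 * pi * of_int (k m) * fcos k (slice (\<lambda>z. b z $ m) t))) = 0" .
    have "(LINT t|time_measure T. \<eta> t * (\<Sum>m\<in>UNIV. 2 * pi * of_int (k m) * fsin k (slice (\<lambda>z. b z $ m) t)))
        = (LINT t|time_measure T. (\<Sum>m\<in>UNIV. (2 * pi * of_int (k m)) * (\<eta> t * fsin k (slice (\<lambda>z. b z $ m) t))))"
      by (simp add: sum_distrib_left mult_ac)
    also have "\<dots> = (\<Sum>m\<in>UNIV. (2 * pi * of_int (k m)) * (LINT t|time_measure T. \<eta> t * fsin k (slice (\<lambda>z. b z $ m) t)))"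
      using ib(2) by (subst Bochner_Integration.integral_sum) auto
    also have "\<dots> = (\<Sum>m\<in>UNIV. LINT z|st_measure T. b z $ m * dir_deriv (axis m 1, 0) (sep_test k \<eta> (-1) 0) z)"
      unfolding eb dir_deriv_sep_test[OF d]
      by (intro sum.cong refl, subst integral_mult_right_zero[symmetric]) (simp add: sep_test_def mult_ac)
    also have "\<dots> = 0" by (rule div[OF space_time_test_sep_test[OF \<eta>]])
    finally show "(LINT t|time_measure T. \<eta> t * (\<Sum>m\<in>UNIV. 2 * pi * of_int (k m) * fsin k (slice (\<lambda>z. b z $ m) t))) = 0" .
  qed
  have "AE t in time_measure T. (\<Sum>m\<in>UNIV. 2 * pi * of_int (k m) * fcos k (slice (\<lambda>z. b z $ m) t)) = 0"
    by (rule AE_zero_if_test_integrals_zero[OF _ w(1)])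
      (intro Bochner_Integration.integrable_sum integrable_mult_right impI st_fcos bi)
  then show "AE t in time_measure T. freq k \<bullet> cos_vec k (slice b t) = 0"
    by eventually_elim (simp add: cos_vec_def inner_vec_def mult.assoc flip: sum_distrib_left)
  have "AE t in time_measure T. (\<Sum>m\<in>UNIV. 2 * pi * of_int (k m) * fsin k (slice (\<lambda>z. b z $ m) t)) = 0"
    by (rule AE_zero_if_test_integrals_zero[OF _ w(2)])
      (intro Bochner_Integration.integrable_sum integrable_mult_right impI st_fcos bi)
  then show "AE t in time_measure T. freq k \<bullet> sin_vec k (slice b t) = 0"
    by eventually_elim (simp add: sin_vec_def inner_vec_def mult.assoc flip: sum_distrib_left)
qed

lemma fcos_minus: "fcos k (\<lambda>x. - f x) = - fcos k f" and fsin_minus: "fsin k (\<lambda>x. - f x) = - fsin k f"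
  by (simp_all add: fcos_def fsin_def)

text \<open>The Fourier side of k x (v x w) = (k . w) v - (k . v) w. It brings the induction
  equation into the form in which the time derivative of b is minus the curl of b x u.\<close>

lemma cos_vec_cross:
  "(\<chi> i. \<Sum>m\<in>UNIV. of_int (k m) * fcos k (\<lambda>x. v x $ i * w x $ m - w x $ i * v x $ m))
    = cross3 (freq k) (cos_vec k (\<lambda>x. cross3 (v x) (w x)))"
  and sin_vec_cross:
  "(\<chi> i. \<Sum>m\<in>UNIV. of_int (k m) * fsin k (\<lambda>x. v x $ i * w x $ m - w x $ i * v x $ m))
    = cross3 (freq k) (sin_vec k (\<lambda>x. cross3 (v x) (w x)))"
proof -
  have anti: "fcos k (\<lambda>x. v x $ i * w x $ m - v x $ m * w x $ i) = - fcos k (\<lambda>x. v x $ m * w x $ i - v x $ i * w x $ m)"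
    "fsin k (\<lambda>x. v x $ i * w x $ m - v x $ m * w x $ i) = - fsin k (\<lambda>x. v x $ m * w x $ i - v x $ i * w x $ m)" for i m
    unfolding fcos_minus[symmetric] fsin_minus[symmetric] by simp_all
  have same: "fcos k (\<lambda>x. v x $ i * w x $ m - w x $ i * v x $ m) = fcos k (\<lambda>x. v x $ i * w x $ m - v x $ m * w x $ i)"
    "fsin k (\<lambda>x. v x $ i * w x $ m - w x $ i * v x $ m) = fsin k (\<lambda>x. v x $ i * w x $ m - v x $ m * w x $ i)" for i m
    by (simp_all add: mult.commute)
  have z: "fcos k (\<lambda>x. 0) = 0" "fsin k (\<lambda>x. 0) = 0" by (simp_all add: fcos_def fsin_def)
  show "(\<chi> i. \<Sum>m\<in>UNIV. of_int (k m) * fcos k (\<lambda>x. v x $ i * w x $ m - w x $ i * v x $ m))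
    = cross3 (freq k) (cos_vec k (\<lambda>x. cross3 (v x) (w x)))"
    by (simp add: vec_eq_iff forall_3 sum_3 cross3_def cos_vec_def same(1)
        anti(1)[of 2 1] anti(1)[of 3 2] anti(1)[of 3 1] z)
  show "(\<chi> i. \<Sum>m\<in>UNIV. of_int (k m) * fsin k (\<lambda>x. v x $ i * w x $ m - w x $ i * v x $ m))
    = cross3 (freq k) (sin_vec k (\<lambda>x. cross3 (v x) (w x)))"
    by (simp add: vec_eq_iff forall_3 sum_3 cross3_def sin_vec_def same(2)
        anti(2)[of 2 1] anti(2)[of 3 2] anti(2)[of 3 1] z)
qed

subsection \<open>Conservation for \<open>L\<^sup>3\<close> solutions\<close>

lemma powr_mult_le_cubes:
  fixes x y :: real
  assumes "0 \<le> x" "0 \<le> y"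
  shows "(x * y) powr (3/2) \<le> x ^ 3 + y ^ 3"
proof -
  define m where "m = max x y"
  have m: "0 \<le> m" "x \<le> m" "y \<le> m" using assms by (auto simp: m_def)
  have "x * y \<le> m * m" using m assms by (intro mult_mono) auto
  then have "(x * y) powr (3/2) \<le> (m * m) powr (3/2)"
    using assms by (intro powr_mono2) auto
  also have "\<dots> = m ^ 3"
  proof (cases "m = 0")
    case False
    then have "(m * m) powr (3/2) = (m powr 2) powr (3/2)"
      using m by (simp add: powr_numeral power2_eq_square)
    also have "\<dots> = m powr 3" by (simp only: powr_powr) simp
    finally show ?thesis using m by (simp add: powr_numeral)
  qed simp
  also have "\<dots> \<le> x ^ 3 + y ^ 3" using assms by (auto simp: m_def max_def)
  finally show ?thesis .
qed

text \<open>A product of two L^3 fields lies in L^(3/2), the exponent dual to that of b.\<close>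

lemma electric_field_integrable:
  fixes b u :: "(real^3) \<times> real \<Rightarrow> real^3"
  assumes b: "Lp 3 (space_time T) b" and u: "Lp 3 (space_time T) u"
  shows "integrable (st_measure T) (\<lambda>z. cross3 (b z) (u z) $ i)"
    and "integrable (st_measure T) (\<lambda>z. \<bar>cross3 (b z) (u z) $ i\<bar> powr (3/2))"
proof -
  note m = Lp3_mult_integrable[OF b u] Lp3_mult_integrable[OF u b]
  have "integrable (st_measure T) (\<lambda>z. cross3 (b z) (u z) $ 1)" "integrable (st_measure T) (\<lambda>z. cross3 (b z) (u z) $ 2)"
    "integrable (st_measure T) (\<lambda>z. cross3 (b z) (u z) $ 3)"
    unfolding cross_components by (intro Bochner_Integration.integrable_diff m)+
  then show E: "integrable (st_measure T) (\<lambda>z. cross3 (b z) (u z) $ i)"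
    using exhaust_3[of i] by auto
  have n3: "integrable (st_measure T) (\<lambda>z. norm (b z) ^ 3 + norm (u z) ^ 3)"
    using b u by (simp add: Lp_def powr_numeral)
  show "integrable (st_measure T) (\<lambda>z. \<bar>cross3 (b z) (u z) $ i\<bar> powr (3/2))"
  proof (rule Bochner_Integration.integrable_bound[OF n3])
    show "(\<lambda>z. \<bar>cross3 (b z) (u z) $ i\<bar> powr (3/2)) \<in> borel_measurable (st_measure T)"
      using borel_measurable_integrable[OF E] by measurable
    show "AE z in st_measure T. norm (\<bar>cross3 (b z) (u z) $ i\<bar> powr (3/2)) \<le> norm (norm (b z) ^ 3 + norm (u z) ^ 3)"
    proof (rule AE_I2)
      fix z
      have "\<bar>cross3 (b z) (u z) $ i\<bar> \<le> norm (b z) * norm (u z)"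
        using component_le_norm_cart[of "cross3 (b z) (u z)" i] norm_cross3_le[of "b z" "u z"] by linarith
      then have "\<bar>cross3 (b z) (u z) $ i\<bar> powr (3/2) \<le> (norm (b z) * norm (u z)) powr (3/2)"
        by (intro powr_mono2) auto
      also have "\<dots> \<le> norm (b z) ^ 3 + norm (u z) ^ 3"
        by (intro powr_mult_le_cubes) auto
      finally show "norm (\<bar>cross3 (b z) (u z) $ i\<bar> powr (3/2)) \<le> norm (norm (b z) ^ 3 + norm (u z) ^ 3)" by simp
    qed
  qed
qed

text \<open>As a linear combination of products of two real coefficients, a mode is accessible to
  the calculus of \<open>has_weak_deriv\<close> and of \<open>L1_converges\<close>.\<close>

lemma helicity_mode_expand:
  "helicity_mode k a s = 1 / (pi * (freq k \<bullet> freq k)) * (of_int (k 1) * (s $ 2 * a $ 3 - s $ 3 * a $ 2)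
    + of_int (k 2) * (s $ 3 * a $ 1 - s $ 1 * a $ 3) + of_int (k 3) * (s $ 1 * a $ 2 - s $ 2 * a $ 1))"
  by (simp add: helicity_mode_def inner_vec_def sum_3 cross3_def)

lemma has_weak_deriv_helicity_mode:
  assumes a: "\<And>i. has_weak_deriv T (\<lambda>t. a t $ i) (\<lambda>t. a' t $ i)" and s: "\<And>i. has_weak_deriv T (\<lambda>t. s t $ i) (\<lambda>t. s' t $ i)"
  shows "has_weak_deriv T (\<lambda>t. helicity_mode k (a t) (s t))
    (\<lambda>t. (freq k \<bullet> cross3 (s' t) (a t) + freq k \<bullet> cross3 (s t) (a' t)) / (pi * (freq k \<bullet> freq k)))"
proof -
  have "has_weak_deriv T (\<lambda>t. helicity_mode k (a t) (s t))
    (\<lambda>t. 1 / (pi * (freq k \<bullet> freq k)) * (of_int (k 1) * ((s' t $ 2 * a t $ 3 + s t $ 2 * a' t $ 3) - (s' t $ 3 * a t $ 2 + s t $ 3 * a' t $ 2))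
      + of_int (k 2) * ((s' t $ 3 * a t $ 1 + s t $ 3 * a' t $ 1) - (s' t $ 1 * a t $ 3 + s t $ 1 * a' t $ 3))
      + of_int (k 3) * ((s' t $ 1 * a t $ 2 + s t $ 1 * a' t $ 2) - (s' t $ 2 * a t $ 1 + s t $ 2 * a' t $ 1))))"
    unfolding helicity_mode_expand
    by (intro has_weak_deriv_cmult has_weak_deriv_add has_weak_deriv_diff has_weak_deriv_mult a s)
  moreover have "(\<lambda>t. 1 / (pi * (freq k \<bullet> freq k)) * (of_int (k 1) * ((s' t $ 2 * a t $ 3 + s t $ 2 * a' t $ 3) - (s' t $ 3 * a t $ 2 + s t $ 3 * a' t $ 2))
      + of_int (k 2) * ((s' t $ 3 * a t $ 1 + s t $ 3 * a' t $ 1) - (s' t $ 1 * a t $ 3 + s t $ 1 * a' t $ 3))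
      + of_int (k 3) * ((s' t $ 1 * a t $ 2 + s t $ 1 * a' t $ 2) - (s' t $ 2 * a t $ 1 + s t $ 2 * a' t $ 1))))
    = (\<lambda>t. (freq k \<bullet> cross3 (s' t) (a t) + freq k \<bullet> cross3 (s t) (a' t)) / (pi * (freq k \<bullet> freq k)))"
    by (rule ext, simp only: divide_inverse mult_1_left mult.commute[of "inverse _"])
      (rule arg_cong[where f = "\<lambda>x. x * _"], simp add: inner_vec_def sum_3 cross3_def algebra_simps)
  ultimately show ?thesis by simp
qed

lemma integral_vec_eq_0_component:
  fixes w :: "real^3 \<Rightarrow> real^3"
  assumes w: "\<And>i. integrable (lebesgue_on torus) (\<lambda>x. w x $ i)" and 0: "(LINT x|lebesgue_on torus. w x) = 0"
  shows "(LINT x|lebesgue_on torus. w x $ i) = 0"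
proof -
  have "w = (\<lambda>x. \<Sum>i\<in>UNIV. (w x $ i) *\<^sub>R axis i 1)"
    by (simp add: fun_eq_iff vec_eq_iff axis_def if_distrib cong: if_cong)
  moreover have "integrable (lebesgue_on torus) (\<lambda>x. \<Sum>i\<in>UNIV. (w x $ i) *\<^sub>R (axis i 1 :: real^3))"
    using w by simp
  ultimately have "integrable (lebesgue_on torus) w" by metis
  then show ?thesis
    using integral_bounded_linear[OF bounded_linear_vec_nth, of "lebesgue_on torus" w i] 0 by simp
qed

lemma mean_zero_modes:
  assumes v: "Lp 3 (space_time T) v" and mz: "mean_zero T v"
  shows "AE t in time_measure T. cos_vec (\<lambda>_. 0) (slice v t) = 0"
proof -
  have "AE t in time_measure T. \<forall>i. integrable (lebesgue_on torus) (\<lambda>x. v (x, t) $ i)"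
    using st_Fubini(1)[OF Lp3_component_integrable(1)[OF v]] by (simp add: eventually_all_finite)
  with mz[unfolded mean_zero_def] show ?thesis
  proof eventually_elim
    fix t assume "(LINT x|lebesgue_on torus. v (x, t)) = 0" "\<forall>i. integrable (lebesgue_on torus) (\<lambda>x. v (x, t) $ i)"
    then show "cos_vec (\<lambda>_. 0) (slice v t) = 0"
      using integral_vec_eq_0_component[of "slice v t"] by (simp add: vec_eq_iff cos_vec_def fcos_0)
  qed
qed

lemma sin_vec_0 [simp]: "sin_vec (\<lambda>_. 0) w = 0"
  by (simp add: sin_vec_def vec_eq_iff)

text \<open>The product rule on each mode, followed by \<open>helicity_mode_derivative\<close>: the
  negative order of helicity cancels against the curl in the equation, and a plain smoothed pairing
  of b with b x u is left.\<close>

lemma approx_helicity_weak_deriv: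
  assumes T: "0 < T" and b: "Lp 3 (space_time T) b" and u: "Lp 3 (space_time T) u" and mhd: "ideal_MHD T b u q"
    and mz: "mean_zero T b"
  obtains g where "has_weak_deriv T (\<lambda>t. approx_helicity N (slice b t)) g"
    "AE t in time_measure T. g t = - 2 * (\<Sum>i\<in>UNIV. smooth_pairing N (\<lambda>x. b (x, t) $ i) (\<lambda>x. cross3 (b (x, t)) (u (x, t)) $ i))"
proof -
  define E where "E t x = cross3 (b (x, t)) (u (x, t))" for t x
  define a where "a k t = cos_vec k (slice b t)" for k t
  define s where "s k t = sin_vec k (slice b t)" for k t
  define a' where "a' k t = (- (2 * pi)) *\<^sub>R cross3 (freq k) (sin_vec k (E t))" for k t
  define s' where "s' k t = (2 * pi) *\<^sub>R cross3 (freq k) (cos_vec k (E t))" for k t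
  have a: "has_weak_deriv T (\<lambda>t. a k t $ i) (\<lambda>t. a' k t $ i)" and s: "has_weak_deriv T (\<lambda>t. s k t $ i) (\<lambda>t. s' k t $ i)" for k i
  proof -
    have c: "cross3 (freq k) (cos_vec k (E t)) $ i = (\<Sum>m\<in>UNIV. of_int (k m) *
        fcos k (\<lambda>x. b (x, t) $ i * u (x, t) $ m - u (x, t) $ i * b (x, t) $ m))" for t
      unfolding E_def cos_vec_cross[symmetric] by simp
    have s: "cross3 (freq k) (sin_vec k (E t)) $ i = (\<Sum>m\<in>UNIV. of_int (k m) *
        fsin k (\<lambda>x. b (x, t) $ i * u (x, t) $ m - u (x, t) $ i * b (x, t) $ m))" for t
      unfolding E_def sin_vec_cross[symmetric] by simp
    show "has_weak_deriv T (\<lambda>t. a k t $ i) (\<lambda>t. a' k t $ i)"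
      using induction_equation_weak_deriv(1)[OF T b u mhd, of k i] by (simp add: a_def a'_def s cos_vec_def)
    show "has_weak_deriv T (\<lambda>t. s k t $ i) (\<lambda>t. s' k t $ i)"
      using induction_equation_weak_deriv(2)[OF T b u mhd, of k i] by (simp add: s_def s'_def c sin_vec_def)
  qed
  define g where "g t = (\<Sum>k\<in>freq_box N. freq_weight N k *
      ((freq k \<bullet> cross3 (s' k t) (a k t) + freq k \<bullet> cross3 (s k t) (a' k t)) / (pi * (freq k \<bullet> freq k))))" for t
  have g: "has_weak_deriv T (\<lambda>t. approx_helicity N (slice b t)) g"
    unfolding approx_helicity_def a_def[symmetric] s_def[symmetric] g_def[abs_def]
    by (intro has_weak_deriv_sum has_weak_deriv_cmult has_weak_deriv_helicity_mode a s)
  have "AE t in time_measure T. \<forall>k\<in>freq_box N. freq k \<bullet> a k t = 0 \<and> freq k \<bullet> s k t = 0"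
    using divergence_free_modes[OF b mhd] unfolding a_def s_def
    by (intro eventually_ball_finite ballI eventually_conj) auto
  with mean_zero_modes[OF b mz]
  have "AE t in time_measure T. g t = - 2 * (\<Sum>i\<in>UNIV. smooth_pairing N (\<lambda>x. b (x, t) $ i) (\<lambda>x. E t x $ i))"
  proof eventually_elim
    fix t assume a0: "cos_vec (\<lambda>_. 0) (slice b t) = 0" and div: "\<forall>k\<in>freq_box N. freq k \<bullet> a k t = 0 \<and> freq k \<bullet> s k t = 0"
    have "(freq k \<bullet> cross3 (s' k t) (a k t) + freq k \<bullet> cross3 (s k t) (a' k t)) / (pi * (freq k \<bullet> freq k))
        = - 2 * (a k t \<bullet> cos_vec k (E t) + s k t \<bullet> sin_vec k (E t))" if k: "k \<in> freq_box N" for k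
    proof (cases "k = (\<lambda>_. 0)")
      \<comment> \<open>The left side is 0 because x / 0 = 0. The right side vanishes because b has
        mean zero and the sine coefficient at frequency zero is 0.\<close>
      case True
      then show ?thesis using a0 freq_eq_0_iff[of k] by (simp add: a_def s_def)
    next
      case False
      then have kk: "freq k \<bullet> freq k \<noteq> 0" using freq_eq_0_iff[of k] by simp
      have "freq k \<bullet> cross3 (s' k t) (a k t) + freq k \<bullet> cross3 (s k t) (a' k t)
          = 2 * pi * (freq k \<bullet> cross3 (cross3 (freq k) (cos_vec k (E t))) (a k t)
            - freq k \<bullet> cross3 (s k t) (cross3 (freq k) (sin_vec k (E t))))"
        by (simp add: a'_def s'_def cross_mult_left cross_mult_right cross_minus_right right_diff_distrib)
      also have "\<dots> = 2 * pi * (- (freq k \<bullet> freq k) * (a k t \<bullet> cos_vec k (E t) + s k t \<bullet> sin_vec k (E t)))"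
        using div k by (subst helicity_mode_derivative) auto
      finally show ?thesis using kk by simp
    qed
    then have "g t = (\<Sum>k\<in>freq_box N. freq_weight N k * (- 2 * (a k t \<bullet> cos_vec k (E t) + s k t \<bullet> sin_vec k (E t))))"
      unfolding g_def by (intro sum.cong refl) simp
    also have "\<dots> = - 2 * (\<Sum>i\<in>UNIV. smooth_pairing N (\<lambda>x. b (x, t) $ i) (\<lambda>x. E t x $ i))"
      unfolding sum_smooth_pairing[of N "slice b t" "E t"] a_def s_def
      by (simp add: sum_distrib_left mult_ac)
    finally show "g t = - 2 * (\<Sum>i\<in>UNIV. smooth_pairing N (\<lambda>x. b (x, t) $ i) (\<lambda>x. E t x $ i))" .
  qed
  then show ?thesis using that[OF g] by (simp add: E_def)
qed

lemma smooth_pairing_sum_bound: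
  assumes "\<And>i. f i \<in> borel_measurable (lebesgue_on torus)" "\<And>i. integrable (lebesgue_on torus) (\<lambda>x. \<bar>f i x\<bar> ^ 3)"
    and "\<And>i. h i \<in> borel_measurable (lebesgue_on torus)" "\<And>i. integrable (lebesgue_on torus) (\<lambda>x. \<bar>h i x\<bar> powr (3/2))"
  shows "\<bar>\<Sum>i\<in>(UNIV::3 set). smooth_pairing N (f i) (h i)\<bar>
    \<le> (\<Sum>i\<in>UNIV. (LINT x|lebesgue_on torus. \<bar>f i x\<bar> ^ 3) + (LINT x|lebesgue_on torus. \<bar>h i x\<bar> powr (3/2)))"
  by (rule order_trans[OF sum_abs sum_mono]) (use abs_smooth_pairing_le[OF assms, of 1 N] in simp)

lemma AE_all_3: "(\<And>i::3. AE t in M. P i t) \<Longrightarrow> AE t in M. \<forall>i. P i t"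
  by (simp add: eventually_all_finite)

text \<open>Each \<open>L\<^sup>3\<close> solution conserves helicity: the limit of the derivatives is the integral of
  \<open>b \<bullet> (b \<times> u) = 0\<close>.\<close>

lemma oscillation_approx_helicity_tendsto_0:
  assumes T: "0 < T" and b: "Lp 3 (space_time T) b" and u: "Lp 3 (space_time T) u" and mhd: "ideal_MHD T b u q"
    and mz: "mean_zero T b"
  shows "(\<lambda>N. oscillation T (\<lambda>t. approx_helicity N (slice b t))) \<longlonglongrightarrow> 0"
proof -
  define E where "E z = cross3 (b z) (u z)" for z
  note Ei = electric_field_integrable[OF b u, folded E_def]
  note b3 = Lp3_component[OF b]
  have "\<exists>g. has_weak_deriv T (\<lambda>t. approx_helicity N (slice b t)) g \<and>
      (AE t in time_measure T. g t = - 2 * (\<Sum>i\<in>UNIV. smooth_pairing N (\<lambda>x. b (x, t) $ i) (\<lambda>x. E (x, t) $ i)))" for N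
    using approx_helicity_weak_deriv[OF T b u mhd mz, of N] unfolding E_def by blast
  then have "\<forall>N. \<exists>g. has_weak_deriv T (\<lambda>t. approx_helicity N (slice b t)) g \<and>
      (AE t in time_measure T. g t = - 2 * (\<Sum>i\<in>UNIV. smooth_pairing N (\<lambda>x. b (x, t) $ i) (\<lambda>x. E (x, t) $ i)))"
    by blast
  from choice[OF this]
  obtain g where g: "\<And>N. has_weak_deriv T (\<lambda>t. approx_helicity N (slice b t)) (g N)"
    and gE: "\<And>N. AE t in time_measure T. g N t = - 2 * (\<Sum>i\<in>UNIV. smooth_pairing N (\<lambda>x. b (x, t) $ i) (\<lambda>x. E (x, t) $ i))"
    by blast
  \<comment> \<open>A majorant in time that does not depend on \<open>N\<close>, supplied by the
    uniform bound on smoothed pairings.\<close>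
  define w where "w t = (\<Sum>i\<in>UNIV. (LINT x|lebesgue_on torus. \<bar>b (x, t) $ i\<bar> ^ 3) + (LINT x|lebesgue_on torus. \<bar>E (x, t) $ i\<bar> powr (3/2)))" for t
  have wi: "integrable (time_measure T) w"
    unfolding w_def[abs_def]
    by (intro Bochner_Integration.integrable_sum Bochner_Integration.integrable_add st_Fubini(2) Ei(2) b3(2))
  have good: "AE t in time_measure T. \<forall>i. slice (\<lambda>z. b z $ i) t \<in> borel_measurable (lebesgue_on torus) \<and>
      integrable (lebesgue_on torus) (\<lambda>x. \<bar>b (x, t) $ i\<bar> ^ 3) \<and> integrable (lebesgue_on torus) (\<lambda>x. E (x, t) $ i) \<and>
      integrable (lebesgue_on torus) (\<lambda>x. \<bar>E (x, t) $ i\<bar> powr (3/2))"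
    using Lp3_slice[OF b] AE_all_3[OF st_Fubini(1)[OF Ei(1)]] AE_all_3[OF st_Fubini(1)[OF Ei(2)]]
    by eventually_elim auto
  have lim: "(\<lambda>N. LINT t|time_measure T. \<bar>g N t\<bar>) \<longlonglongrightarrow> (LINT t|time_measure T. 0)"
  proof (rule integral_dominated_convergence[where w = "\<lambda>t. 2 * w t"])
    have "AE t in time_measure T. \<forall>N. g N t = - 2 * (\<Sum>i\<in>UNIV. smooth_pairing N (\<lambda>x. b (x, t) $ i) (\<lambda>x. E (x, t) $ i))"
      using gE by (simp add: AE_all_countable)
    then show "AE t in time_measure T. (\<lambda>N. \<bar>g N t\<bar>) \<longlonglongrightarrow> 0"
      using good
    proof eventually_elim
      fix t assume gt: "\<forall>N. g N t = - 2 * (\<Sum>i\<in>UNIV. smooth_pairing N (\<lambda>x. b (x, t) $ i) (\<lambda>x. E (x, t) $ i))"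
        and gd: "\<forall>i. slice (\<lambda>z. b z $ i) t \<in> borel_measurable (lebesgue_on torus) \<and>
          integrable (lebesgue_on torus) (\<lambda>x. \<bar>b (x, t) $ i\<bar> ^ 3) \<and> integrable (lebesgue_on torus) (\<lambda>x. E (x, t) $ i) \<and>
          integrable (lebesgue_on torus) (\<lambda>x. \<bar>E (x, t) $ i\<bar> powr (3/2))"
      have bE: "integrable (lebesgue_on torus) (\<lambda>x. b (x, t) $ i * E (x, t) $ i)" for i
        using gd by (intro abs_integral_mult_le(1)[where l = 1]) auto
      have "(\<lambda>N. \<Sum>i\<in>UNIV. smooth_pairing N (\<lambda>x. b (x, t) $ i) (\<lambda>x. E (x, t) $ i))
          \<longlonglongrightarrow> (\<Sum>i\<in>UNIV. LINT x|lebesgue_on torus. b (x, t) $ i * E (x, t) $ i)"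
        using gd by (intro tendsto_sum smooth_pairing_tendsto) auto
      also have "(\<Sum>i\<in>UNIV. LINT x|lebesgue_on torus. b (x, t) $ i * E (x, t) $ i)
          = (LINT x|lebesgue_on torus. (\<Sum>i\<in>UNIV. b (x, t) $ i * E (x, t) $ i))"
        using bE by simp
      also have "(\<lambda>x. \<Sum>i\<in>UNIV. b (x, t) $ i * E (x, t) $ i) = (\<lambda>x. 0)"
        using dot_cross_self(1) by (simp add: E_def inner_vec_def fun_eq_iff)
      finally have "(\<lambda>N. \<bar>- 2 * (\<Sum>i\<in>UNIV. smooth_pairing N (\<lambda>x. b (x, t) $ i) (\<lambda>x. E (x, t) $ i))\<bar>) \<longlonglongrightarrow> \<bar>- 2 * 0\<bar>"
        by (intro tendsto_rabs tendsto_mult tendsto_const) simp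
      then show "(\<lambda>N. \<bar>g N t\<bar>) \<longlonglongrightarrow> 0" using gt by simp
    qed
    show "AE t in time_measure T. norm \<bar>g N t\<bar> \<le> 2 * w t" for N
      using gE[of N] good
    proof eventually_elim
      fix t assume gt: "g N t = - 2 * (\<Sum>i\<in>UNIV. smooth_pairing N (\<lambda>x. b (x, t) $ i) (\<lambda>x. E (x, t) $ i))"
        and gd: "\<forall>i. slice (\<lambda>z. b z $ i) t \<in> borel_measurable (lebesgue_on torus) \<and>
          integrable (lebesgue_on torus) (\<lambda>x. \<bar>b (x, t) $ i\<bar> ^ 3) \<and> integrable (lebesgue_on torus) (\<lambda>x. E (x, t) $ i) \<and>
          integrable (lebesgue_on torus) (\<lambda>x. \<bar>E (x, t) $ i\<bar> powr (3/2))"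
      have "\<bar>\<Sum>i\<in>UNIV. smooth_pairing N (\<lambda>x. b (x, t) $ i) (\<lambda>x. E (x, t) $ i)\<bar> \<le> w t"
        unfolding w_def using gd by (intro smooth_pairing_sum_bound) auto
      then show "norm \<bar>g N t\<bar> \<le> 2 * w t" by (simp add: gt abs_mult)
    qed
    show "(\<lambda>t. \<bar>g N t\<bar>) \<in> borel_measurable (time_measure T)" for N
      using has_weak_deriv_integrable(2)[OF g[of N]] by auto
  qed (use wi in auto)
  have up: "oscillation T (\<lambda>t. approx_helicity N (slice b t)) \<le> 2 * T * (LINT t|time_measure T. \<bar>g N t\<bar>)" for N
    by (rule oscillation_has_weak_deriv[OF T g])
  have "(\<lambda>N. 2 * T * (LINT t|time_measure T. \<bar>g N t\<bar>)) \<longlonglongrightarrow> 2 * T * 0"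
    using lim by (intro tendsto_mult tendsto_const) simp
  then have "(\<lambda>N. 2 * T * (LINT t|time_measure T. \<bar>g N t\<bar>)) \<longlonglongrightarrow> 0" by simp
  from tendsto_sandwich[OF _ _ tendsto_const this] show ?thesis
    using up oscillation_nonneg by simp
qed

subsection \<open>Passage to the limit\<close>

definition L1_converges :: "real \<Rightarrow> (nat \<Rightarrow> real \<Rightarrow> real) \<Rightarrow> (real \<Rightarrow> real) \<Rightarrow> bool"
  where "L1_converges T f F \<longleftrightarrow> (\<forall>j. integrable (time_measure T) (f j)) \<and> integrable (time_measure T) F \<and>
    (\<lambda>j. LINT t|time_measure T. \<bar>f j t - F t\<bar>) \<longlonglongrightarrow> 0"

lemma L1_converges_0: "L1_converges T (\<lambda>_ _. 0) (\<lambda>_. 0)"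
  by (simp add: L1_converges_def)

lemma L1_converges_add:
  assumes "L1_converges T f F" "L1_converges T h H"
  shows "L1_converges T (\<lambda>j t. f j t + h j t) (\<lambda>t. F t + H t)"
proof -
  note i = assms[unfolded L1_converges_def]
  have le: "(LINT t|time_measure T. \<bar>f j t + h j t - (F t + H t)\<bar>)
      \<le> (LINT t|time_measure T. \<bar>f j t - F t\<bar>) + (LINT t|time_measure T. \<bar>h j t - H t\<bar>)" for j
  proof -
    have "(LINT t|time_measure T. \<bar>f j t + h j t - (F t + H t)\<bar>)
        \<le> (LINT t|time_measure T. \<bar>f j t - F t\<bar> + \<bar>h j t - H t\<bar>)"
      using i by (intro integral_mono) auto
    also have "\<dots> = (LINT t|time_measure T. \<bar>f j t - F t\<bar>) + (LINT t|time_measure T. \<bar>h j t - H t\<bar>)"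
      using i by simp
    finally show ?thesis .
  qed
  have "(\<lambda>j. (LINT t|time_measure T. \<bar>f j t - F t\<bar>) + (LINT t|time_measure T. \<bar>h j t - H t\<bar>)) \<longlonglongrightarrow> 0"
    using i by (intro tendsto_add_zero) auto
  from tendsto_sandwich[OF _ _ tendsto_const this]
  have "(\<lambda>j. LINT t|time_measure T. \<bar>f j t + h j t - (F t + H t)\<bar>) \<longlonglongrightarrow> 0"
    using le by simp
  then show ?thesis using i by (simp add: L1_converges_def)
qed

lemma L1_converges_cmult:
  assumes "L1_converges T f F"
  shows "L1_converges T (\<lambda>j t. c * f j t) (\<lambda>t. c * F t)"
proof -
  have "(\<lambda>j. \<bar>c\<bar> * (LINT t|time_measure T. \<bar>f j t - F t\<bar>)) \<longlonglongrightarrow> \<bar>c\<bar> * 0"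
    using assms by (intro tendsto_mult tendsto_const) (simp add: L1_converges_def)
  then show ?thesis
    using assms by (simp add: L1_converges_def abs_mult flip: right_diff_distrib)
qed

lemma L1_converges_diff:
  assumes "L1_converges T f F" "L1_converges T h H"
  shows "L1_converges T (\<lambda>j t. f j t - h j t) (\<lambda>t. F t - H t)"
  using L1_converges_add[OF assms(1) L1_converges_cmult[OF assms(2), of "-1"]] by simp

lemma L1_converges_sum:
  assumes "\<And>i. i \<in> A \<Longrightarrow> L1_converges T (f i) (F i)"
  shows "L1_converges T (\<lambda>j t. \<Sum>i\<in>A. f i j t) (\<lambda>t. \<Sum>i\<in>A. F i t)"
  using assms
  by (induction A rule: infinite_finite_induct) (auto intro: L1_converges_0 L1_converges_add)

text \<open>Convergence in L^1 alone does not pass to products, but helicity is quadratic; essential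
  bounds uniform in \<open>j\<close> make up for it.\<close>

definition bounded_L1_converges :: "real \<Rightarrow> (nat \<Rightarrow> real \<Rightarrow> real) \<Rightarrow> (real \<Rightarrow> real) \<Rightarrow> bool"
  where "bounded_L1_converges T f F \<longleftrightarrow> L1_converges T f F \<and>
    (\<exists>B. (\<forall>j. AE t in time_measure T. \<bar>f j t\<bar> \<le> B) \<and> (AE t in time_measure T. \<bar>F t\<bar> \<le> B))"

lemma L1_converges_mult:
  assumes f: "bounded_L1_converges T f F" and h: "bounded_L1_converges T h H"
  shows "L1_converges T (\<lambda>j t. f j t * h j t) (\<lambda>t. F t * H t)"
proof -
  obtain B where B: "\<And>j. AE t in time_measure T. \<bar>f j t\<bar> \<le> B" "AE t in time_measure T. \<bar>F t\<bar> \<le> B"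
    using f by (auto simp: bounded_L1_converges_def)
  obtain D where D: "\<And>j. AE t in time_measure T. \<bar>h j t\<bar> \<le> D" "AE t in time_measure T. \<bar>H t\<bar> \<le> D"
    using h by (auto simp: bounded_L1_converges_def)
  have fi: "\<And>j. integrable (time_measure T) (f j)" "integrable (time_measure T) F"
      "(\<lambda>j. LINT t|time_measure T. \<bar>f j t - F t\<bar>) \<longlonglongrightarrow> 0"
    and hi: "\<And>j. integrable (time_measure T) (h j)" "integrable (time_measure T) H"
      "(\<lambda>j. LINT t|time_measure T. \<bar>h j t - H t\<bar>) \<longlonglongrightarrow> 0"
    using f h by (auto simp: bounded_L1_converges_def L1_converges_def)
  have i1: "integrable (time_measure T) (\<lambda>t. f j t * h j t)" for j
    by (rule integrable_mult_AE_bounded[OF borel_measurable_integrable[OF fi(1)] B(1) hi(1)])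
  have i2: "integrable (time_measure T) (\<lambda>t. F t * H t)"
    by (rule integrable_mult_AE_bounded[OF borel_measurable_integrable[OF fi(2)] B(2) hi(2)])
  have le: "(LINT t|time_measure T. \<bar>f j t * h j t - F t * H t\<bar>)
      \<le> D * (LINT t|time_measure T. \<bar>f j t - F t\<bar>) + B * (LINT t|time_measure T. \<bar>h j t - H t\<bar>)" for j
  proof -
    have "(LINT t|time_measure T. \<bar>f j t * h j t - F t * H t\<bar>)
        \<le> (LINT t|time_measure T. D * \<bar>f j t - F t\<bar> + B * \<bar>h j t - H t\<bar>)"
    proof (rule integral_mono_AE)
      show "AE t in time_measure T. \<bar>f j t * h j t - F t * H t\<bar> \<le> D * \<bar>f j t - F t\<bar> + B * \<bar>h j t - H t\<bar>"
        using D(1)[of j] B(2)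
      proof eventually_elim
        fix t assume b: "\<bar>h j t\<bar> \<le> D" "\<bar>F t\<bar> \<le> B"
        have "f j t * h j t - F t * H t = h j t * (f j t - F t) + F t * (h j t - H t)"
          by (simp add: algebra_simps)
        then have "\<bar>f j t * h j t - F t * H t\<bar> \<le> \<bar>h j t\<bar> * \<bar>f j t - F t\<bar> + \<bar>F t\<bar> * \<bar>h j t - H t\<bar>"
          using abs_triangle_ineq[of "h j t * (f j t - F t)" "F t * (h j t - H t)"] by (simp add: abs_mult)
        also have "\<dots> \<le> D * \<bar>f j t - F t\<bar> + B * \<bar>h j t - H t\<bar>"
          using b by (intro add_mono mult_right_mono) auto
        finally show "\<bar>f j t * h j t - F t * H t\<bar> \<le> D * \<bar>f j t - F t\<bar> + B * \<bar>h j t - H t\<bar>" .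
      qed
    qed (use i1 i2 fi hi in auto)
    also have "\<dots> = D * (LINT t|time_measure T. \<bar>f j t - F t\<bar>) + B * (LINT t|time_measure T. \<bar>h j t - H t\<bar>)"
      using fi hi by simp
    finally show ?thesis .
  qed
  have "(\<lambda>j. D * (LINT t|time_measure T. \<bar>f j t - F t\<bar>) + B * (LINT t|time_measure T. \<bar>h j t - H t\<bar>)) \<longlonglongrightarrow> D * 0 + B * 0"
    by (intro tendsto_intros fi hi)
  then have "(\<lambda>j. D * (LINT t|time_measure T. \<bar>f j t - F t\<bar>) + B * (LINT t|time_measure T. \<bar>h j t - H t\<bar>)) \<longlonglongrightarrow> 0" by simp
  from tendsto_sandwich[OF _ _ tendsto_const this]
  have "(\<lambda>j. LINT t|time_measure T. \<bar>f j t * h j t - F t * H t\<bar>) \<longlonglongrightarrow> 0"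
    using le by simp
  then show ?thesis using i1 i2 by (simp add: L1_converges_def)
qed

text \<open>On a finite measure space L^2 lies in L^(3/2), so weak convergence in L^3 may be tested
  with L^2 functions, as the uniform boundedness argument requires.\<close>

lemma Lp_of_square_integrable:
  fixes g :: "'a::euclidean_space \<Rightarrow> 'b::euclidean_space"
  assumes A: "finite_measure (lebesgue_on A)" and g: "square_integrable (lebesgue_on A) g"
  shows "Lp (3/2) A g"
  unfolding Lp_def
proof
  show gm: "g \<in> borel_measurable (lebesgue_on A)" using g by (simp add: square_integrable_def)
  have i: "integrable (lebesgue_on A) (\<lambda>z. 1 + (norm (g z))\<^sup>2)"
    using g finite_measure.integrable_const[OF A, of "1::real"] by (simp add: square_integrable_def)
  have "norm (g z) powr (3/2) \<le> 1 + (norm (g z))\<^sup>2" for z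
  proof (cases "norm (g z) \<le> 1")
    case True
    then have "norm (g z) powr (3/2) \<le> 1" by (simp add: powr_le1)
    then show ?thesis by (simp add: add_increasing2)
  next
    case False
    then have "norm (g z) powr (3/2) \<le> norm (g z) powr 2" by (intro powr_mono) auto
    then show ?thesis by (simp add: powr_numeral)
  qed
  then show "integrable (lebesgue_on A) (\<lambda>z. norm (g z) powr (3/2))"
    by (intro Bochner_Integration.integrable_bound[OF i]) (use gm in auto)
qed

lemma Lp3_square_integrable:
  fixes v :: "(real^3) \<times> real \<Rightarrow> real^3"
  assumes "Lp 3 (space_time T) v"
  shows "square_integrable (st_measure T) v"
proof -
  have "(\<lambda>z. norm (v z)) \<in> borel_measurable (st_measure T)" "integrable (st_measure T) (\<lambda>z. \<bar>norm (v z)\<bar> ^ 3)"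
    using assms by (auto simp: Lp_def powr_numeral)
  from cube_integrable(2)[OF finite_measure_st this] show ?thesis
    using assms by (simp add: square_integrable_def Lp_def)
qed

text \<open>The L^2 bound serves twice: for the frequency tail through Bessel's inequality and for
  the L^1 norm of the fluxes.\<close>

lemma weakly_converges_L3_bounded:
  assumes "weakly_converges_L3 (space_time T) vj (v :: (real^3) \<times> real \<Rightarrow> real^3)"
  shows "\<exists>C. \<forall>j. (LINT z|st_measure T. (norm (vj j z))\<^sup>2) \<le> C"
proof (rule square_integrable_uniformly_bounded)
  show "square_integrable (st_measure T) (vj j)" for j
    using assms by (intro Lp3_square_integrable) (simp add: weakly_converges_L3_def)
  fix g :: "(real^3) \<times> real \<Rightarrow> real^3" assume "square_integrable (st_measure T) g"
  then have "Lp (3/2) (space_time T) g" by (rule Lp_of_square_integrable[OF finite_measure_st])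
  then have "(\<lambda>j. LINT z|st_measure T. vj j z \<bullet> g z) \<longlonglongrightarrow> (LINT z|st_measure T. v z \<bullet> g z)"
    using assms unfolding weakly_converges_L3_def by blast
  from convergent_imp_Bseq[OF convergentI[OF this]]
  show "Bseq (\<lambda>j. LINT z|st_measure T. vj j z \<bullet> g z)" .
qed

lemma weakly_converges_component:
  fixes v :: "(real^3) \<times> real \<Rightarrow> real^3"
  assumes w: "weakly_converges_L3 (space_time T) vj v"
    and g: "g \<in> borel_measurable (st_measure T)" "\<And>z. \<bar>g z\<bar> \<le> B"
  shows "(\<lambda>j. LINT z|st_measure T. vj j z $ i * g z) \<longlonglongrightarrow> (LINT z|st_measure T. v z $ i * g z)"
proof -
  have "square_integrable (st_measure T) (\<lambda>z. g z *\<^sub>R (axis i 1 :: real^3))"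
    unfolding square_integrable_def
  proof
    show m: "(\<lambda>z. g z *\<^sub>R (axis i 1 :: real^3)) \<in> borel_measurable (st_measure T)" using g(1) by simp
    have "(\<lambda>z. (norm (g z *\<^sub>R (axis i 1 :: real^3)))\<^sup>2) = (\<lambda>z. (g z)\<^sup>2)" by simp
    moreover have "integrable (st_measure T) (\<lambda>z. (g z)\<^sup>2)"
    proof (rule finite_measure.integrable_const_bound[OF finite_measure_st, of _ "B\<^sup>2"])
      show "AE z in st_measure T. norm ((g z)\<^sup>2) \<le> B\<^sup>2"
      proof (rule AE_I2)
        fix z
        have "\<bar>g z\<bar>\<^sup>2 \<le> B\<^sup>2" using g(2)[of z] by (intro power_mono) auto
        then show "norm ((g z)\<^sup>2) \<le> B\<^sup>2" by simp
      qed
    qed (use g(1) in simp)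
    ultimately show "integrable (st_measure T) (\<lambda>z. (norm (g z *\<^sub>R (axis i 1 :: real^3)))\<^sup>2)" by simp
  qed
  from Lp_of_square_integrable[OF finite_measure_st this] w
  have "(\<lambda>j. LINT z|st_measure T. vj j z \<bullet> (g z *\<^sub>R axis i 1)) \<longlonglongrightarrow> (LINT z|st_measure T. v z \<bullet> (g z *\<^sub>R axis i 1))"
    unfolding weakly_converges_L3_def by blast
  then show ?thesis by (simp add: inner_axis mult.commute)
qed

lemma abs_fcos_le: "integrable (lebesgue_on torus) f \<Longrightarrow> \<bar>fcos k f\<bar> \<le> (LINT x|lebesgue_on torus. \<bar>f x\<bar>)"
  and abs_fsin_le: "integrable (lebesgue_on torus) f \<Longrightarrow> \<bar>fsin k f\<bar> \<le> (LINT x|lebesgue_on torus. \<bar>f x\<bar>)"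
proof -
  assume f: "integrable (lebesgue_on torus) f"
  have "\<bar>fcos k f\<bar> \<le> (LINT x|lebesgue_on torus. \<bar>f x * cosk k x\<bar>)" unfolding fcos_def by (rule integral_abs_bound)
  also have "\<dots> \<le> (LINT x|lebesgue_on torus. \<bar>f x\<bar>)"
    using f abs_cosk_le by (intro integral_mono integrable_abs integrable_times_cosk) (auto simp: abs_mult mult_left_le)
  finally show "\<bar>fcos k f\<bar> \<le> (LINT x|lebesgue_on torus. \<bar>f x\<bar>)" .
  have "\<bar>fsin k f\<bar> \<le> (LINT x|lebesgue_on torus. \<bar>f x * sink k x\<bar>)" unfolding fsin_def by (rule integral_abs_bound)
  also have "\<dots> \<le> (LINT x|lebesgue_on torus. \<bar>f x\<bar>)"
    using f abs_sink_le by (intro integral_mono integrable_abs integrable_times_sink) (auto simp: abs_mult mult_left_le)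
  finally show "\<bar>fsin k f\<bar> \<le> (LINT x|lebesgue_on torus. \<bar>f x\<bar>)" .
qed

lemma st_abs_fcos_le:
  assumes f: "integrable (st_measure T) f"
  shows "(LINT t|time_measure T. \<bar>fcos k (slice f t)\<bar>) \<le> (LINT z|st_measure T. \<bar>f z\<bar>)"
    and "(LINT t|time_measure T. \<bar>fsin k (slice f t)\<bar>) \<le> (LINT z|st_measure T. \<bar>f z\<bar>)"
proof -
  have fa: "integrable (st_measure T) (\<lambda>z. \<bar>f z\<bar>)" using f by simp
  have "(LINT t|time_measure T. \<bar>fcos k (slice f t)\<bar>) \<le> (LINT t|time_measure T. LINT x|lebesgue_on torus. \<bar>f (x, t)\<bar>)"
    using st_Fubini(1)[OF f] st_fcos(1)[OF f] st_Fubini(2)[OF fa]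
    by (intro integral_mono_AE) (auto elim!: eventually_mono intro: abs_fcos_le)
  then show "(LINT t|time_measure T. \<bar>fcos k (slice f t)\<bar>) \<le> (LINT z|st_measure T. \<bar>f z\<bar>)"
    by (simp add: st_Fubini(3)[OF fa])
  have "(LINT t|time_measure T. \<bar>fsin k (slice f t)\<bar>) \<le> (LINT t|time_measure T. LINT x|lebesgue_on torus. \<bar>f (x, t)\<bar>)"
    using st_Fubini(1)[OF f] st_fcos(2)[OF f] st_Fubini(2)[OF fa]
    by (intro integral_mono_AE) (auto elim!: eventually_mono intro: abs_fsin_le)
  then show "(LINT t|time_measure T. \<bar>fsin k (slice f t)\<bar>) \<le> (LINT z|st_measure T. \<bar>f z\<bar>)"
    by (simp add: st_Fubini(3)[OF fa])
qed

lemma flux_L1_le: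
  fixes b u :: "(real^3) \<times> real \<Rightarrow> real^3"
  assumes b: "Lp 3 (space_time T) b" and u: "Lp 3 (space_time T) u"
  shows "(LINT z|st_measure T. \<bar>b z $ i * u z $ m - u z $ i * b z $ m\<bar>)
    \<le> (LINT z|st_measure T. (norm (b z))\<^sup>2) + (LINT z|st_measure T. (norm (u z))\<^sup>2)"
proof -
  have P: "integrable (st_measure T) (\<lambda>z. b z $ i * u z $ m - u z $ i * b z $ m)"
    by (intro Bochner_Integration.integrable_diff Lp3_mult_integrable b u)
  note sq = Lp3_square_integrable[OF b, unfolded square_integrable_def] Lp3_square_integrable[OF u, unfolded square_integrable_def]
  have le: "\<bar>v $ i * w $ m - w $ i * v $ m\<bar> \<le> (norm v)\<^sup>2 + (norm w)\<^sup>2" for v w :: "real^3"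
  proof -
    have p: "\<bar>v $ p * w $ q\<bar> \<le> norm v * norm w" for p q
      unfolding abs_mult by (intro mult_mono component_le_norm_cart) auto
    have "2 * (norm v * norm w) \<le> (norm v)\<^sup>2 + (norm w)\<^sup>2"
      using sum_squares_bound[of "norm v" "norm w"] by (simp add: mult.assoc)
    then show ?thesis using p[of i m] p[of m i] by (simp add: mult.commute[of "w $ i"])
  qed
  have "(LINT z|st_measure T. \<bar>b z $ i * u z $ m - u z $ i * b z $ m\<bar>) \<le> (LINT z|st_measure T. (norm (b z))\<^sup>2 + (norm (u z))\<^sup>2)"
    using P sq le by (intro integral_mono) auto
  then show ?thesis using sq by simp
qed

text \<open>The time derivative of a fixed mode is a combination of coefficients of the quadratic
  flux. The L^2 bounds on both fields control it in L^1, with a constant that depends on k but not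
  on \<open>j\<close>, even though the fluxes need not converge to the flux of the limit.\<close>

lemma modes_converge:
  assumes T: "0 < T" and bj: "\<And>j. Lp 3 (space_time T) (bj j)" and uj: "\<And>j. Lp 3 (space_time T) (uj j)"
    and mhd: "\<And>j. ideal_MHD T (bj j) (uj j) (qj j)"
    and wb: "weakly_converges_L3 (space_time T) bj b" and wu: "weakly_converges_L3 (space_time T) uj u"
  shows "bounded_L1_converges T (\<lambda>j t. fcos k (slice (\<lambda>z. bj j z $ i) t)) (\<lambda>t. fcos k (slice (\<lambda>z. b z $ i) t))"
    and "bounded_L1_converges T (\<lambda>j t. fsin k (slice (\<lambda>z. bj j z $ i) t)) (\<lambda>t. fsin k (slice (\<lambda>z. b z $ i) t))"
proof -
  have b: "Lp 3 (space_time T) b" using wb by (simp add: weakly_converges_L3_def)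
  note bi = Lp3_component_integrable(1)[OF b, of i] and bji = Lp3_component_integrable(1)[OF bj, where i = i]
  obtain Cb Cu where Cb: "\<And>j. (LINT z|st_measure T. (norm (bj j z))\<^sup>2) \<le> Cb"
    and Cu: "\<And>j. (LINT z|st_measure T. (norm (uj j z))\<^sup>2) \<le> Cu"
    using weakly_converges_L3_bounded[OF wb] weakly_converges_L3_bounded[OF wu] by blast
  define P where "P j m z = bj j z $ i * uj j z $ m - uj j z $ i * bj j z $ m" for j m z
  have Pi: "integrable (st_measure T) (P j m)" for j m
    unfolding P_def by (intro Bochner_Integration.integrable_diff Lp3_mult_integrable bj uj)
  have PC: "(LINT z|st_measure T. \<bar>P j m z\<bar>) \<le> Cb + Cu" for j m
    unfolding P_def using flux_L1_le[OF bj[of j] uj[of j], of i m] Cb[of j] Cu[of j] by linarith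
  \<comment> \<open>Each flux component contributes 2 pi |k_m| times a bound on its L^1
    norm.\<close>
  define C where "C = 2 * pi * (\<Sum>m\<in>UNIV. \<bar>of_int (k m)\<bar> * (Cb + Cu))"
  have deriv_bound: "(LINT t|time_measure T. \<bar>c * (\<Sum>m\<in>UNIV. of_int (k m) * h m t)\<bar>) \<le> C"
    if c: "\<bar>c\<bar> = 2 * pi" and hi: "\<And>m. integrable (time_measure T) (h m)"
      and hC: "\<And>m. (LINT t|time_measure T. \<bar>h m t\<bar>) \<le> Cb + Cu" for c and h :: "3 \<Rightarrow> real \<Rightarrow> real"
  proof -
    have "(LINT t|time_measure T. \<bar>c * (\<Sum>m\<in>UNIV. of_int (k m) * h m t)\<bar>)
        \<le> (LINT t|time_measure T. 2 * pi * (\<Sum>m\<in>UNIV. \<bar>of_int (k m)\<bar> * \<bar>h m t\<bar>))"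
    proof (rule integral_mono)
      show "\<bar>c * (\<Sum>m\<in>UNIV. of_int (k m) * h m t)\<bar> \<le> 2 * pi * (\<Sum>m\<in>UNIV. \<bar>of_int (k m)\<bar> * \<bar>h m t\<bar>)" for t
        unfolding abs_mult c by (intro mult_left_mono order_trans[OF sum_abs]) (auto simp: abs_mult)
    qed (use hi in auto)
    also have "\<dots> = 2 * pi * (\<Sum>m\<in>UNIV. \<bar>of_int (k m)\<bar> * (LINT t|time_measure T. \<bar>h m t\<bar>))"
      using hi by simp
    also have "\<dots> \<le> C"
      unfolding C_def by (intro mult_left_mono sum_mono hC) auto
    finally show ?thesis .
  qed
  have weak: "(\<lambda>j. LINT t|time_measure T. \<theta> t * fcos k (slice (\<lambda>z. bj j z $ i) t))
        \<longlonglongrightarrow> (LINT t|time_measure T. \<theta> t * fcos k (slice (\<lambda>z. b z $ i) t))"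
      "(\<lambda>j. LINT t|time_measure T. \<theta> t * fsin k (slice (\<lambda>z. bj j z $ i) t))
        \<longlonglongrightarrow> (LINT t|time_measure T. \<theta> t * fsin k (slice (\<lambda>z. b z $ i) t))"
    if \<theta>: "\<theta> \<in> borel_measurable (time_measure T)" "\<And>t. \<bar>\<theta> t\<bar> \<le> 1" for \<theta> :: "real \<Rightarrow> real"
  proof -
    have c: "\<bar>\<theta> (snd z) * cosk k (fst z)\<bar> \<le> 1" "\<bar>\<theta> (snd z) * sink k (fst z)\<bar> \<le> 1" for z
      unfolding abs_mult using \<theta>(2) abs_cosk_le abs_sink_le by (auto intro!: mult_le_one)
    show "(\<lambda>j. LINT t|time_measure T. \<theta> t * fcos k (slice (\<lambda>z. bj j z $ i) t))
        \<longlonglongrightarrow> (LINT t|time_measure T. \<theta> t * fcos k (slice (\<lambda>z. b z $ i) t))"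
      unfolding st_fcos_mult(1)[OF bji \<theta>] st_fcos_mult(1)[OF bi \<theta>]
      by (rule weakly_converges_component[OF wb _ c(1)]) (intro borel_measurable_times st_measurable_snd \<theta> st_measurable_cosk)
    show "(\<lambda>j. LINT t|time_measure T. \<theta> t * fsin k (slice (\<lambda>z. bj j z $ i) t))
        \<longlonglongrightarrow> (LINT t|time_measure T. \<theta> t * fsin k (slice (\<lambda>z. b z $ i) t))"
      unfolding st_fcos_mult(2)[OF bji \<theta>] st_fcos_mult(2)[OF bi \<theta>]
      by (rule weakly_converges_component[OF wb _ c(2)]) (intro borel_measurable_times st_measurable_snd \<theta> st_measurable_sink)
  qed
  note d = induction_equation_weak_deriv[OF T bj uj mhd, where k = k and i = i, folded P_def]
  have b1: "(LINT t|time_measure T. \<bar>- (2 * pi) * (\<Sum>m\<in>UNIV. of_int (k m) * fsin k (slice (P j m) t))\<bar>) \<le> C" for j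
    by (intro deriv_bound st_fcos(2) Pi order_trans[OF st_abs_fcos_le(2)[OF Pi] PC]) simp
  have b2: "(LINT t|time_measure T. \<bar>2 * pi * (\<Sum>m\<in>UNIV. of_int (k m) * fcos k (slice (P j m) t))\<bar>) \<le> C" for j
    by (intro deriv_bound st_fcos(1) Pi order_trans[OF st_abs_fcos_le(1)[OF Pi] PC]) simp
  note c1 = weak_imp_strong_convergence[OF T d(1) b1 st_fcos(1)[OF bi] weak(1)]
  note c2 = weak_imp_strong_convergence[OF T d(2) b2 st_fcos(2)[OF bi] weak(2)]
  show "bounded_L1_converges T (\<lambda>j t. fcos k (slice (\<lambda>z. bj j z $ i) t)) (\<lambda>t. fcos k (slice (\<lambda>z. b z $ i) t))"
    unfolding bounded_L1_converges_def L1_converges_def using c1 st_fcos(1)[OF bi] st_fcos(1)[OF bji] by blast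
  show "bounded_L1_converges T (\<lambda>j t. fsin k (slice (\<lambda>z. bj j z $ i) t)) (\<lambda>t. fsin k (slice (\<lambda>z. b z $ i) t))"
    unfolding bounded_L1_converges_def L1_converges_def using c2 st_fcos(2)[OF bi] st_fcos(2)[OF bji] by blast
qed

text \<open>At fixed \<open>N\<close> only finitely many products of two modes are involved.\<close>

lemma approx_helicity_converges:
  assumes T: "0 < T" and bj: "\<And>j. Lp 3 (space_time T) (bj j)" and uj: "\<And>j. Lp 3 (space_time T) (uj j)"
    and mhd: "\<And>j. ideal_MHD T (bj j) (uj j) (qj j)"
    and wb: "weakly_converges_L3 (space_time T) bj b" and wu: "weakly_converges_L3 (space_time T) uj u"
  shows "L1_converges T (\<lambda>j t. approx_helicity N (slice (bj j) t)) (\<lambda>t. approx_helicity N (slice b t))"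
  unfolding approx_helicity_def helicity_mode_expand cos_vec_def sin_vec_def vec_lambda_beta
  by (intro L1_converges_sum L1_converges_cmult L1_converges_add L1_converges_diff L1_converges_mult
      modes_converge[OF T bj uj mhd wb wu])

subsection \<open>The vector potential\<close>

lemma bounded_linear_matrix_entry: "bounded_linear (\<lambda>M :: real^3^3. M $ i $ j)"
  using bounded_linear_compose[OF bounded_linear_vec_nth bounded_linear_vec_nth] .

lemma W13_modes:
  assumes W: "W13 w G"
  shows "fcos k (\<lambda>x. G x $ i $ j) = 2 * pi * of_int (k j) * fsin k (\<lambda>x. w x $ i)"
    and "fsin k (\<lambda>x. G x $ i $ j) = - (2 * pi * of_int (k j)) * fcos k (\<lambda>x. w x $ i)"
proof -
  have by_parts: "(LINT x|lebesgue_on torus. G x $ i $ j * \<phi> x) = - (LINT x|lebesgue_on torus. w x $ i * dir_deriv (axis j 1) \<phi> x)"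
    if "torus_test \<phi>" for \<phi>
    using W that unfolding W13_def by blast
  have "fcos k (\<lambda>x. G x $ i $ j) = - (LINT x|lebesgue_on torus. - (2 * pi * of_int (k j)) * (w x $ i * sink k x))"
    unfolding fcos_def by_parts[OF torus_test_cosk] dir_deriv_cosk by (simp add: mult_ac)
  also have "\<dots> = 2 * pi * of_int (k j) * fsin k (\<lambda>x. w x $ i)"
    unfolding integral_mult_right_zero fsin_def by simp
  finally show "fcos k (\<lambda>x. G x $ i $ j) = 2 * pi * of_int (k j) * fsin k (\<lambda>x. w x $ i)" .
  have "fsin k (\<lambda>x. G x $ i $ j) = - (LINT x|lebesgue_on torus. 2 * pi * of_int (k j) * (w x $ i * cosk k x))"
    unfolding fsin_def by_parts[OF torus_test_sink] dir_deriv_sink by (simp add: mult_ac)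
  also have "\<dots> = - (2 * pi * of_int (k j)) * fcos k (\<lambda>x. w x $ i)"
    unfolding integral_mult_right_zero fcos_def by simp
  finally show "fsin k (\<lambda>x. G x $ i $ j) = - (2 * pi * of_int (k j)) * fcos k (\<lambda>x. w x $ i)" .
qed

lemma fcos_cong_AE:
  assumes "AE x in lebesgue_on torus. f x = h x" "integrable (lebesgue_on torus) f" "integrable (lebesgue_on torus) h"
  shows "fcos k f = fcos k h" and "fsin k f = fsin k h"
proof -
  note [measurable] = borel_measurable_integrable[OF assms(2)] borel_measurable_integrable[OF assms(3)]
  show "fcos k f = fcos k h"
    unfolding fcos_def using assms(1) by (intro integral_cong_AE) (auto elim!: eventually_mono)
  show "fsin k f = fsin k h"
    unfolding fsin_def using assms(1) by (intro integral_cong_AE) (auto elim!: eventually_mono)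
qed

lemma fcos_diff:
  assumes "integrable (lebesgue_on torus) f" "integrable (lebesgue_on torus) h"
  shows "fcos k (\<lambda>x. f x - h x) = fcos k f - fcos k h" and "fsin k (\<lambda>x. f x - h x) = fsin k f - fsin k h"
    and "fcos k (\<lambda>x. f x + h x) = fcos k f + fcos k h" and "fsin k (\<lambda>x. f x + h x) = fsin k f + fsin k h"
  using assms by (simp_all add: fcos_def fsin_def left_diff_distrib distrib_right integrable_times_cosk integrable_times_sink)

text \<open>The curl becomes multiplication by 2 pi k with cosine and sine exchanged, and the trace
  condition becomes orthogonality of the coefficients of the potential to k.\<close>

lemma potential_modes:
  assumes W: "W13 w G" and curl: "AE x in lebesgue_on torus. curl_of_grad (G x) = v x"
    and tr: "AE x in lebesgue_on torus. trace (G x) = 0" and v: "\<And>i. integrable (lebesgue_on torus) (\<lambda>x. v x $ i)"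
  shows "cos_vec k v = (2 * pi) *\<^sub>R cross3 (freq k) (sin_vec k w)"
    and "sin_vec k v = - (2 * pi) *\<^sub>R cross3 (freq k) (cos_vec k w)"
    and "freq k \<bullet> cos_vec k w = 0" and "freq k \<bullet> sin_vec k w = 0"
proof -
  have "Lp 3 torus G" using W by (simp add: W13_def)
  then have "integrable (lebesgue_on torus) G" by (rule Lp3_integrable[OF _ finite_measure_torus])
  then have Gi: "integrable (lebesgue_on torus) (\<lambda>x. G x $ i $ j)" for i j
    by (rule integrable_bounded_linear[OF bounded_linear_matrix_entry])
  note m = W13_modes[OF W]
  have pt: "v x $ 1 = G x $ 3 $ 2 - G x $ 2 $ 3" "v x $ 2 = G x $ 1 $ 3 - G x $ 3 $ 1" "v x $ 3 = G x $ 2 $ 1 - G x $ 1 $ 2"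
    if "curl_of_grad (G x) = v x" for x
    unfolding that[symmetric] by (simp_all add: curl_of_grad_def)
  have c: "AE x in lebesgue_on torus. v x $ 1 = G x $ 3 $ 2 - G x $ 2 $ 3"
    "AE x in lebesgue_on torus. v x $ 2 = G x $ 1 $ 3 - G x $ 3 $ 1"
    "AE x in lebesgue_on torus. v x $ 3 = G x $ 2 $ 1 - G x $ 1 $ 2"
    by (auto intro: eventually_mono[OF curl] simp: pt)
  note d = fcos_cong_AE[OF c(1) v Bochner_Integration.integrable_diff[OF Gi Gi]] fcos_cong_AE[OF c(2) v Bochner_Integration.integrable_diff[OF Gi Gi]]
    fcos_cong_AE[OF c(3) v Bochner_Integration.integrable_diff[OF Gi Gi]]
  show "cos_vec k v = (2 * pi) *\<^sub>R cross3 (freq k) (sin_vec k w)"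
    by (simp add: vec_eq_iff forall_3 cross3_def cos_vec_def sin_vec_def d fcos_diff[OF Gi Gi] m right_diff_distrib)
  show "sin_vec k v = - (2 * pi) *\<^sub>R cross3 (freq k) (cos_vec k w)"
    by (simp add: vec_eq_iff forall_3 cross3_def cos_vec_def sin_vec_def d fcos_diff[OF Gi Gi] m right_diff_distrib)
  have t: "AE x in lebesgue_on torus. (G x $ 1 $ 1 + G x $ 2 $ 2) + G x $ 3 $ 3 = 0"
    using tr by eventually_elim (simp add: trace_def sum_3)
  have G12: "integrable (lebesgue_on torus) (\<lambda>x. G x $ 1 $ 1 + G x $ 2 $ 2)"
    by (intro Bochner_Integration.integrable_add Gi)
  note e = fcos_cong_AE[OF t Bochner_Integration.integrable_add[OF G12 Gi] integrable_const_torus]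
  have z: "fcos k (\<lambda>x. 0) = 0" "fsin k (\<lambda>x. 0) = 0" by (simp_all add: fcos_def fsin_def)
  have "2 * pi * (freq k \<bullet> sin_vec k w) = 0"
    using e(1)[of k] unfolding fcos_diff(3)[OF G12 Gi] fcos_diff(3)[OF Gi Gi] m z
    by (simp add: inner_vec_def sum_3 sin_vec_def algebra_simps)
  then show "freq k \<bullet> sin_vec k w = 0" by simp
  have "- (2 * pi) * (freq k \<bullet> cos_vec k w) = 0"
    using e(2)[of k] unfolding fcos_diff(4)[OF G12 Gi] fcos_diff(4)[OF Gi Gi] m z
    by (simp add: inner_vec_def sum_3 cos_vec_def algebra_simps)
  then show "freq k \<bullet> cos_vec k w = 0" by simp
qed

text \<open>This ties the expression in the field alone to its potential, by
  \<open>helicity_mode_potential\<close> for nonzero k. At k = 0 the mode is 0 by the division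
  convention, and the pairing vanishes because the potential has mean zero.\<close>

lemma approx_helicity_eq_pairing:
  assumes W: "W13 w G" and curl: "AE x in lebesgue_on torus. curl_of_grad (G x) = v x"
    and tr: "AE x in lebesgue_on torus. trace (G x) = 0" and v: "\<And>i. integrable (lebesgue_on torus) (\<lambda>x. v x $ i)"
    and mz: "cos_vec (\<lambda>_. 0) w = 0"
  shows "approx_helicity N v = (\<Sum>i\<in>UNIV. smooth_pairing N (\<lambda>x. v x $ i) (\<lambda>x. w x $ i))"
  unfolding approx_helicity_def sum_smooth_pairing
proof (rule sum.cong[OF refl])
  fix k
  note p = potential_modes[OF W curl tr v]
  have "helicity_mode k (cos_vec k v) (sin_vec k v) = cos_vec k v \<bullet> cos_vec k w + sin_vec k v \<bullet> sin_vec k w"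
  proof (cases "k = (\<lambda>_. 0)")
    case True
    then show ?thesis using mz freq_eq_0_iff[of k] by (simp add: helicity_mode_def)
  next
    case False
    then show ?thesis using helicity_mode_potential[OF p(3,4) _ p(1,2)] by blast
  qed
  then show "freq_weight N k * helicity_mode k (cos_vec k v) (sin_vec k v)
      = freq_weight N k * (cos_vec k v \<bullet> cos_vec k w + sin_vec k v \<bullet> sin_vec k w)" by simp
qed

text \<open>For almost every \<open>t\<close> the smoothed pairing of b with \<Psi> converges to the
  helicity. Here \<Psi> takes the place of the L^(3/2) factor, as L^3 lies in L^(3/2) on a set of
  finite measure.\<close>

lemma approx_helicity_tendsto_helicity:
  assumes T: "0 < T" and b: "Lp 3 (space_time T) b" and pot: "vector_potential T b \<Psi>"
    and Qi: "\<And>N. integrable (time_measure T) (\<lambda>t. approx_helicity N (slice b t))"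
  shows "integrable (time_measure T) (\<lambda>t. LINT x|lebesgue_on torus. \<Psi> (x, t) \<bullet> b (x, t))"
    and "(\<lambda>N. LINT t|time_measure T. \<bar>approx_helicity N (slice b t) - (LINT x|lebesgue_on torus. \<Psi> (x, t) \<bullet> b (x, t))\<bar>) \<longlonglongrightarrow> 0"
proof -
  obtain G where L: "L3_W13 T \<Psi> G" and curl: "AE z in st_measure T. curl_of_grad (G z) = b z"
    and tr: "AE z in st_measure T. trace (G z) = 0" and mz: "mean_zero T \<Psi>"
    using pot unfolding vector_potential_def by blast
  have \<Psi>: "Lp 3 (space_time T) \<Psi>" and W: "AE t in time_measure T. W13 (slice \<Psi> t) (slice G t)"
    using L by (auto simp: L3_W13_def)
  define H where "H t = (LINT x|lebesgue_on torus. \<Psi> (x, t) \<bullet> b (x, t))" for t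
  have Hi: "integrable (time_measure T) H"
    unfolding H_def[abs_def]
    by (rule st_Fubini(2)[OF square_integrable_inner[OF Lp3_square_integrable[OF \<Psi>] Lp3_square_integrable[OF b]]])
  then show "integrable (time_measure T) (\<lambda>t. LINT x|lebesgue_on torus. \<Psi> (x, t) \<bullet> b (x, t))"
    by (simp add: H_def[abs_def])
  have \<Psi>32: "AE t in time_measure T. \<forall>i. integrable (lebesgue_on torus) (\<lambda>x. \<bar>\<Psi> (x, t) $ i\<bar> powr (3/2))"
    by (intro AE_all_3 st_Fubini(1) Lp3_component_integrable(3) \<Psi>)
  define w where "w t = (\<Sum>i\<in>UNIV. (LINT x|lebesgue_on torus. \<bar>b (x, t) $ i\<bar> ^ 3) + (LINT x|lebesgue_on torus. \<bar>\<Psi> (x, t) $ i\<bar> powr (3/2)))" for t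
  have wi: "integrable (time_measure T) w"
    unfolding w_def[abs_def]
    by (intro Bochner_Integration.integrable_sum Bochner_Integration.integrable_add st_Fubini(2)
        Lp3_component_integrable(3)[OF \<Psi>] Lp3_component(2)[OF b])
  have curl': "AE t in time_measure T. AE x in lebesgue_on torus. curl_of_grad (G (x, t)) = b (x, t)"
    by (rule AE_lebesgue_on_prod[OF _ _ curl]) auto
  have tr': "AE t in time_measure T. AE x in lebesgue_on torus. trace (G (x, t)) = 0"
    by (rule AE_lebesgue_on_prod[OF _ _ tr]) auto
  have main: "AE t in time_measure T. (\<forall>N. \<bar>approx_helicity N (slice b t)\<bar> \<le> w t) \<and> (\<lambda>N. approx_helicity N (slice b t)) \<longlonglongrightarrow> H t"
    using eventually_conj[OF W eventually_conj[OF curl' eventually_conj[OF tr'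
      eventually_conj[OF mean_zero_modes[OF \<Psi> mz] eventually_conj[OF Lp3_slice[OF b] eventually_conj[OF Lp3_slice[OF \<Psi>] \<Psi>32]]]]]]
  proof (rule eventually_mono, elim conjE)
    fix t
    assume W: "W13 (slice \<Psi> t) (slice G t)" and curl: "AE x in lebesgue_on torus. curl_of_grad (G (x, t)) = b (x, t)"
      and tr: "AE x in lebesgue_on torus. trace (G (x, t)) = 0" and mz: "cos_vec (\<lambda>_. 0) (slice \<Psi> t) = 0"
      and b: "\<forall>i. slice (\<lambda>z. b z $ i) t \<in> borel_measurable (lebesgue_on torus) \<and> integrable (lebesgue_on torus) (\<lambda>x. \<bar>b (x, t) $ i\<bar> ^ 3)"
      and \<Psi>: "\<forall>i. slice (\<lambda>z. \<Psi> z $ i) t \<in> borel_measurable (lebesgue_on torus) \<and> integrable (lebesgue_on torus) (\<lambda>x. \<bar>\<Psi> (x, t) $ i\<bar> ^ 3)"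
      and \<Psi>32: "\<forall>i. integrable (lebesgue_on torus) (\<lambda>x. \<bar>\<Psi> (x, t) $ i\<bar> powr (3/2))"
    have bi: "integrable (lebesgue_on torus) (\<lambda>x. b (x, t) $ i)" for i
      by (rule cube_integrable(1)[OF finite_measure_torus]) (use b in auto)
    have Q: "approx_helicity N (slice b t) = (\<Sum>i\<in>UNIV. smooth_pairing N (\<lambda>x. b (x, t) $ i) (\<lambda>x. \<Psi> (x, t) $ i))" for N
      by (rule approx_helicity_eq_pairing[OF W curl tr bi mz])
    have b\<Psi>: "integrable (lebesgue_on torus) (\<lambda>x. b (x, t) $ i * \<Psi> (x, t) $ i)" for i
      by (rule abs_integral_mult_le(1)[where l = 1]) (use b \<Psi> \<Psi>32 in auto)
    have "(\<lambda>N. approx_helicity N (slice b t)) \<longlonglongrightarrow> (\<Sum>i\<in>UNIV. LINT x|lebesgue_on torus. b (x, t) $ i * \<Psi> (x, t) $ i)"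
      unfolding Q using b \<Psi> \<Psi>32 by (intro tendsto_sum smooth_pairing_tendsto) auto
    also have "(\<Sum>i\<in>UNIV. LINT x|lebesgue_on torus. b (x, t) $ i * \<Psi> (x, t) $ i)
        = (LINT x|lebesgue_on torus. (\<Sum>i\<in>UNIV. b (x, t) $ i * \<Psi> (x, t) $ i))"
      using b\<Psi> by simp
    also have "\<dots> = H t" by (simp add: H_def inner_vec_def mult.commute)
    finally have "(\<lambda>N. approx_helicity N (slice b t)) \<longlonglongrightarrow> H t" .
    moreover have "\<bar>approx_helicity N (slice b t)\<bar> \<le> w t" for N
      unfolding Q w_def using b \<Psi> \<Psi>32 by (intro smooth_pairing_sum_bound) auto
    ultimately show "(\<forall>N. \<bar>approx_helicity N (slice b t)\<bar> \<le> w t) \<and> (\<lambda>N. approx_helicity N (slice b t)) \<longlonglongrightarrow> H t" by blast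
  qed
  have "(\<lambda>N. LINT t|time_measure T. \<bar>approx_helicity N (slice b t) - H t\<bar>) \<longlonglongrightarrow> (LINT t|time_measure T. 0)"
  proof (rule integral_dominated_convergence[where w = "\<lambda>t. w t + \<bar>H t\<bar>"])
    show "AE t in time_measure T. (\<lambda>N. \<bar>approx_helicity N (slice b t) - H t\<bar>) \<longlonglongrightarrow> 0"
      using main by eventually_elim (simp add: LIM_zero tendsto_rabs_zero)
    show "AE t in time_measure T. norm \<bar>approx_helicity N (slice b t) - H t\<bar> \<le> w t + \<bar>H t\<bar>" for N
      using main
    proof eventually_elim
      fix t assume "(\<forall>N. \<bar>approx_helicity N (slice b t)\<bar> \<le> w t) \<and> (\<lambda>N. approx_helicity N (slice b t)) \<longlonglongrightarrow> H t"
      then have "\<bar>approx_helicity N (slice b t)\<bar> \<le> w t" by blast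
      then show "norm \<bar>approx_helicity N (slice b t) - H t\<bar> \<le> w t + \<bar>H t\<bar>" by simp
    qed
    show "(\<lambda>t. \<bar>approx_helicity N (slice b t) - H t\<bar>) \<in> borel_measurable (time_measure T)" for N
      using borel_measurable_integrable[OF Qi[of N]] borel_measurable_integrable[OF Hi] by measurable
  qed (use wi Hi in auto)
  then show "(\<lambda>N. LINT t|time_measure T. \<bar>approx_helicity N (slice b t) - (LINT x|lebesgue_on torus. \<Psi> (x, t) \<bullet> b (x, t))\<bar>) \<longlonglongrightarrow> 0"
    by (simp add: H_def)
qed

text \<open>The frequency tail integrated in time. It depends on the field only through the L^2 norm
  and is therefore uniform along the sequence.\<close>

lemma integral_abs_approx_helicity_diff_le:
  assumes b: "Lp 3 (space_time T) b" and i: "\<And>N. integrable (time_measure T) (\<lambda>t. approx_helicity N (slice b t))"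
    and NM: "N \<le> M" and e: "\<And>k. \<bar>freq_weight N k - freq_weight M k\<bar> / norm (freq k) \<le> e"
  shows "(LINT t|time_measure T. \<bar>approx_helicity N (slice b t) - approx_helicity M (slice b t)\<bar>)
    \<le> e * (LINT z|st_measure T. (norm (b z))\<^sup>2)"
proof -
  note b2 = Lp3_component_integrable(2)[OF b]
  have si: "integrable (time_measure T) (\<lambda>t. \<Sum>i\<in>UNIV. LINT x|lebesgue_on torus. (b (x, t) $ i)\<^sup>2)"
    by (intro Bochner_Integration.integrable_sum st_Fubini(2) b2)
  have "(LINT t|time_measure T. \<bar>approx_helicity N (slice b t) - approx_helicity M (slice b t)\<bar>)
      \<le> (LINT t|time_measure T. e * (\<Sum>i\<in>UNIV. LINT x|lebesgue_on torus. (b (x, t) $ i)\<^sup>2))"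
  proof (rule integral_mono_AE)
    show "AE t in time_measure T. \<bar>approx_helicity N (slice b t) - approx_helicity M (slice b t)\<bar>
        \<le> e * (\<Sum>i\<in>UNIV. LINT x|lebesgue_on torus. (b (x, t) $ i)\<^sup>2)"
      using Lp3_slice[OF b]
    proof eventually_elim
      fix t assume s: "\<forall>i. slice (\<lambda>z. b z $ i) t \<in> borel_measurable (lebesgue_on torus) \<and>
        integrable (lebesgue_on torus) (\<lambda>x. \<bar>b (x, t) $ i\<bar> ^ 3)"
      have "integrable (lebesgue_on torus) (\<lambda>x. b (x, t) $ i)" "integrable (lebesgue_on torus) (\<lambda>x. (b (x, t) $ i)\<^sup>2)" for i
        by (rule cube_integrable[OF finite_measure_torus]; use s in simp)+
      then show "\<bar>approx_helicity N (slice b t) - approx_helicity M (slice b t)\<bar>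
          \<le> e * (\<Sum>i\<in>UNIV. LINT x|lebesgue_on torus. (b (x, t) $ i)\<^sup>2)"
        by (rule abs_approx_helicity_diff_le[OF _ _ NM e])
    qed
  qed (use i si in auto)
  also have "\<dots> = e * (\<Sum>i\<in>UNIV. LINT t|time_measure T. LINT x|lebesgue_on torus. (b (x, t) $ i)\<^sup>2)"
    using st_Fubini(2)[OF b2] by simp
  also have "(\<Sum>i\<in>UNIV. LINT t|time_measure T. LINT x|lebesgue_on torus. (b (x, t) $ i)\<^sup>2)
      = (\<Sum>i\<in>UNIV. LINT z|st_measure T. (b z $ i)\<^sup>2)"
    by (simp only: st_Fubini(3)[OF b2])
  also have "\<dots> = (LINT z|st_measure T. (norm (b z))\<^sup>2)"
    using b2 by (simp add: norm_square_vec3)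
  finally show ?thesis .
qed

theorem theorem5p5:
  fixes T :: real
    and bj uj :: "nat \<Rightarrow> (real^3) \<times> real \<Rightarrow> real^3"
    and qj :: "nat \<Rightarrow> (real^3) \<times> real \<Rightarrow> real"
    and b u \<Psi> :: "(real^3) \<times> real \<Rightarrow> real^3"
    and q :: "(real^3) \<times> real \<Rightarrow> real"
  assumes "T > 0"
    and "\<And>j. Lp 3 (space_time T) (bj j)"
    and "\<And>j. Lp 3 (space_time T) (uj j)"
    and "\<And>j. L1_loc T (qj j)"
    and "\<And>j. ideal_MHD T (bj j) (uj j) (qj j)"
    and "\<And>j. mean_zero T (uj j)"
    and "\<And>j. mean_zero T (bj j)"
    and "weakly_converges_L3 (space_time T) bj b"
    and "weakly_converges_L3 (space_time T) uj u"
    and "weakly_converges_L1_loc T qj q"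
    and "vector_potential T b \<Psi>"
  shows "conserves_magnetic_helicity T b \<Psi>"
proof -
  note T = assms(1) and bj = assms(2) and uj = assms(3) and mhd = assms(5) and mz = assms(7)
    and wb = assms(8) and wu = assms(9) and pot = assms(11)
  have b: "Lp 3 (space_time T) b" using wb by (simp add: weakly_converges_L3_def)
  define Q where "Q N v t = approx_helicity N (slice v t)" for N and v :: "(real^3) \<times> real \<Rightarrow> real^3" and t
  define H where "H t = (LINT x|lebesgue_on torus. \<Psi> (x, t) \<bullet> b (x, t))" for t
  have conv: "L1_converges T (\<lambda>j. Q N (bj j)) (Q N b)" for N
    unfolding Q_def[abs_def] by (rule approx_helicity_converges[OF T bj uj mhd wb wu])
  then have Qji: "integrable (time_measure T) (Q N (bj j))" and Qi: "integrable (time_measure T) (Q N b)"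
    and Qlim: "(\<lambda>j. LINT t|time_measure T. \<bar>Q N (bj j) t - Q N b t\<bar>) \<longlonglongrightarrow> 0" for N j
    by (auto simp: L1_converges_def)
  have Hi: "integrable (time_measure T) H"
    and Hlim: "(\<lambda>N. LINT t|time_measure T. \<bar>Q N b t - H t\<bar>) \<longlonglongrightarrow> 0"
    using approx_helicity_tendsto_helicity[OF T b pot Qi[unfolded Q_def[abs_def]]]
    by (simp_all add: Q_def H_def[abs_def])
  obtain C0 where C0: "\<And>j. (LINT z|st_measure T. (norm (bj j z))\<^sup>2) \<le> C0"
    using weakly_converges_L3_bounded[OF wb] by blast
  \<comment> \<open>Made strictly positive, so that \<open>e\<close> can be chosen as d / (2 C) at
    the end.\<close>
  define C where "C = max C0 0 + 1"
  have C: "0 < C" "\<And>j. (LINT z|st_measure T. (norm (bj j z))\<^sup>2) \<le> C"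
    using C0 by (auto simp: C_def intro: order_trans[of _ C0])
  have osc_small: "oscillation T H \<le> 2 * (e * C)" if e: "0 < e" for e
  proof -
    obtain N0 where N0: "\<And>N M k. N \<ge> N0 \<Longrightarrow> M \<ge> N0 \<Longrightarrow> \<bar>freq_weight N k - freq_weight M k\<bar> / norm (freq k) \<le> e"
      using freq_weight_uniform[OF e] by blast
    \<comment> \<open>\<open>j\<close> and \<open>N\<close> are fixed while \<open>M\<close> grows.
      The oscillation at cut-off \<open>M\<close> vanishes in the limit at a speed depending on
      \<open>j\<close>, but the distance between the cut-offs stays below e C for all
      \<open>j\<close>.\<close>
    have oscj: "oscillation T (Q N (bj j)) \<le> 2 * (e * C)" if N: "N \<ge> N0" for N j
    proof -
      have osc0: "(\<lambda>M. oscillation T (Q M (bj j))) \<longlonglongrightarrow> 0"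
        unfolding Q_def[abs_def] by (rule oscillation_approx_helicity_tendsto_0[OF T bj uj mhd mz])
      have "(\<lambda>M. oscillation T (Q M (bj j)) + 2 * (e * C)) \<longlonglongrightarrow> 0 + 2 * (e * C)"
        by (intro tendsto_intros osc0)
      then have "oscillation T (Q N (bj j)) \<le> 0 + 2 * (e * C)"
      proof (rule LIMSEQ_le_const)
        show "\<exists>K. \<forall>M\<ge>K. oscillation T (Q N (bj j)) \<le> oscillation T (Q M (bj j)) + 2 * (e * C)"
        proof (intro exI allI impI)
          fix M assume M: "N \<le> M"
          have "(LINT t|time_measure T. \<bar>Q N (bj j) t - Q M (bj j) t\<bar>) \<le> e * (LINT z|st_measure T. (norm (bj j z))\<^sup>2)"
            unfolding Q_def
            by (rule integral_abs_approx_helicity_diff_le[OF bj Qji[unfolded Q_def[abs_def]] M N0]) (use N M in auto)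
          also have "\<dots> \<le> e * C" using e C(2) by (intro mult_left_mono) auto
          finally show "oscillation T (Q N (bj j)) \<le> oscillation T (Q M (bj j)) + 2 * (e * C)"
            using oscillation_diff_le[OF T Qji[of N j] Qji[of M j]] by linarith
        qed
      qed
      then show ?thesis by simp
    qed
    \<comment> \<open>Now \<open>j\<close> grows at fixed \<open>N\<close>, where only finitely many
      modes matter.\<close>
    have oscb: "oscillation T (Q N b) \<le> 2 * (e * C)" if N: "N \<ge> N0" for N
    proof -
      have "(\<lambda>j. 2 * (e * C) + 2 * (LINT t|time_measure T. \<bar>Q N (bj j) t - Q N b t\<bar>)) \<longlonglongrightarrow> 2 * (e * C) + 2 * 0"
        by (intro tendsto_intros Qlim)
      then have "oscillation T (Q N b) \<le> 2 * (e * C) + 2 * 0"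
      proof (rule LIMSEQ_le_const, intro exI allI impI)
        fix j
        show "oscillation T (Q N b) \<le> 2 * (e * C) + 2 * (LINT t|time_measure T. \<bar>Q N (bj j) t - Q N b t\<bar>)"
          using oscillation_diff_le[OF T Qi[of N] Qji[of N j]] oscj[OF N, of j] by (simp add: abs_minus_commute)
      qed
      then show ?thesis by simp
    qed
    \<comment> \<open>Finally \<open>N\<close> grows at fixed \<open>e\<close>, which replaces the
      regularised helicity of the limit by the helicity \<open>H\<close> itself.\<close>
    have "(\<lambda>N. 2 * (e * C) + 2 * (LINT t|time_measure T. \<bar>Q N b t - H t\<bar>)) \<longlonglongrightarrow> 2 * (e * C) + 2 * 0"
      by (intro tendsto_intros Hlim)
    then have "oscillation T H \<le> 2 * (e * C) + 2 * 0"
    proof (rule LIMSEQ_le_const)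
      show "\<exists>K. \<forall>N\<ge>K. oscillation T H \<le> 2 * (e * C) + 2 * (LINT t|time_measure T. \<bar>Q N b t - H t\<bar>)"
      proof (intro exI allI impI)
        fix N assume "N0 \<le> N"
        then show "oscillation T H \<le> 2 * (e * C) + 2 * (LINT t|time_measure T. \<bar>Q N b t - H t\<bar>)"
          using oscillation_diff_le[OF T Hi Qi[of N]] oscb[of N] by (simp add: abs_minus_commute)
      qed
    qed
    then show ?thesis by simp
  qed
  have "oscillation T H \<le> 0 + d" if d: "0 < d" for d
    using osc_small[of "d / (2 * C)"] d C(1) by simp
  then have "oscillation T H \<le> 0" by (rule field_le_epsilon)
  then have "oscillation T H = 0" using oscillation_nonneg[of T H] by linarith
  from AE_const_if_oscillation_0[OF Hi this] show ?thesis
    unfolding conserves_magnetic_helicity_def H_def .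
qed

end
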